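(* Let $\mu$ be the random limiting measure on $\partial\mathcal N=\{1,\dots,K\}^\infty$ determined by the random growing tree, let $\partial\mathcal N$ be equipped with the metric $d$ with parameter $0<\Lambda<1$, and let $h$ be the almost surely constant limit $h=\lim_{n\to\infty}\frac1nH_n$. Then the Hausdorff dimension $\dim_{\mathrm H}\mu$ and the packing dimension $\dim_{\mathrm P}\mu$ are constant and equal with probability one, and with probability one $$\dim_{\mathrm H}\mu=\dim_{\mathrm P}\mu=\frac{h}{-\log\Lambda}.$$ Moreover, with probability one, at $\mu$-almost every point the local dimension of $\mu$ (exists and) equals $\dim_{\mathrm H}\mu=\dim_{\mathrm P}\mu$.
   Context: Fix an integer $K\ge 2$, let $\mathbb I=\{1,\dots,K\}$, and fix a weight function $w:\{0,1,\dots,K-1\}\to(0,\infty)$. Let $\mathcal N=\bigcup_{n\ge 0}\mathbb I^n$ be the set of finite words over $\mathbb I$ ($\mathbb I^0=\{\emptyset\}$, $\emptyset$ is the root); $xi$ is the $i$-th child of $x$, $|x|$ is the length of $x$, and $xy$ denotes concatenation. A finite rooted ordered tree is a finite set $G\subset\mathcal N$ containing $\emptyset$ and such that $yi\in G$ implies $y\in G$, and $y(i-1)\in G$ if $i>1$; $\deg(x,G)$ is the number of children of $x$ in $G$. The random tree $\Upsilon(t)$, $t\ge 0$, is the right-continuous continuous-time Markov chain on finite rooted ordered trees with $\Upsilon(0)=\{\emptyset\}$ such that from $G$, for every $x\in G$ with $\deg(x,G)=j<K$, it jumps to $G\cup\{x(j+1)\}$ with rate $w(j)$. Let $\tau_x$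 be the birth time of $x$ (the first time $x$ is in the tree, $\tau_\emptyset=0$), $\sigma_\emptyset=0$, $\sigma_{y1}=\tau_{y1}-\tau_y$ and $\sigma_{yi}=\tau_{yi}-\tau_{y(i-1)}$ for $i\ge 2$. Equivalently in law: the $\sigma_{yi}$ ($y\in\mathcal N$, $i\in\mathbb I$) are independent, $\sigma_{yi}$ is exponential with parameter (rate) $w(i-1)$, $\tau_{yi}=\tau_y+\sigma_{y1}+\dots+\sigma_{yi}$, and $\Upsilon(t)=\{x:\tau_x\le t\}$. $\lambda^*>0$ denotes the unique positive root of $\sum_{j=1}^K\prod_{i=0}^{j-1}\frac{w(i)}{\lambda+w(i)}=1$. For $x\in\mathcal N$ let $\Theta_x=\lim_{t\to\infty}e^{-\lambda^*(t-\tau_x)}|\{y:xy\in\Upsilon(t)\}|$, and $\Theta=\Theta_\emptyset$ (it is known that these limits exist almost surely, lie in $(0,\infty)$, and have finite second moment). Let $$\Delta_x=\lim_{t\to\infty}\frac{|\{y:xy\in\Upsilon(t)\}|}{|\Upsilon(t)|}=\frac{e^{-\lambda^*\tau_x}\Theta_x}{\Theta}.$$ Almost surely $\Delta_\emptyset=1$ and $\Delta_y=\sum_{i=1}^K\Delta_{yi}$. Set $\mu_n(\{x\})=\Delta_x$ for $|x|=n$ and $H_n=-\sum_{|x|=n}\Delta_x\log\Delta_x$. The limit $\lim_n\frac1nH_n$ exists almost surely and is an almost sure constant, denoted $h$. $\partial\mathcal N=\{1,\dots,K\}^\infty$ is the set of leaves; for $x\in\mathcal N$, $\partial\mathcal N(x)=\{z\in\partial\mathcal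 N: x\text{ is an initial segment of }z\}$; $z|_n$ is the initial segment of $z$ of length $n$. The metric is $d(x,y)=\Lambda^{\max\{n: x|_n=y|_n\}}$ for $x\ne y$ (and $d(x,x)=0$), where $0<\Lambda<1$ is an arbitrary fixed constant. $\mu$ is the (random) Borel probability measure on $\partial\mathcal N$ with $\mu(\partial\mathcal N(x))=\Delta_x$ for all $x\in\mathcal N$. With $B(x,r)$ the ball of radius $r$ around $x$, the lower and upper local dimensions are $\underline{\dim}_{\mathrm{loc}}\mu(x)=\liminf_{r\to0}\frac{\log\mu(B(x,r))}{\log r}$ and $\overline{\dim}_{\mathrm{loc}}\mu(x)=\limsup_{r\to0}\frac{\log\mu(B(x,r))}{\log r}$; when they coincide the common value is the local dimension at $x$. The dimensions of $\mu$ are $\dim_{\mathrm H}\mu=\sup\{s:\underline{\dim}_{\mathrm{loc}}\mu(x)\ge s\text{ for }\mu\text{-a.e. }x\}$ and $\dim_{\mathrm P}\mu=\sup\{s:\overline{\dim}_{\mathrm{loc}}\mu(x)\ge s\text{ for }\mu\text{-a.e. }x\}$. *)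

theory Defs
  imports "HOL-Probability.Probability"
begin

section \<open>The random tree\<close>

definition words :: "nat \<Rightarrow> nat list set" where
  "words K = lists {1..K}"

text \<open>
  The random tree is built on a sample space \<open>'a\<close> from the family of waiting times
  \<open>\<sigma> x \<omega>\<close>, for \<open>x\<close> a nonempty word: the time between the birth of \<open>x\<close> and the birth
  of its preceding sibling (or of its parent, if \<open>x\<close> is a first child).
  If these are independent and \<open>\<sigma> (y @ [i])\<close> is exponential with rate \<open>w (i - 1)\<close>, then
  \<open>t \<mapsto> tree K \<sigma> t\<close> is the Markov chain that starts from the root alone and adds a
  further child to a vertex with currently \<open>j < K\<close> children at rate \<open>w j\<close>.
\<close>

function birth_time :: "(nat list \<Rightarrow> 'a \<Rightarrow> real) \<Rightarrow> nat list \<Rightarrow> 'a \<Rightarrow> real" where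
  "birth_time \<sigma> x \<omega> =
    (if x = [] then 0
     else birth_time \<sigma> (butlast x) \<omega> + (\<Sum>j=1..last x. \<sigma> (butlast x @ [j]) \<omega>))"
  by pat_completeness auto
termination by (relation "Wellfounded.measure (\<lambda>(_, x, _). length x)") auto

declare birth_time.simps [simp del]

lemma birth_time_Nil [simp]: "birth_time \<sigma> [] \<omega> = 0"
  by (subst birth_time.simps) simp

lemma birth_time_snoc:
  "birth_time \<sigma> (y @ [i]) \<omega> = birth_time \<sigma> y \<omega> + (\<Sum>j=1..i. \<sigma> (y @ [j]) \<omega>)"
  by (subst birth_time.simps) simp

definition tree :: "nat \<Rightarrow> (nat list \<Rightarrow> 'a \<Rightarrow> real) \<Rightarrow> real \<Rightarrow> 'a \<Rightarrow> nat list set" where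
  "tree K \<sigma> t \<omega> = {x \<in> words K. birth_time \<sigma> x \<omega> \<le> t}"

text \<open>
  The limiting proportion of the descendants of \<open>x\<close>. The tree is almost surely finite at
  all times and the limit almost surely exists; elsewhere the value is arbitrary.
\<close>

definition limit_mass :: "nat \<Rightarrow> (nat list \<Rightarrow> 'a \<Rightarrow> real) \<Rightarrow> nat list \<Rightarrow> 'a \<Rightarrow> real" where
  "limit_mass K \<sigma> x \<omega> =
    Lim at_top (\<lambda>t. real (card {y. x @ y \<in> tree K \<sigma> t \<omega>}) / real (card (tree K \<sigma> t \<omega>)))"

definition level_entropy :: "nat \<Rightarrow> (nat list \<Rightarrow> 'a \<Rightarrow> real) \<Rightarrow> nat \<Rightarrow> 'a \<Rightarrow> real" where
  "level_entropy K \<sigma> n \<omega> =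
    - (\<Sum>x \<in> {x \<in> words K. length x = n}. limit_mass K \<sigma> x \<omega> * ln (limit_mass K \<sigma> x \<omega>))"


section \<open>The space of leaves\<close>

text \<open>Sequences are indexed from \<open>0\<close>, so \<open>z 0\<close> is the first letter of \<open>z\<close>.\<close>

definition leaves :: "nat \<Rightarrow> (nat \<Rightarrow> nat) set" where
  "leaves K = {z. \<forall>n. z n \<in> {1..K}}"

definition initial_segment :: "nat \<Rightarrow> (nat \<Rightarrow> nat) \<Rightarrow> nat list" where
  "initial_segment n z = map z [0..<n]"

definition cylinder :: "nat \<Rightarrow> nat list \<Rightarrow> (nat \<Rightarrow> nat) set" where
  "cylinder K x = {z \<in> leaves K. initial_segment (length x) z = x}"

definition leaf_dist :: "real \<Rightarrow> (nat \<Rightarrow> nat) \<Rightarrow> (nat \<Rightarrow> nat) \<Rightarrow> real" where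
  "leaf_dist \<Lambda> x y =
    (if x = y then 0 else \<Lambda> ^ Max {n. initial_segment n x = initial_segment n y})"

lemma initial_segment_eq_iff:
  "initial_segment n x = initial_segment n y \<longleftrightarrow> (\<forall>k<n. x k = y k)"
  by (auto simp: initial_segment_def)

lemma Metric_space_leaves:
  assumes "0 < \<Lambda>" "\<Lambda> < 1"
  shows "Metric_space (leaves K) (leaf_dist \<Lambda>)"
proof
  fix x y z :: "nat \<Rightarrow> nat"
  let ?A = "\<lambda>x y :: nat \<Rightarrow> nat. {n. initial_segment n x = initial_segment n y}"
  have fin: "finite (?A x y)" and zero: "0 \<in> ?A x y" if ne: "x \<noteq> y" for x y
  proof -
    obtain k where k: "x k \<noteq> y k" using ne by auto
    have "?A x y \<subseteq> {..k}"
    proof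
      fix n assume "n \<in> ?A x y"
      then have "\<forall>j<n. x j = y j" by (simp add: initial_segment_eq_iff)
      with k show "n \<in> {..k}" by (metis atMost_iff not_le)
    qed
    then show "finite (?A x y)" by (rule finite_subset) simp
    show "0 \<in> ?A x y" by (simp add: initial_segment_eq_iff)
  qed
  show "0 \<le> leaf_dist \<Lambda> x y" using assms by (simp add: leaf_dist_def)
  show "leaf_dist \<Lambda> x y = leaf_dist \<Lambda> y x"
    by (simp add: leaf_dist_def initial_segment_eq_iff eq_commute[of "x _" "y _"] eq_commute[of x y])
  show "leaf_dist \<Lambda> x y = 0 \<longleftrightarrow> x = y" using assms by (simp add: leaf_dist_def)
  show "leaf_dist \<Lambda> x z \<le> leaf_dist \<Lambda> x y + leaf_dist \<Lambda> y z"
  proof (cases "x = y \<or> y = z \<or> x = z")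
    case True
    then show ?thesis using assms by (auto simp: leaf_dist_def)
  next
    case False
    let ?m = "min (Max (?A x y)) (Max (?A y z))"
    have "Max (?A x y) \<in> ?A x y"
      using False fin[of x y] zero[of x y] by (intro Max_in) auto
    moreover have "Max (?A y z) \<in> ?A y z"
      using False fin[of y z] zero[of y z] by (intro Max_in) auto
    ultimately have "?m \<in> ?A x z" by (auto simp: initial_segment_eq_iff)
    then have "?m \<le> Max (?A x z)" using False fin[of x z] by (intro Max_ge) auto
    then have "\<Lambda> ^ Max (?A x z) \<le> \<Lambda> ^ ?m"
      using assms by (intro power_decreasing) auto
    also have "\<dots> \<le> \<Lambda> ^ Max (?A x y) + \<Lambda> ^ Max (?A y z)"
      using assms by (auto simp: min_def)
    finally show ?thesis using False by (simp add: leaf_dist_def)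
  qed
qed

definition leaf_ball :: "nat \<Rightarrow> real \<Rightarrow> (nat \<Rightarrow> nat) \<Rightarrow> real \<Rightarrow> (nat \<Rightarrow> nat) set" where
  "leaf_ball K \<Lambda> = Metric_space.mball (leaves K) (leaf_dist \<Lambda>)"

definition leaf_borel :: "nat \<Rightarrow> real \<Rightarrow> (nat \<Rightarrow> nat) measure" where
  "leaf_borel K \<Lambda> =
    sigma (leaves K) {U. openin (Metric_space.mtopology (leaves K) (leaf_dist \<Lambda>)) U}"


section \<open>The limiting measure and dimensions\<close>

definition limiting_measure ::
    "nat \<Rightarrow> real \<Rightarrow> (nat list \<Rightarrow> 'a \<Rightarrow> real) \<Rightarrow> 'a \<Rightarrow> (nat \<Rightarrow> nat) measure \<Rightarrow> bool" where
  "limiting_measure K \<Lambda> \<sigma> \<omega> \<nu> \<longleftrightarrow>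
    space \<nu> = space (leaf_borel K \<Lambda>) \<and> sets \<nu> = sets (leaf_borel K \<Lambda>) \<and>
    prob_space \<nu> \<and> (\<forall>x \<in> words K. measure \<nu> (cylinder K x) = limit_mass K \<sigma> x \<omega>)"

text \<open>
  Since \<open>ln 0 = 0\<close> for reals, the convention \<open>log 0 = -\<infinity>\<close> has to be made explicit. With it,
  the local dimensions are infinite at points outside the support of the measure.
\<close>

definition ext_log :: "real \<Rightarrow> ereal" where
  "ext_log p = (if p = 0 then -\<infinity> else ereal (ln p))"

definition lower_local_dim ::
    "nat \<Rightarrow> real \<Rightarrow> (nat \<Rightarrow> nat) measure \<Rightarrow> (nat \<Rightarrow> nat) \<Rightarrow> ereal" where
  "lower_local_dim K \<Lambda> \<nu> x =
    Liminf (at_right 0) (\<lambda>r. ext_log (measure \<nu> (leaf_ball K \<Lambda> x r)) / ereal (ln r))"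

definition upper_local_dim ::
    "nat \<Rightarrow> real \<Rightarrow> (nat \<Rightarrow> nat) measure \<Rightarrow> (nat \<Rightarrow> nat) \<Rightarrow> ereal" where
  "upper_local_dim K \<Lambda> \<nu> x =
    Limsup (at_right 0) (\<lambda>r. ext_log (measure \<nu> (leaf_ball K \<Lambda> x r)) / ereal (ln r))"

definition has_local_dim ::
    "nat \<Rightarrow> real \<Rightarrow> (nat \<Rightarrow> nat) measure \<Rightarrow> (nat \<Rightarrow> nat) \<Rightarrow> ereal \<Rightarrow> bool" where
  "has_local_dim K \<Lambda> \<nu> x s \<longleftrightarrow> lower_local_dim K \<Lambda> \<nu> x = s \<and> upper_local_dim K \<Lambda> \<nu> x = s"

definition hausdorff_dim :: "nat \<Rightarrow> real \<Rightarrow> (nat \<Rightarrow> nat) measure \<Rightarrow> ereal" where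
  "hausdorff_dim K \<Lambda> \<nu> = Sup {s. AE x in \<nu>. s \<le> lower_local_dim K \<Lambda> \<nu> x}"

definition packing_dim :: "nat \<Rightarrow> real \<Rightarrow> (nat \<Rightarrow> nat) measure \<Rightarrow> ereal" where
  "packing_dim K \<Lambda> \<nu> = Sup {s. AE x in \<nu>. s \<le> upper_local_dim K \<Lambda> \<nu> x}"

end

(*
  Write phi r for the sum over the children of the root of E exp (- r * birth time) and choose
  the Malthusian parameter with phi malthus = 1. For r > malthus the exponential sums of the
  birth times, normalised by their mean 1 / (1 - phi r), have mean 1 and satisfy a recursion
  through the first generation in which the subtrees are independent; this contracts second
  moments by phi (2 * malthus) < 1. So these sums converge, along a sequence of r decreasing to
  malthus, to a positive square integrable limit W, and every word x receives the mass
  D x = exp (- malthus * birth time of x) * W (subtree of x) / W.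

  By an Abelian argument, whenever the proportion of descendants of x converges at all, its limit
  is D x. Existence of the limit is not needed: where it fails, the limiting mass is one fixed
  junk value, and since the limiting masses are additive along the tree while max {D y: |y| = n}
  tends to 0, this never happens with a value different from D x.

  Weighted by D, the birth times along the tree are sums of independent variables. Chernoff and
  Markov bounds, all in terms of the first moments phi r ^ n of level sums, give that the total mass
  of the words x of length n with |- ln (D x) - c * n| > e * n is summable in n, where
  c = - malthus * phi' malthus. By Borel-Cantelli - ln (D x) / n tends to c along almost every
  leaf; the masses of level n also satisfy H_n / n -> c, because at most K ^ n words contribute,
  and so c = h.
*)
theory Submission
  imports Defs
begin

section \<open>Words and flows on the tree\<close>

text \<open>The counts of the tree enter only through Laplace transforms: \<open>total r\<close> is
  \<open>r\<close> times the Laplace transform of the population size in time. This is why all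
  generations are summed at exponents above \<open>malthus\<close> instead of following the
  generation sums at \<open>malthus\<close> itself. Passing from transforms back to counts is
  Tauberian and delicate; passing from counts to transforms is elementary. The information that is
  missing is supplied by \<open>\<mu>\<close> being a measure, which makes the limiting masses
  additive. The contraction works on mean zero variables, because mixed terms of distinct subtrees
  see only the mean. The normalisation by \<open>1 - phi r\<close> gives all \<open>ntotal r\<close>
  the same mean, so their differences have mean zero. The sequence \<open>rs\<close> is chosen by
  values of \<open>phi\<close>, which makes second moments of increments geometric. Probability
  takes place on the product space \<open>law\<close> of waiting times, where passing to the subtree
  at \<open>x\<close> is the measure preserving map \<open>shift x\<close>; the last proof
  transports the result to the given sample space.\<close>

lemma Nil_in_words [simp]: "[] \<in> words K"
  by (simp add: words_def)

lemma append_in_words [simp]: "x @ y \<in> words K \<longleftrightarrow> x \<in> words K \<and> y \<in> words K"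
  by (auto simp: words_def)

lemma Cons_in_words [simp]: "i # y \<in> words K \<longleftrightarrow> i \<in> {1..K} \<and> y \<in> words K"
  by (auto simp: words_def)

definition lvl :: "nat \<Rightarrow> nat \<Rightarrow> nat list set" where
  "lvl K n = {x \<in> words K. length x = n}"

lemma lvl_alt: "lvl K n = {x. set x \<subseteq> {1..K} \<and> length x = n}"
  by (auto simp: lvl_def words_def lists_eq_set)

lemma finite_lvl [simp]: "finite (lvl K n)"
  unfolding lvl_alt by (rule finite_lists_length_eq) simp

lemma card_lvl: "card (lvl K n) = K ^ n"
  unfolding lvl_alt by (subst card_lists_length_eq) simp_all

lemma lvl_0 [simp]: "lvl K 0 = {[]}"
  by (auto simp: lvl_def)

lemma lvl_subset_words: "x \<in> lvl K n \<Longrightarrow> x \<in> words K"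
  by (simp add: lvl_def)

lemma sum_lvl_Suc:
  fixes f :: "nat list \<Rightarrow> 'b :: comm_monoid_add"
  shows "(\<Sum>x\<in>lvl K (Suc n). f x) = (\<Sum>i=1..K. \<Sum>x\<in>lvl K n. f (i # x))"
proof -
  have eq: "lvl K (Suc n) = (\<lambda>(i, x). i # x) ` ({1..K} \<times> lvl K n)"
    by (auto simp: lvl_def length_Suc_conv image_iff)
  have "inj_on (\<lambda>(i, x). i # x) ({1..K} \<times> lvl K n)"
    by (auto simp: inj_on_def)
  then have "(\<Sum>x\<in>lvl K (Suc n). f x) = (\<Sum>(i, x)\<in>{1..K} \<times> lvl K n. f (i # x))"
    unfolding eq by (subst sum.reindex) (auto intro!: sum.cong)
  then show ?thesis by (simp add: sum.cartesian_product)
qed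

lemma sum_lvl_Suc_snoc:
  fixes f :: "nat list \<Rightarrow> 'b :: comm_monoid_add"
  shows "(\<Sum>x\<in>lvl K (Suc n). f x) = (\<Sum>x\<in>lvl K n. \<Sum>i=1..K. f (x @ [i]))"
proof -
  have eq: "lvl K (Suc n) = (\<lambda>(x, i). x @ [i]) ` (lvl K n \<times> {1..K})"
  proof (intro set_eqI iffI)
    fix z assume "z \<in> lvl K (Suc n)"
    then show "z \<in> (\<lambda>(x, i). x @ [i]) ` (lvl K n \<times> {1..K})"
      by (cases z rule: rev_cases) (auto simp: lvl_def image_iff)
  qed (auto simp: lvl_def)
  have "inj_on (\<lambda>(x, i). x @ [i]) (lvl K n \<times> {1..K})"
    by (auto simp: inj_on_def)
  then have "(\<Sum>x\<in>lvl K (Suc n). f x) = (\<Sum>(x, i)\<in>lvl K n \<times> {1..K}. f (x @ [i]))"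
    unfolding eq by (subst sum.reindex) (auto intro!: sum.cong)
  then show ?thesis by (simp add: sum.cartesian_product)
qed

lemma sum_lvl_flow:
  fixes m :: "nat list \<Rightarrow> real"
  assumes "\<And>x. x \<in> words K \<Longrightarrow> m x = (\<Sum>i=1..K. m (x @ [i]))" and x: "x \<in> words K"
  shows "(\<Sum>y\<in>lvl K n. m (x @ y)) = m x"
proof (induction n)
  case (Suc n)
  have "(\<Sum>y\<in>lvl K (Suc n). m (x @ y)) = (\<Sum>y\<in>lvl K n. \<Sum>i=1..K. m ((x @ y) @ [i]))"
    by (simp add: sum_lvl_Suc_snoc)
  also have "\<dots> = (\<Sum>y\<in>lvl K n. m (x @ y))"
    by (intro sum.cong refl assms(1)[symmetric]) (use x in \<open>auto simp: lvl_def\<close>)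
  finally show ?case using Suc by simp
qed simp

text \<open>Suppose \<open>m\<close> and \<open>D\<close> differ at \<open>x\<close>, so
  \<open>m x = c\<close>. If \<open>c = 0\<close>, then \<open>m\<close> never exceeds
  \<open>D\<close> and is smaller at \<open>x\<close>, against equal totals on the level of
  \<open>x\<close>. If \<open>c > 0\<close>, every disagreeing descendant carries the value
  \<open>c\<close>, the whole \<open>m\<close>-mass below \<open>x\<close>, so each depth has
  exactly one. Its \<open>D\<close>-mass must be at least \<open>D x\<close>, which is impossible
  once all \<open>D\<close>-masses at that depth are small.\<close>

lemma flow_eqI:
  fixes m D :: "nat list \<Rightarrow> real"
  assumes m: "\<And>x. x \<in> words K \<Longrightarrow> m x = (\<Sum>i=1..K. m (x @ [i]))"
    and D: "\<And>x. x \<in> words K \<Longrightarrow> D x = (\<Sum>i=1..K. D (x @ [i]))"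
    and m_nonneg: "\<And>x. x \<in> words K \<Longrightarrow> 0 \<le> m x"
    and D_pos: "\<And>x. x \<in> words K \<Longrightarrow> 0 < D x"
    and root: "m [] = 1" "D [] = 1"
    and cases: "\<And>x. x \<in> words K \<Longrightarrow> m x = D x \<or> m x = c"
    and small: "(\<lambda>n. \<Sum>x\<in>lvl K n. (D x)\<^sup>2) \<longlonglongrightarrow> 0"
    and x: "x \<in> words K"
  shows "m x = D x"
proof (rule ccontr)
  assume neq: "m x \<noteq> D x"
  then have mx: "m x = c" using cases x by blast
  define l where "l = length x"
  show False
  proof (cases "c = 0")
    case True
    have "(\<Sum>y\<in>lvl K l. m y) < (\<Sum>y\<in>lvl K l. D y)"
    proof (rule sum_strict_mono_strong)
      show "x \<in> lvl K l" using x by (simp add: lvl_def l_def)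
      show "m x < D x" using mx True D_pos[OF x] by simp
      show "m y \<le> D y" if "y \<in> lvl K l" for y
        using cases[OF lvl_subset_words[OF that]] D_pos[OF lvl_subset_words[OF that]] True by linarith
    qed simp
    moreover have "(\<Sum>y\<in>lvl K l. m y) = 1" "(\<Sum>y\<in>lvl K l. D y) = 1"
      using sum_lvl_flow[OF m Nil_in_words, of l] sum_lvl_flow[OF D Nil_in_words, of l] root
      by auto
    ultimately show False by simp
  next
    case False
    then have c: "0 < c" using m_nonneg[OF x] mx by simp
    \<comment> \<open>With \<open>c * card S \<le> c\<close> and \<open>c \<le> 1\<close>, the words
      in \<open>S\<close> then carry at most half of \<open>D x\<close>.\<close>
    define e where "e = c * D x / 2"
    have e: "0 < e" using c D_pos[OF x] by (simp add: e_def)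
    have "\<forall>\<^sub>F n in sequentially. (\<Sum>y\<in>lvl K n. (D y)\<^sup>2) < e\<^sup>2"
      using order_tendstoD(2)[OF small, of "e\<^sup>2"] e by simp
    then obtain N where N: "\<And>n. n \<ge> N \<Longrightarrow> (\<Sum>y\<in>lvl K n. (D y)\<^sup>2) < e\<^sup>2"
      by (auto simp: eventually_sequentially)
    have small': "D (x @ y) < e" if "y \<in> lvl K N" for y
    proof -
      have xy: "x @ y \<in> lvl K (l + N)" using that x by (auto simp: lvl_def l_def)
      \<comment> \<open>One square is at most the sum of all, so the hypothesis on squares controls
        the largest mass of a level.\<close>
      then have "(D (x @ y))\<^sup>2 \<le> (\<Sum>y\<in>lvl K (l + N). (D y)\<^sup>2)"
        by (intro member_le_sum) auto
      also have "\<dots> < e\<^sup>2" by (rule N) simp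
      finally show ?thesis using e by (meson less_imp_le power2_less_imp_less)
    qed
    define S where "S = {y \<in> lvl K N. m (x @ y) \<noteq> D (x @ y)}"
    have [simp]: "finite S" and S: "S \<subseteq> lvl K N" by (auto simp: S_def)
    have mS: "m (x @ y) = c" if "y \<in> S" for y
    proof -
      have "x @ y \<in> words K" "m (x @ y) \<noteq> D (x @ y)"
        using that x by (auto simp: S_def dest: lvl_subset_words)
      then show ?thesis using cases by blast
    qed
    have tot: "(\<Sum>y\<in>lvl K N. m (x @ y)) = c" "(\<Sum>y\<in>lvl K N. D (x @ y)) = D x"
      using sum_lvl_flow[OF m x, of N] sum_lvl_flow[OF D x, of N] mx by auto
    have "c - D x = (\<Sum>y\<in>lvl K N. m (x @ y) - D (x @ y))"
      by (simp add: sum_subtractf tot)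
    also have "\<dots> = (\<Sum>y\<in>S. m (x @ y) - D (x @ y))"
      by (rule sum.mono_neutral_right) (auto simp: S_def)
    also have "\<dots> = c * card S - (\<Sum>y\<in>S. D (x @ y))"
      by (simp add: sum_subtractf mS)
    finally have eq: "c - D x = c * card S - (\<Sum>y\<in>S. D (x @ y))" .
    \<comment> \<open>An empty \<open>S\<close> would give \<open>c = D x\<close>, that is,
      agreement at \<open>x\<close>.\<close>
    have "S \<noteq> {}" using eq neq mx by auto
    then have "1 \<le> card S" by (simp add: Suc_leI card_gt_0_iff)
    then have c1: "c * 1 \<le> c * card S" using c by (intro mult_left_mono) auto
    have "D x \<le> (\<Sum>y\<in>S. D (x @ y))" using eq c1 by simp
    also have "\<dots> \<le> (\<Sum>y\<in>S. e)"
      by (intro sum_mono less_imp_le small') (use S in auto)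
    also have "\<dots> = D x * (c * card S) / 2" by (simp add: e_def)
    also have "\<dots> \<le> D x * c / 2"
    proof -
      have "(\<Sum>y\<in>S. m (x @ y)) \<le> (\<Sum>y\<in>lvl K N. m (x @ y))"
        by (rule sum_mono2) (use S m_nonneg x in \<open>auto dest!: lvl_subset_words\<close>)
      then have "c * card S \<le> c" by (simp add: mS tot mult.commute)
      then show ?thesis using D_pos[OF x] by simp
    qed
    finally have "1 \<le> c / 2" using D_pos[OF x] by (simp add: field_simps)
    moreover have "c \<le> 1"
    proof -
      have "m x \<le> (\<Sum>y\<in>lvl K l. m y)"
        
      proof (rule member_le_sum)
        show "x \<in> lvl K l" using x by (simp add: lvl_def l_def)
      qed (auto intro: m_nonneg dest: lvl_subset_words)
      also have "\<dots> = 1" using sum_lvl_flow[OF m Nil_in_words, of l] root(1) by simp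
      finally show ?thesis using mx by simp
    qed
    ultimately show False by simp
  qed
qed

text \<open>Under the probability weights \<open>D\<close> on level \<open>n\<close>, the surprise
  per letter \<open>g = - ln D / n\<close> tends to \<open>c\<close> in probability; its mean
  follows once large values are negligible. A value above \<open>R\<close> forces \<open>D x\<close>
  below \<open>K ^ (- 2 n)\<close>, so even all \<open>K ^ n\<close> words together contribute
  little.\<close>

lemma entropy_rate_of_typical:
  fixes D :: "nat list \<Rightarrow> real" and c :: real
  assumes pos: "\<And>x. x \<in> words K \<Longrightarrow> 0 < D x"
    and total: "\<And>n. (\<Sum>x\<in>lvl K n. D x) = 1"
    and typical: "\<And>e::real. 0 < e \<Longrightarrow>
      (\<lambda>n. \<Sum>x | x \<in> lvl K n \<and> \<bar>- ln (D x) - c * n\<bar> > e * n. D x) \<longlonglongrightarrow> 0"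
  shows "(\<lambda>n. - (\<Sum>x\<in>lvl K n. D x * ln (D x)) / n) \<longlonglongrightarrow> c"
proof -
  \<comment> \<open>For \<open>D x = exp (- y)\<close> with \<open>y > R * n\<close>, the bound
    \<open>y * exp (- y) \<le> 2 * exp (- y / 2)\<close> is at most \<open>2 * E\<close>, and
    \<open>K ^ n * E = exp (- n)\<close>. The factor 2 pays for halving the exponent,
    \<open>ln K\<close> for the number of words, and 1 for the decay.\<close>
  define R where "R = 2 * (ln (real K) + 1)"
  have K: "0 < K"
  proof (rule ccontr)
    assume "\<not> 0 < K"
    then have "lvl K 1 = {}" by (auto simp: lvl_alt)
    then show False using total[of 1] by simp
  qed
  have le1: "D x \<le> 1" if "x \<in> lvl K n" for x n
  proof -
    have "D x \<le> (\<Sum>x\<in>lvl K n. D x)"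
      by (rule member_le_sum) (use that pos in \<open>auto dest!: lvl_subset_words intro: less_imp_le\<close>)
    then show ?thesis by (simp add: total)
  qed
  show ?thesis
  proof (rule LIMSEQ_I)
    fix e :: real assume e: "0 < e"
    define e' where "e' = e / 4"
    have e': "0 < e'" using e by (simp add: e'_def)
    define B where "B n = {x. x \<in> lvl K n \<and> \<bar>- ln (D x) - c * n\<bar> > e' * n}" for n
    have finB [simp]: "finite (B n)" for n
      by (rule finite_subset[of _ "lvl K n"]) (auto simp: B_def)
    have "(\<lambda>n. (\<Sum>x\<in>B n. D x) * (\<bar>c\<bar> + \<bar>R\<bar>)) \<longlonglongrightarrow> 0"
      using tendsto_mult_right[OF typical[OF e'], of "\<bar>c\<bar> + \<bar>R\<bar>"] unfolding B_def by simp
    then have ev1: "\<forall>\<^sub>F n in sequentially. (\<Sum>x\<in>B n. D x) * (\<bar>c\<bar> + \<bar>R\<bar>) < e'"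
      using e' by (rule order_tendstoD)
    have "(\<lambda>n. 2 * exp (- 1) ^ n :: real) \<longlonglongrightarrow> 2 * 0"
      by (intro tendsto_intros LIMSEQ_power_zero) simp
    then have ev2: "\<forall>\<^sub>F n in sequentially. 2 * exp (- 1) ^ n < e'"
      using e' by (intro order_tendstoD) auto
    have "\<forall>\<^sub>F n in sequentially. norm (- (\<Sum>x\<in>lvl K n. D x * ln (D x)) / n - c) < e"
      using ev1 ev2 eventually_gt_at_top[of 0]
    proof eventually_elim
      case (elim n)
      then have n: "0 < real n" by simp
      define E where "E = exp (- real n * (ln K + 1))"
      have E: "0 < E" by (simp add: E_def)
      define g where "g x = - ln (D x) / n" for x
      have g0: "0 \<le> g x" if "x \<in> lvl K n" for x
        
      proof -
        have "ln (D x) \<le> 0"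
          using le1[OF that] pos[OF lvl_subset_words[OF that]] by simp
        then show ?thesis by (simp add: g_def divide_nonpos_nonneg)
      qed
      have "\<bar>- (\<Sum>x\<in>lvl K n. D x * ln (D x)) / n - c\<bar> = \<bar>\<Sum>x\<in>lvl K n. D x * (g x - c)\<bar>"
      proof -
        have "(\<Sum>x\<in>lvl K n. D x * (g x - c)) = (\<Sum>x\<in>lvl K n. D x * g x) - c"
          by (simp add: algebra_simps sum_subtractf flip: sum_distrib_left) (simp add: total)
        also have "(\<Sum>x\<in>lvl K n. D x * g x) = - (\<Sum>x\<in>lvl K n. D x * ln (D x)) / n"
          by (simp add: g_def sum_divide_distrib sum_negf)
        finally show ?thesis by simp
      qed
      also have "\<dots> \<le> (\<Sum>x\<in>lvl K n. \<bar>D x * (g x - c)\<bar>)" by (rule sum_abs)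
      \<comment> \<open>The three terms stand for typical words, for atypical words with
        \<open>g x \<le> R\<close>, and for the excess of atypical words with
        \<open>g x > R\<close>.\<close>
      also have "\<dots> \<le> (\<Sum>x\<in>lvl K n. D x * e' + (if x \<in> B n then D x * (\<bar>c\<bar> + \<bar>R\<bar>) else 0)
          + 2 * E)"
      proof (rule sum_mono)
        fix x assume x: "x \<in> lvl K n"
        have Dx: "0 < D x" using pos x by (auto simp: lvl_def)
        have abs: "\<bar>D x * (g x - c)\<bar> = D x * \<bar>g x - c\<bar>"
          using Dx by (simp add: abs_mult)
        have gc: "\<bar>g x - c\<bar> * n = \<bar>- ln (D x) - c * n\<bar>"
        proof -
          have "\<bar>g x - c\<bar> * n = \<bar>(g x - c) * n\<bar>" using n by (simp add: abs_mult)
          also have "(g x - c) * n = - ln (D x) - c * n" using n by (simp add: g_def field_simps)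
          finally show ?thesis .
        qed
        show "\<bar>D x * (g x - c)\<bar> \<le> D x * e' + (if x \<in> B n then D x * (\<bar>c\<bar> + \<bar>R\<bar>) else 0)
            + 2 * E"
        proof (cases "x \<in> B n")
          case False
          then have "\<bar>g x - c\<bar> * n \<le> e' * n" using x gc by (simp add: B_def)
          then have "\<bar>g x - c\<bar> \<le> e'" using n by simp
          then have "D x * \<bar>g x - c\<bar> \<le> D x * e'" using Dx by simp
          then show ?thesis using False E unfolding abs by simp
        next
          case True
          show ?thesis
          proof (cases "g x \<le> R")
            case True
            then have "D x * \<bar>g x - c\<bar> \<le> D x * (\<bar>c\<bar> + \<bar>R\<bar>)"
              using Dx g0[OF x] by simp
            moreover have "0 \<le> D x * e'" using Dx e' by simp
            ultimately show ?thesis using E \<open>x \<in> B n\<close> unfolding abs by simp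
          next
            case False
            define y where "y = - ln (D x)"
            have Dy: "D x = exp (- y)" using Dx by (simp add: y_def)
            have y: "R * n < y" using False n by (simp add: g_def y_def field_simps)
            have "0 \<le> y" using le1[OF x] Dx by (simp add: y_def)
            have "y \<le> 2 * exp (y / 2)"
              using exp_ge_add_one_self[of "y/2"] by linarith
            then have "y * exp (- y) \<le> 2 * exp (y/2) * exp (- y)"
              by (intro mult_right_mono) auto
            also have "\<dots> = 2 * exp (- y / 2)" by (simp flip: exp_add)
            also have "\<dots> \<le> 2 * E"
              using y by (simp add: R_def E_def algebra_simps)
            finally have 1: "D x * y \<le> 2 * E"
              by (simp add: Dy mult.commute)
            have "g x \<le> y"
              using divide_left_mono[of 1 "real n" y] \<open>0 \<le> y\<close> elim by (simp add: g_def y_def)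
            then have "D x * \<bar>g x - c\<bar> \<le> D x * (y + (\<bar>c\<bar> + \<bar>R\<bar>))"
              using Dx g0[OF x] by simp
            moreover have "0 \<le> D x * e'" using Dx e' by simp
            ultimately show ?thesis using \<open>x \<in> B n\<close> 1 unfolding abs by (simp add: distrib_left)
          qed
        qed
      qed
      also have "\<dots> = e' + (\<Sum>x\<in>B n. D x) * (\<bar>c\<bar> + \<bar>R\<bar>) + 2 * exp (- 1) ^ n"
      proof -
        have "(\<Sum>x\<in>lvl K n. D x * e') = e'" by (simp add: total flip: sum_distrib_right)
        moreover have "(\<Sum>x\<in>lvl K n. if x \<in> B n then D x * (\<bar>c\<bar> + \<bar>R\<bar>) else 0)
            = (\<Sum>x\<in>B n. D x) * (\<bar>c\<bar> + \<bar>R\<bar>)"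
        proof -
          have "(\<Sum>x\<in>lvl K n. if x \<in> B n then D x * (\<bar>c\<bar> + \<bar>R\<bar>) else 0)
            = (\<Sum>x\<in>lvl K n \<inter> B n. D x * (\<bar>c\<bar> + \<bar>R\<bar>))" by (simp add: sum.inter_restrict)
          also have "lvl K n \<inter> B n = B n" by (auto simp: B_def)
          finally show ?thesis by (simp add: sum_distrib_right)
        qed
        moreover have "real (card (lvl K n)) * E = exp (- 1) ^ n"
        proof -
          have "E = exp (- (n * ln K)) * exp (- real n)"
            by (simp add: E_def algebra_simps flip: exp_add)
          also have "exp (- (n * ln K)) = 1 / real K ^ n"
            using K by (simp add: exp_minus field_simps exp_of_nat_mult)
          also have "exp (- real n) = exp (- 1) ^ n"
            by (simp flip: exp_of_nat_mult)
          finally show ?thesis using K by (simp add: card_lvl)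
        qed
        ultimately show ?thesis by (simp add: sum.distrib)
      qed
      also have "\<dots> < e" using elim e by (simp add: e'_def)
      finally show ?case by simp
    qed
    then show "\<exists>no. \<forall>n\<ge>no. norm (- (\<Sum>x\<in>lvl K n. D x * ln (D x)) / n - c) < e"
      by (simp add: eventually_sequentially)
  qed
qed

section \<open>The space of leaves\<close>

lemma initial_segment_Suc: "initial_segment (Suc n) z = initial_segment n z @ [z n]"
  by (simp add: initial_segment_def)

lemma length_initial_segment [simp]: "length (initial_segment n z) = n"
  by (simp add: initial_segment_def)

lemma initial_segment_in_words: "z \<in> leaves K \<Longrightarrow> initial_segment n z \<in> words K"
  by (auto simp: initial_segment_def words_def leaves_def)

lemma initial_segment_in_lvl: "z \<in> leaves K \<Longrightarrow> initial_segment n z \<in> lvl K n"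
  by (simp add: lvl_def initial_segment_in_words)

lemma cylinder_split: "cylinder K x = (\<Union>i\<in>{1..K}. cylinder K (x @ [i]))"
  by (auto simp: cylinder_def initial_segment_Suc leaves_def)

lemma cylinder_disjoint: "length x = length y \<Longrightarrow> x \<noteq> y \<Longrightarrow> cylinder K x \<inter> cylinder K y = {}"
  by (auto simp: cylinder_def)

lemma finite_common_prefix:
  assumes "x \<noteq> y"
  shows "finite {n. initial_segment n x = initial_segment n y}"
proof -
  obtain k where k: "x k \<noteq> y k" using assms by auto
  have "n \<le> k" if "initial_segment n x = initial_segment n y" for n
  proof (rule ccontr)
    assume "\<not> n \<le> k"
    then have "k < n" by simp
    then show False using that k unfolding initial_segment_eq_iff by blast
  qed
  then show ?thesis by (auto intro: finite_subset[OF _ finite_atMost[of k]])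
qed

lemma leaf_dist_le_iff:
  assumes "0 < \<Lambda>" "\<Lambda> < 1"
  shows "leaf_dist \<Lambda> x y \<le> \<Lambda> ^ n \<longleftrightarrow> initial_segment n x = initial_segment n y"
proof (cases "x = y")
  case False
  let ?A = "{n. initial_segment n x = initial_segment n y}"
  have fin: "finite ?A" using False by (rule finite_common_prefix)
  have "0 \<in> ?A" by (simp add: initial_segment_eq_iff)
  then have "?A \<noteq> {}" by blast
  with fin have Max: "Max ?A \<in> ?A" by (rule Max_in)
  have "leaf_dist \<Lambda> x y \<le> \<Lambda> ^ n \<longleftrightarrow> n \<le> Max ?A"
    using assms False by (simp add: leaf_dist_def)
  also have "\<dots> \<longleftrightarrow> n \<in> ?A"
  proof
    assume "n \<le> Max ?A"
    moreover have "\<forall>k<Max ?A. x k = y k" using Max unfolding initial_segment_eq_iff by blast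
    ultimately show "n \<in> ?A" unfolding initial_segment_eq_iff by simp
  qed (rule Max_ge[OF fin])
  finally show ?thesis by simp
qed (use assms in \<open>simp add: leaf_dist_def\<close>)

text \<open>Distances are powers of \<Lambda>, so an open ball depends only on which interval
  between consecutive powers contains its radius. The inequality is strict, hence
  \<open>r = \<Lambda> ^ n\<close> already demands \<open>n + 1\<close> common letters; this is why
  the interval is closed on the right.\<close>

lemma leaf_dist_less_iff:
  assumes \<Lambda>: "0 < \<Lambda>" "\<Lambda> < 1" and r: "\<Lambda> ^ Suc n < r" "r \<le> \<Lambda> ^ n"
  shows "leaf_dist \<Lambda> x y < r \<longleftrightarrow> initial_segment (Suc n) x = initial_segment (Suc n) y"
proof
  assume "initial_segment (Suc n) x = initial_segment (Suc n) y"
  then have "leaf_dist \<Lambda> x y \<le> \<Lambda> ^ Suc n" using leaf_dist_le_iff[OF \<Lambda>] by blast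
  then show "leaf_dist \<Lambda> x y < r" using r by linarith
next
  assume less: "leaf_dist \<Lambda> x y < r"
  show "initial_segment (Suc n) x = initial_segment (Suc n) y"
  proof (cases "x = y")
    case False
    let ?m = "Max {n. initial_segment n x = initial_segment n y}"
    have d: "leaf_dist \<Lambda> x y = \<Lambda> ^ ?m" using False by (simp add: leaf_dist_def)
    then have "\<Lambda> ^ ?m < \<Lambda> ^ n" using less r by linarith
    then have "n < ?m" using \<Lambda> by (simp add: power_strict_decreasing_iff)
    then have "leaf_dist \<Lambda> x y \<le> \<Lambda> ^ Suc n" unfolding d using \<Lambda> by (intro power_decreasing) auto
    then show ?thesis using leaf_dist_le_iff[OF \<Lambda>] by blast
  qed simp
qed

lemma leaf_ball_eq_cylinder:
  assumes "0 < \<Lambda>" "\<Lambda> < 1" "\<Lambda> ^ Suc n < r" "r \<le> \<Lambda> ^ n" "z \<in> leaves K"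
  shows "leaf_ball K \<Lambda> z r = cylinder K (initial_segment (Suc n) z)"
proof -
  interpret Metric_space "leaves K" "leaf_dist \<Lambda>"
    using assms by (intro Metric_space_leaves)
  show ?thesis
    using assms leaf_dist_less_iff[OF assms(1-4), of z]
    by (auto simp: leaf_ball_def cylinder_def)
qed

lemma space_leaf_borel [simp]: 
  assumes "0 < \<Lambda>" "\<Lambda> < 1"
  shows "space (leaf_borel K \<Lambda>) = leaves K"
proof -
  interpret Metric_space "leaves K" "leaf_dist \<Lambda>"
    using assms by (intro Metric_space_leaves)
  have "{U. openin mtopology U} \<subseteq> Pow (leaves K)"
    using openin_subset[of mtopology] by (simp add: subset_eq)
  then show ?thesis
    unfolding leaf_borel_def by (rule space_measure_of)
qed

lemma cylinder_in_leaf_borel: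
  assumes \<Lambda>: "0 < \<Lambda>" "\<Lambda> < 1"
  shows "cylinder K x \<in> sets (leaf_borel K \<Lambda>)"
proof -
  interpret Metric_space "leaves K" "leaf_dist \<Lambda>"
    using assms by (intro Metric_space_leaves)
  have "openin mtopology (cylinder K x)"
    unfolding openin_mtopology
  proof (intro conjI allI impI)
    fix z assume z: "z \<in> cylinder K x"
    have "mball z (\<Lambda> ^ length x) \<subseteq> cylinder K x"
    proof
      fix y assume "y \<in> mball z (\<Lambda> ^ length x)"
      then have "y \<in> leaves K" "leaf_dist \<Lambda> z y \<le> \<Lambda> ^ length x" by auto
      then show "y \<in> cylinder K x"
        using leaf_dist_le_iff[OF \<Lambda>, of z y "length x"] z by (auto simp: cylinder_def)
    qed
    moreover have "0 < \<Lambda> ^ length x" using \<Lambda> by simp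
    ultimately show "\<exists>r>0. mball z r \<subseteq> cylinder K x" by blast
  qed (auto simp: cylinder_def)
  moreover have "{U. openin mtopology U} \<subseteq> Pow (leaves K)"
    using openin_subset[of mtopology] by (simp add: subset_eq)
  ultimately show ?thesis
    unfolding leaf_borel_def by simp
qed

lemma measure_cylinder_split:
  assumes \<Lambda>: "0 < \<Lambda>" "\<Lambda> < 1" and "prob_space \<nu>" and sets: "sets \<nu> = sets (leaf_borel K \<Lambda>)"
  shows "measure \<nu> (cylinder K x) = (\<Sum>i=1..K. measure \<nu> (cylinder K (x @ [i])))"
proof -
  interpret prob_space \<nu> by fact
  show ?thesis
    by (subst cylinder_split, rule finite_measure_finite_Union)
      (auto simp: sets disjoint_family_on_def cylinder_in_leaf_borel[OF \<Lambda>] cylinder_disjoint)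
qed

text \<open>The quotient at radius \<open>r\<close> is the quotient at a level times the ratio of
  that level to the real number \<open>u r\<close> at which the power of \<Lambda> equals
  \<open>r\<close>, and this ratio tends to 1. Positive masses keep \<open>ext_log\<close>
  finite.\<close>

lemma has_local_dimI:
  assumes \<Lambda>: "0 < \<Lambda>" "\<Lambda> < 1" and z: "z \<in> leaves K"
    and pos: "\<And>n. 0 < measure \<nu> (cylinder K (initial_segment n z))"
    and lim: "(\<lambda>n. - ln (measure \<nu> (cylinder K (initial_segment n z))) / real n) \<longlonglongrightarrow> c"
  shows "has_local_dim K \<Lambda> \<nu> z (ereal (c / (- ln \<Lambda>)))"
proof -
  define f where "f n = - ln (measure \<nu> (cylinder K (initial_segment n z))) / real n" for n
  define u where "u r = ln r / ln \<Lambda>" for r :: real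
  define q where "q r = ext_log (measure \<nu> (leaf_ball K \<Lambda> z r)) / ereal (ln r)" for r
  have ln\<Lambda>: "ln \<Lambda> < 0" using \<Lambda> by simp
  have u: "filterlim u at_top (at_right 0)"
  proof -
    have "filterlim (\<lambda>r::real. (1 / (- ln \<Lambda>)) * (- ln r)) at_top (at_right 0)"
    proof (rule filterlim_tendsto_pos_mult_at_top[OF tendsto_const])
      show "0 < 1 / (- ln \<Lambda>)" using ln\<Lambda> by simp
      show "filterlim (\<lambda>r::real. - ln r) at_top (at_right 0)"
        using ln_at_0 by (simp add: filterlim_uminus_at_top)
    qed
    then show ?thesis by (simp add: u_def[abs_def])
  qed
  have n: "filterlim (\<lambda>r. Suc (nat \<lfloor>u r\<rfloor>)) sequentially (at_right 0)"
    by (intro filterlim_compose[OF filterlim_Suc] filterlim_compose[OF filterlim_nat_sequentially]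
        filterlim_compose[OF filterlim_floor_sequentially] u)
  have small: "\<forall>\<^sub>F r in at_right (0::real). r < 1"
    by (rule eventually_at_rightI[of 0 1]) auto
  have pos_r: "\<forall>\<^sub>F r in at_right (0::real). 0 < r"
    by (rule eventually_at_right_less)
  have "((\<lambda>r. 1 + 1 / u r) \<longlongrightarrow> 1 + 0) (at_right 0)"
    by (intro tendsto_add tendsto_const tendsto_divide_0[OF tendsto_const]
        filterlim_at_top_imp_at_infinity u)
  then have up: "((\<lambda>r. 1 + 1 / u r) \<longlongrightarrow> 1) (at_right 0)" by simp
  have ratio: "((\<lambda>r. real (Suc (nat \<lfloor>u r\<rfloor>)) / u r) \<longlongrightarrow> 1) (at_right 0)"
  proof (rule tendsto_sandwich[OF _ _ tendsto_const up])
    have ev: "\<forall>\<^sub>F r in at_right 0. 0 < u r"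
      using u by (simp add: filterlim_at_top_dense)
    show "\<forall>\<^sub>F r in at_right 0. 1 \<le> real (Suc (nat \<lfloor>u r\<rfloor>)) / u r"
      using ev by eventually_elim (simp, linarith)
    show "\<forall>\<^sub>F r in at_right 0. real (Suc (nat \<lfloor>u r\<rfloor>)) / u r \<le> 1 + 1 / u r"
      using ev
    proof eventually_elim
      case (elim r)
      then have "real (Suc (nat \<lfloor>u r\<rfloor>)) \<le> u r + 1" by simp
      then have "real (Suc (nat \<lfloor>u r\<rfloor>)) / u r \<le> (u r + 1) / u r"
        using elim by (intro divide_right_mono) auto
      also have "(u r + 1) / u r = 1 + 1 / u r" using elim by (simp add: add_divide_distrib)
      finally show ?case .
    qed
  qed
  have "((\<lambda>r. f (Suc (nat \<lfloor>u r\<rfloor>)) * (real (Suc (nat \<lfloor>u r\<rfloor>)) / u r) / (- ln \<Lambda>)) \<longlongrightarrow> c * 1 / (- ln \<Lambda>)) (at_right 0)"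
    using ln\<Lambda> lim unfolding f_def
    by (intro tendsto_intros ratio filterlim_compose[OF _ n]) auto
  then have "((\<lambda>r. ereal (f (Suc (nat \<lfloor>u r\<rfloor>)) * (real (Suc (nat \<lfloor>u r\<rfloor>)) / u r) / (- ln \<Lambda>))) \<longlongrightarrow> ereal (c / (- ln \<Lambda>))) (at_right 0)"
    unfolding mult_1_right by (rule tendsto_ereal)
  moreover have "\<forall>\<^sub>F r in at_right 0. ereal (f (Suc (nat \<lfloor>u r\<rfloor>)) * (real (Suc (nat \<lfloor>u r\<rfloor>)) / u r) / (- ln \<Lambda>)) = q r"
    using small pos_r
  proof eventually_elim
    case (elim r)
    \<comment> \<open>With \<open>k\<close> the floor of \<open>u r\<close>, the radius lies between
      \<open>\<Lambda> ^ Suc k\<close> (excluded) and \<open>\<Lambda> ^ k\<close> (included), hence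
      the level \<open>Suc k\<close>.\<close>
    define k where "k = nat \<lfloor>u r\<rfloor>"
    define m where "m = measure \<nu> (cylinder K (initial_segment (Suc k) z))"
    have lnr: "ln r < 0" using elim by simp
    have ur: "0 < u r" using lnr ln\<Lambda> by (simp add: u_def divide_neg_neg)
    have eq: "ln r = u r * ln \<Lambda>" using ln\<Lambda> by (simp add: u_def)
    have k: "real k \<le> u r" "u r < real (Suc k)" using ur by (simp_all add: k_def) linarith
    have pw: "\<Lambda> ^ j = exp (real j * ln \<Lambda>)" for j using \<Lambda> by (simp add: exp_of_nat_mult)
    have r: "r = exp (u r * ln \<Lambda>)" using elim by (simp flip: eq)
    have "\<Lambda> ^ Suc k < r"
      unfolding pw using k(2) ln\<Lambda> by (subst r) (simp only: exp_less_cancel_iff mult_less_cancel_right, simp)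
    moreover have "r \<le> \<Lambda> ^ k"
      unfolding pw using k(1) ln\<Lambda> by (subst r) (simp only: exp_le_cancel_iff mult_le_cancel_right, simp)
    ultimately have ball: "leaf_ball K \<Lambda> z r = cylinder K (initial_segment (Suc k) z)"
      by (rule leaf_ball_eq_cylinder[OF \<Lambda> _ _ z])
    have m: "0 < m" using pos by (simp add: m_def)
    have "q r = ereal (ln m / ln r)"
      using m lnr by (simp add: q_def ball ext_log_def flip: m_def)
    also have "ln m / ln r = f (Suc k) * (real (Suc k) / u r) / (- ln \<Lambda>)"
      using ur ln\<Lambda> by (simp add: f_def eq flip: m_def)
    finally show ?case by (simp add: k_def)
  qed
  ultimately have "(q \<longlongrightarrow> ereal (c / (- ln \<Lambda>))) (at_right 0)"
    by (rule Lim_transform_eventually)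
  then show ?thesis
    unfolding has_local_dim_def lower_local_dim_def upper_local_dim_def q_def
    by (auto intro: lim_imp_Liminf lim_imp_Limsup)
qed

section \<open>Dimensions from the decay of masses along leaves\<close>

lemma AE_local_rate_of_typical:
  fixes D :: "nat list \<Rightarrow> real" and c :: real
  assumes \<Lambda>: "0 < \<Lambda>" "\<Lambda> < 1" and \<nu>: "prob_space \<nu>" and sets: "sets \<nu> = sets (leaf_borel K \<Lambda>)"
    and D: "\<And>x. x \<in> words K \<Longrightarrow> measure \<nu> (cylinder K x) = D x"
    and typical: "\<And>e::real. 0 < e \<Longrightarrow>
      summable (\<lambda>n. \<Sum>x | x \<in> lvl K n \<and> \<bar>- ln (D x) - c * n\<bar> > e * n. D x)"
  shows "AE z in \<nu>. (\<lambda>n. - ln (measure \<nu> (cylinder K (initial_segment n z))) / real n) \<longlonglongrightarrow> c"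
proof -
  interpret prob_space \<nu> by fact
  have space: "space \<nu> = leaves K" using sets_eq_imp_space_eq[OF sets] \<Lambda> by simp
  define B where "B e n = {x. x \<in> lvl K n \<and> \<bar>- ln (D x) - c * n\<bar> > e * n}" for e :: real and n
  define A where "A e n = (\<Union>x\<in>B e n. cylinder K x)" for e n
  have finB: "finite (B e n)" for e n
    by (rule finite_subset[of _ "lvl K n"]) (auto simp: B_def)
  have AE1: "AE z in \<nu>. \<forall>\<^sub>F n in sequentially. z \<in> space \<nu> - A e n" if e: "0 < e" for e
  proof (rule borel_cantelli_AE1)
    show "A e n \<in> sets \<nu>" for n
      unfolding A_def sets using finB by (intro sets.finite_UN cylinder_in_leaf_borel[OF \<Lambda>]) auto
    show "emeasure \<nu> (A e n) < \<infinity>" for n by (simp add: less_top[symmetric])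
    show "summable (\<lambda>n. measure \<nu> (A e n))"
    proof (rule summable_comparison_test'[OF typical[OF e]])
      fix n :: nat
      have "measure \<nu> (A e n) \<le> (\<Sum>x\<in>B e n. measure \<nu> (cylinder K x))"
        unfolding A_def using finB
        by (intro measure_UNION_le) (auto simp: sets cylinder_in_leaf_borel[OF \<Lambda>])
      also have "\<dots> = (\<Sum>x\<in>B e n. D x)"
        by (intro sum.cong refl D) (auto simp: B_def dest: lvl_subset_words)
      finally show "norm (measure \<nu> (A e n)) \<le> (\<Sum>x | x \<in> lvl K n \<and> \<bar>- ln (D x) - c * n\<bar> > e * n. D x)"
        by (simp add: B_def)
    qed
  qed
  \<comment> \<open>Countably many tolerances suffice, so the exceptional null sets can be
    united.\<close>
  have "AE z in \<nu>. \<forall>j. \<forall>\<^sub>F n in sequentially. z \<in> space \<nu> - A (1 / real (Suc j)) n"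
    by (subst AE_all_countable) (intro allI AE1, simp)
  then show ?thesis
  proof (eventually_elim, intro LIMSEQ_I)
    fix z and e :: real
    assume *: "\<forall>j. \<forall>\<^sub>F n in sequentially. z \<in> space \<nu> - A (1 / real (Suc j)) n" and e: "0 < e"
    obtain j where j: "1 / real (Suc j) < e"
      using reals_Archimedean[OF e] by (auto simp: inverse_eq_divide)
    have "\<forall>\<^sub>F n in sequentially.
      norm (- ln (measure \<nu> (cylinder K (initial_segment n z))) / real n - c) < e"
      using *[rule_format, of j] eventually_gt_at_top[of 0]
    proof eventually_elim
      case (elim n)
      then have z: "z \<in> leaves K" and n: "0 < real n" by (auto simp: space)
      let ?x = "initial_segment n z"
      have "z \<in> cylinder K ?x" using z by (simp add: cylinder_def)
      then have "?x \<notin> B (1 / real (Suc j)) n" using elim by (auto simp: A_def)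
      then have "\<bar>- ln (D ?x) - c * n\<bar> \<le> 1 / real (Suc j) * n"
        using initial_segment_in_lvl[OF z] by (simp add: B_def)
      also have "\<dots> < e * n" using j n by (intro mult_strict_right_mono)
      finally have "\<bar>- ln (D ?x) - c * n\<bar> < e * n" .
      moreover have "- ln (D ?x) / n - c = (- ln (D ?x) - c * n) / n" using n by (simp add: field_simps)
      ultimately have "\<bar>- ln (D ?x) / n - c\<bar> < e"
        using n by (simp only: abs_divide) (simp add: pos_divide_less_eq)
      then show ?case using D[OF initial_segment_in_words[OF z]] by simp
    qed
    then show "\<exists>no. \<forall>n\<ge>no. norm (- ln (measure \<nu> (cylinder K (initial_segment n z))) / real n - c) < e"
      by (simp add: eventually_sequentially)
  qed
qed

lemma dims_of_typical:
  fixes D :: "nat list \<Rightarrow> real" and c :: real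
  assumes \<Lambda>: "0 < \<Lambda>" "\<Lambda> < 1" and \<nu>: "prob_space \<nu>" and sets: "sets \<nu> = sets (leaf_borel K \<Lambda>)"
    and D: "\<And>x. x \<in> words K \<Longrightarrow> measure \<nu> (cylinder K x) = D x"
    and pos: "\<And>x. x \<in> words K \<Longrightarrow> 0 < D x"
    and typical: "\<And>e::real. 0 < e \<Longrightarrow>
      summable (\<lambda>n. \<Sum>x | x \<in> lvl K n \<and> \<bar>- ln (D x) - c * n\<bar> > e * n. D x)"
  defines "d \<equiv> ereal (c / (- ln \<Lambda>))"
  shows "hausdorff_dim K \<Lambda> \<nu> = d" "packing_dim K \<Lambda> \<nu> = d"
    and "AE z in \<nu>. has_local_dim K \<Lambda> \<nu> z d"
proof -
  interpret prob_space \<nu> by fact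
  have space: "space \<nu> = leaves K" using sets_eq_imp_space_eq[OF sets] \<Lambda> by simp
  have "AE z in \<nu>. (\<lambda>n. - ln (measure \<nu> (cylinder K (initial_segment n z))) / real n) \<longlonglongrightarrow> c"
    by (rule AE_local_rate_of_typical[OF \<Lambda> \<nu> sets D typical]) auto
  then show *: "AE z in \<nu>. has_local_dim K \<Lambda> \<nu> z d"
    using AE_space
  proof eventually_elim
    case (elim z)
    then show ?case
      unfolding d_def using pos D
      by (intro has_local_dimI[OF \<Lambda>]) (auto simp: space initial_segment_in_words)
  qed
  have Sup: "Sup {s. AE z in \<nu>. s \<le> g z} = d" if "AE z in \<nu>. g z = d" for g
  proof -
    \<comment> \<open>The forward direction uses that \<open>\<nu>\<close> is not the zero measure:
      a constant statement that holds almost everywhere is true.\<close>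
    have "(AE z in \<nu>. s \<le> g z) \<longleftrightarrow> s \<le> d" for s
    proof
      assume "AE z in \<nu>. s \<le> g z"
      with that have "AE z in \<nu>. s \<le> d" by eventually_elim simp
      then show "s \<le> d" by simp
    next
      assume "s \<le> d"
      with that show "AE z in \<nu>. s \<le> g z" by (auto elim: eventually_mono)
    qed
    then have "{s. AE z in \<nu>. s \<le> g z} = {..d}" by auto
    then show ?thesis by simp
  qed
  show "hausdorff_dim K \<Lambda> \<nu> = d" "packing_dim K \<Lambda> \<nu> = d"
    unfolding hausdorff_dim_def packing_dim_def
    by (intro Sup, use * in \<open>auto simp: has_local_dim_def elim: eventually_mono\<close>)+
qed

section \<open>The law of the waiting times\<close>

text \<open>The sample point is the family of waiting times itself, so birth times become functions
  on the product space and passing to a subtree becomes a map of sample points.\<close>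

definition birth :: "(nat list \<Rightarrow> real) \<Rightarrow> nat list \<Rightarrow> real" where
  "birth s x = birth_time (\<lambda>y s. s y) x s"

lemma birth_Nil [simp]: "birth s [] = 0"
  by (simp add: birth_def)

lemma birth_snoc: "birth s (y @ [i]) = birth s y + (\<Sum>j=1..i. s (y @ [j]))"
  by (simp add: birth_def birth_time_snoc)

lemma birth_singleton: "birth s [i] = (\<Sum>j=1..i. s [j])"
  using birth_snoc[of s "[]" i] by simp

lemma birth_time_eq_birth: "birth_time \<sigma> x \<omega> = birth (\<lambda>y. \<sigma> y \<omega>) x"
  by (induction x rule: rev_induct) (simp_all add: birth_time_snoc birth_snoc)

lemma birth_cong:
  assumes "\<And>y. y \<in> words K - {[]} \<Longrightarrow> s y = s' y" "x \<in> words K"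
  shows "birth s x = birth s' x"
  using assms(2)
proof (induction x rule: rev_induct)
  case (snoc i x)
  then show ?case
    using assms(1) by (auto simp: birth_snoc intro!: sum.cong)
qed simp

lemma birth_nonneg:
  assumes "\<And>y. y \<in> words K - {[]} \<Longrightarrow> 0 \<le> s y" "x \<in> words K"
  shows "0 \<le> birth s x"
  using assms(2)
proof (induction x rule: rev_induct)
  case (snoc i x)
  then show ?case
    using assms(1) by (auto simp: birth_snoc intro!: add_nonneg_nonneg sum_nonneg)
qed simp

locale tree_law =
  fixes K :: nat and w :: "nat \<Rightarrow> real"
  assumes K: "2 \<le> K" and w: "\<And>j. j < K \<Longrightarrow> 0 < w j"
begin

definition idx :: "nat list set" where
  "idx = words K - {[]}"

definition wait :: "nat list \<Rightarrow> real measure" where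
  "wait y = density lborel (exponential_density (w (last y - 1)))"

definition law :: "(nat list \<Rightarrow> real) measure" where
  "law = PiM idx wait"

text \<open>The subtree at \<open>x\<close> as a sample point of its own. The restriction to
  \<open>idx\<close> makes it extensional, as points of the product space have to be.\<close>

definition shift :: "nat list \<Rightarrow> (nat list \<Rightarrow> real) \<Rightarrow> nat list \<Rightarrow> real" where
  "shift x s = (\<lambda>y\<in>idx. s (x @ y))"

lemma idxD: "y \<in> idx \<Longrightarrow> y \<in> words K" "y \<in> idx \<Longrightarrow> y \<noteq> []"
  by (auto simp: idx_def)

lemma append_idx [intro]: "x \<in> words K \<Longrightarrow> y \<in> idx \<Longrightarrow> x @ y \<in> idx"
  by (auto simp: idx_def)

lemma singleton_idx [simp]: "[i] \<in> idx \<longleftrightarrow> i \<in> {1..K}"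
  by (auto simp: idx_def)

lemma last_idx: "y \<in> idx \<Longrightarrow> last y \<in> {1..K}"
  using last_in_set by (fastforce simp: idx_def words_def)

lemma rate_pos: "y \<in> idx \<Longrightarrow> 0 < w (last y - 1)"
  using last_idx[of y] by (intro w) auto

lemma prob_wait: "y \<in> idx \<Longrightarrow> prob_space (wait y)"
  unfolding wait_def by (intro prob_space_exponential_density rate_pos)

lemma sets_wait [measurable_cong, simp]: "sets (wait y) = sets borel"
  by (simp add: wait_def)

sublocale prob_space law
  unfolding law_def by (intro prob_space_PiM prob_wait)

lemma sets_law: "sets law = sets (PiM idx (\<lambda>_. borel))"
  unfolding law_def by (rule sets_PiM_cong) auto

lemma measurable_coord [measurable]: "y \<in> idx \<Longrightarrow> (\<lambda>s. s y) \<in> borel_measurable law"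
  using measurable_component_singleton[of y idx wait]
  by (simp add: law_def measurable_cong_sets[OF refl sets_wait])

lemma measurable_birth [measurable]: "x \<in> words K \<Longrightarrow> (\<lambda>s. birth s x) \<in> borel_measurable law"
proof (induction x rule: rev_induct)
  case (snoc i x)
  then show ?case
    unfolding birth_snoc
    by (intro borel_measurable_add borel_measurable_sum measurable_coord) (auto simp: idx_def)
qed simp

text \<open>Self-similarity of the tree: the law of a waiting time depends only on the last letter
  of its index, which prefixing by \<open>x\<close> preserves, and prefixing is injective.\<close>

lemma distr_shift: "x \<in> words K \<Longrightarrow> distr law law (shift x) = law"
proof -
  assume x: "x \<in> words K"
  have "PiM idx (\<lambda>y. wait (x @ y)) = PiM idx wait"
    by (rule PiM_cong) (auto simp: wait_def idx_def)
  then show ?thesis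
    using distr_PiM_reindex[of idx wait "(@) x" idx] x
    by (auto simp: law_def shift_def[abs_def] inj_on_def prob_wait)
qed

lemma measurable_shift [measurable]: "x \<in> words K \<Longrightarrow> shift x \<in> measurable law law"
  unfolding law_def shift_def
  by (intro measurable_restrict)
    (simp add: measurable_cong_sets[OF refl sets_wait] append_idx flip: law_def)

lemma AE_shift:
  assumes "x \<in> words K" "AE s in law. Q s"
  shows "AE s in law. Q (shift x s)"
proof (rule AE_distrD[OF measurable_shift[OF assms(1)]])
  show "AE s in distr law law (shift x). Q s"
    unfolding distr_shift[OF assms(1)] by (rule assms(2))
qed

lemma integral_shift:
  fixes g :: "(nat list \<Rightarrow> real) \<Rightarrow> real"
  assumes "x \<in> words K" "g \<in> borel_measurable law"
  shows "(\<integral>s. g (shift x s) \<partial>law) = (\<integral>s. g s \<partial>law)"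
  using integral_distr[OF measurable_shift[OF assms(1)] assms(2)] distr_shift[OF assms(1)] by simp

lemma integrable_shift:
  fixes g :: "(nat list \<Rightarrow> real) \<Rightarrow> real"
  assumes "x \<in> words K" "integrable law g"
  shows "integrable law (\<lambda>s. g (shift x s))"
  by (rule integrable_distr[OF measurable_shift]) (use assms in \<open>simp_all add: distr_shift\<close>)

lemma nn_integral_shift:
  assumes "x \<in> words K" "g \<in> borel_measurable law"
  shows "(\<integral>\<^sup>+s. g (shift x s) \<partial>law) = (\<integral>\<^sup>+s. g s \<partial>law)"
  using nn_integral_distr[OF measurable_shift[OF assms(1)], of g] assms distr_shift[OF assms(1)] by simp

lemma shift_Nil: "s \<in> space law \<Longrightarrow> shift [] s = s"
  by (auto simp: law_def space_PiM shift_def)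

lemma shift_append: "y \<in> words K \<Longrightarrow> shift (x @ y) s = shift y (shift x s)"
  by (auto simp: shift_def idx_def)

lemma birth_append: "y \<in> words K \<Longrightarrow> birth s (x @ y) = birth s x + birth (shift x s) y"
proof (induction y rule: rev_induct)
  case (snoc i y)
  then have "birth s (x @ y @ [i]) = birth s x + birth (shift x s) y + (\<Sum>j=1..i. s (x @ y @ [j]))"
    using birth_snoc[of s "x @ y" i] by simp
  also have "(\<Sum>j=1..i. s (x @ y @ [j])) = (\<Sum>j=1..i. shift x s (y @ [j]))"
    using snoc.prems by (intro sum.cong) (auto simp: shift_def idx_def)
  finally show ?case by (simp add: birth_snoc)
qed simp

lemma AE_nonneg: "AE s in law. \<forall>y\<in>idx. 0 \<le> s y"
proof (subst AE_ball_countable)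
  show "\<forall>y\<in>idx. AE s in law. 0 \<le> s y"
  proof
    fix y assume y: "y \<in> idx"
    have "AE u in wait y. 0 \<le> u"
      unfolding wait_def using rate_pos[OF y]
      by (subst AE_density) (auto simp: exponential_density_def)
    then show "AE s in law. 0 \<le> s y"
      unfolding law_def using y by (intro AE_PiM_component[where P="\<lambda>u. 0 \<le> u"] prob_wait)
  qed
qed (simp add: idx_def)

lemma AE_birth_nonneg: "AE s in law. \<forall>x\<in>words K. 0 \<le> birth s x"
  using AE_nonneg by eventually_elim (auto intro: birth_nonneg simp: idx_def)

section \<open>Independence of the first generation and the subtrees of the children\<close>

lemma indep_coord: "indep_vars (\<lambda>_. borel) (\<lambda>y s. s y) idx"
proof (subst indep_vars_iff_distr_eq_PiM')
  show "idx \<noteq> {}" using K singleton_idx[of 1] by (metis atLeastAtMost_iff empty_iff le_refl one_le_numeral order_trans)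
  have "distr law (PiM idx (\<lambda>_. borel)) (\<lambda>s. \<lambda>y\<in>idx. s y) = distr law law (shift [])"
    by (intro distr_cong refl sets_law[symmetric]) (simp add: shift_def)
  also have "\<dots> = law" by (rule distr_shift) simp
  also have "law = PiM idx (\<lambda>y. distr law borel (\<lambda>s. s y))"
  proof -
    have "distr law borel (\<lambda>s. s y) = wait y" if "y \<in> idx" for y
    proof -
      have "distr law borel (\<lambda>s. s y) = distr (PiM idx wait) (wait y) (\<lambda>s. s y)"
        by (intro distr_cong) (auto simp: law_def)
      then show ?thesis using distr_PiM_component[of idx wait y] that prob_wait by simp
    qed
    then show ?thesis unfolding law_def by (intro PiM_cong) (auto simp: law_def)
  qed
  finally show "distr law (PiM idx (\<lambda>_. borel)) (\<lambda>s. \<lambda>y\<in>idx. s y) = PiM idx (\<lambda>y. distr law borel (\<lambda>s. s y))" .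
qed measurable

text \<open>Block 0 holds the waiting times of the first generation and block \<open>j\<close> those
  inside the subtree of child \<open>j\<close>. As \<open>idx\<close> omits the empty word,
  \<open>[j]\<close> belongs to block 0 only, and the blocks are disjoint.\<close>

definition block :: "nat \<Rightarrow> nat list set" where
  "block j = (if j = 0 then (\<lambda>i. [i]) ` {1..K} else (#) j ` idx)"

lemma indep_blocks:
  "indep_vars (\<lambda>j. PiM (block j) (\<lambda>_. borel)) (\<lambda>j s. restrict s (block j)) {0..K}"
proof -
  have "indep_vars (\<lambda>j. PiM (block j) (\<lambda>_. borel)) (\<lambda>j s. restrict (\<lambda>y. s y) (block j)) {0..K}"
  proof (rule indep_vars_restrict[OF indep_coord])
    show "block j \<subseteq> idx" if "j \<in> {0..K}" for j
      using that by (auto simp: block_def idx_def)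
    show "disjoint_family_on block {0..K}"
      by (auto simp: disjoint_family_on_def block_def idx_def)
  qed
  then show ?thesis by simp
qed

abbreviation root_sets :: "(nat list \<Rightarrow> real) measure" where
  "root_sets \<equiv> PiM (block 0) (\<lambda>_. borel)"

text \<open>Recovers \<open>shift [i] s\<close> from the coordinates in block \<open>i\<close>
  alone, which exhibits functions of a subtree as functions of its block.\<close>

definition unshift :: "nat \<Rightarrow> (nat list \<Rightarrow> real) \<Rightarrow> nat list \<Rightarrow> real" where
  "unshift i v = (\<lambda>y\<in>idx. v (i # y))"

lemma unshift_restrict: "i \<in> {1..K} \<Longrightarrow> unshift i (restrict s (block i)) = shift [i] s"
  by (auto simp: unshift_def shift_def block_def)

lemma measurable_unshift [measurable]:
  "i \<in> {1..K} \<Longrightarrow> unshift i \<in> measurable (PiM (block i) (\<lambda>_. borel)) law"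
  unfolding unshift_def measurable_cong_sets[OF refl sets_law]
  by (intro measurable_restrict measurable_component_singleton) (auto simp: block_def)

lemma indep_root_subtree:
  fixes f :: "(nat list \<Rightarrow> real) \<Rightarrow> ennreal"
  assumes [measurable]: "f \<in> borel_measurable root_sets" "g \<in> borel_measurable law"
    and i: "i \<in> {1..K}"
  shows "(\<integral>\<^sup>+s. f (restrict s (block 0)) * g (shift [i] s) \<partial>law)
    = (\<integral>\<^sup>+s. f (restrict s (block 0)) \<partial>law) * (\<integral>\<^sup>+s. g s \<partial>law)"
proof -
  define Y where "Y j = (if j = 0 then f else (\<lambda>v. g (unshift i v)))" for j :: nat
  have "indep_vars (\<lambda>j. PiM (block j) (\<lambda>_. borel)) (\<lambda>j s. restrict s (block j)) {0, i}"
    by (rule indep_vars_subset[OF indep_blocks]) (use i in auto)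
  then have "indep_vars (\<lambda>_. borel) (\<lambda>j s. Y j (restrict s (block j))) {0, i}"
    by (rule indep_vars_compose2) (use i in \<open>auto simp: Y_def\<close>)
  then have "(\<integral>\<^sup>+s. (\<Prod>j\<in>{0, i}. Y j (restrict s (block j))) \<partial>law)
      = (\<Prod>j\<in>{0, i}. \<integral>\<^sup>+s. Y j (restrict s (block j)) \<partial>law)"
    by (intro indep_vars_nn_integral) auto
  then show ?thesis using i
    by (simp add: Y_def unshift_restrict nn_integral_shift)
qed

text \<open>Here \<open>f\<close> depends on the first generation only. The factorisation serves for
  the mixed terms in squares of branching sums and, with \<open>f = 1\<close>, for extinction in two
  subtrees at once.\<close>

lemma indep_root_two_subtrees:
  fixes f g h :: "(nat list \<Rightarrow> real) \<Rightarrow> real"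
  assumes [measurable]: "f \<in> borel_measurable root_sets"
    and f: "integrable law (\<lambda>s. f (restrict s (block 0)))" and g: "integrable law g" and h: "integrable law h"
    and ij: "i \<in> {1..K}" "j \<in> {1..K}" "i \<noteq> j"
  shows "integrable law (\<lambda>s. f (restrict s (block 0)) * (g (shift [i] s) * h (shift [j] s)))" (is ?int)
    and "(\<integral>s. f (restrict s (block 0)) * (g (shift [i] s) * h (shift [j] s)) \<partial>law)
    = (\<integral>s. f (restrict s (block 0)) \<partial>law) * ((\<integral>s. g s \<partial>law) * (\<integral>s. h s \<partial>law))" (is ?eq)
proof -
  have [measurable]: "g \<in> borel_measurable law" "h \<in> borel_measurable law"
    using g h by auto
  define Y where "Y k = (if k = 0 then f else if k = i then (\<lambda>v. g (unshift i v)) else (\<lambda>v. h (unshift j v)))" for k :: nat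
  have "indep_vars (\<lambda>j. PiM (block j) (\<lambda>_. borel)) (\<lambda>j s. restrict s (block j)) {0, i, j}"
    by (rule indep_vars_subset[OF indep_blocks]) (use ij in auto)
  then have ind: "indep_vars (\<lambda>_. borel) (\<lambda>j s. Y j (restrict s (block j))) {0, i, j}"
    by (rule indep_vars_compose2) (use ij in \<open>auto simp: Y_def\<close>)
  have int: "integrable law (\<lambda>s. Y k (restrict s (block k)))" if "k \<in> {0, i, j}" for k
    using that ij f integrable_shift[OF _ g, of "[i]"] integrable_shift[OF _ h, of "[j]"]
    by (auto simp: Y_def unshift_restrict)
  have fin: "finite {0, i, j}" by simp
  show ?int ?eq
    using indep_vars_integrable[OF fin ind int] indep_vars_lebesgue_integral[OF fin ind int] ij
    by (simp_all add: Y_def unshift_restrict integral_shift)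
qed

section \<open>Laplace transforms of the birth times of the first generation\<close>

lemma birth_restrict: "i \<in> {1..K} \<Longrightarrow> birth (restrict s (block 0)) [i] = birth s [i]"
  by (auto simp: birth_singleton block_def intro!: sum.cong)

lemma measurable_root_birth [measurable]:
  "i \<in> {1..K} \<Longrightarrow> (\<lambda>v. birth v [i]) \<in> borel_measurable root_sets"
  unfolding birth_singleton
  by (intro borel_measurable_sum measurable_component_singleton) (auto simp: block_def)

text \<open>Closed form of the Laplace transform of the birth time of child \<open>i\<close>, a sum
  of independent exponential waiting times with rates \<open>w 0\<close> to
  \<open>w (i - 1)\<close>.\<close>

definition phi1 :: "nat \<Rightarrow> real \<Rightarrow> real" where
  "phi1 i r = (\<Prod>k<i. w k / (r + w k))"

definition phi :: "real \<Rightarrow> real" where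
  "phi r = (\<Sum>i=1..K. phi1 i r)"

lemma nn_integral_exp_wait:
  assumes y: "y \<in> idx" and r: "0 \<le> r"
  shows "(\<integral>\<^sup>+u. ennreal (exp (- (r * u))) \<partial>wait y) = ennreal (w (last y - 1) / (r + w (last y - 1)))"
proof -
  define l where "l = w (last y - 1)"
  have l: "0 < l" using rate_pos[OF y] by (simp add: l_def)
  interpret e: prob_space "density lborel (exponential_density (r + l))"
    using l r by (intro prob_space_exponential_density) simp
  have "(\<integral>\<^sup>+u. ennreal (exp (- (r * u))) \<partial>wait y)
      = (\<integral>\<^sup>+u. ennreal (exponential_density l u) * ennreal (exp (- (r * u))) \<partial>lborel)"
    unfolding wait_def l_def[symmetric] by (subst nn_integral_density) auto
  \<comment> \<open>Tilting an exponential density of rate \<open>l\<close> by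
    \<open>exp (- r * u)\<close> gives, up to the factor \<open>l / (r + l)\<close>, the density of
    rate \<open>r + l\<close>.\<close>
  also have "\<dots> = (\<integral>\<^sup>+u. ennreal (l / (r + l)) * ennreal (exponential_density (r + l) u) \<partial>lborel)"
  proof (intro nn_integral_cong)
    fix u :: real
    have "exp (- (u * l)) * exp (- (r * u)) = exp (- (u * (r + l)))"
      by (simp add: algebra_simps flip: exp_add)
    then show "ennreal (exponential_density l u) * ennreal (exp (- (r * u)))
        = ennreal (l / (r + l)) * ennreal (exponential_density (r + l) u)"
      using l r by (simp add: exponential_density_def flip: ennreal_mult)
  qed
  also have "\<dots> = ennreal (l / (r + l)) * emeasure (density lborel (exponential_density (r + l))) (space lborel)"
    by (simp add: nn_integral_cmult emeasure_density)
  also have "\<dots> = ennreal (l / (r + l))" using e.emeasure_space_1 by simp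
  finally show ?thesis by (simp add: l_def)
qed

lemma nn_integral_exp_birth:
  assumes i: "i \<in> {1..K}" and r: "0 \<le> r"
  shows "(\<integral>\<^sup>+s. ennreal (exp (- r * birth s [i])) \<partial>law) = ennreal (phi1 i r)"
proof -
  let ?J = "(\<lambda>j. [j]) ` {1..i}"
  have "(\<integral>\<^sup>+s. ennreal (exp (- r * birth s [i])) \<partial>law)
      = (\<integral>\<^sup>+s. (\<Prod>y\<in>?J. ennreal (exp (- (r * s y)))) \<partial>law)"
    by (intro nn_integral_cong)
      (simp add: birth_singleton sum_distrib_left exp_sum prod_ennreal prod.reindex inj_on_def flip: sum_negf)
  also have "\<dots> = (\<Prod>y\<in>?J. \<integral>\<^sup>+s. ennreal (exp (- (r * s y))) \<partial>law)"
  proof (rule indep_vars_nn_integral)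
    have "indep_vars (\<lambda>_. borel) (\<lambda>y s. s y) ?J"
      by (rule indep_vars_subset[OF indep_coord]) (use i in auto)
    then show "indep_vars (\<lambda>_. borel) (\<lambda>y s. ennreal (exp (- (r * s y)))) ?J"
      by (rule indep_vars_compose2) simp
  qed auto
  also have "\<dots> = (\<Prod>y\<in>?J. ennreal (w (last y - 1) / (r + w (last y - 1))))"
  proof (rule prod.cong[OF refl])
    fix y assume "y \<in> ?J"
    then have y: "y \<in> idx" using i by auto
    have "(\<integral>\<^sup>+s. ennreal (exp (- (r * s y))) \<partial>law) = (\<integral>\<^sup>+u. ennreal (exp (- (r * u))) \<partial>distr law (wait y) (\<lambda>s. s y))"
      unfolding law_def by (subst nn_integral_distr) (use y in \<open>auto intro: measurable_component_singleton simp: measurable_cong_sets[OF sets_wait refl]\<close>)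
    also have "distr law (wait y) (\<lambda>s. s y) = wait y"
      unfolding law_def by (intro distr_PiM_component prob_wait y)
    finally show "(\<integral>\<^sup>+s. ennreal (exp (- (r * s y))) \<partial>law) = ennreal (w (last y - 1) / (r + w (last y - 1)))"
      using nn_integral_exp_wait[OF y r] by simp
  qed
  also have "\<dots> = (\<Prod>j=1..i. ennreal (w (j - 1) / (r + w (j - 1))))"
    by (simp add: prod.reindex inj_on_def)
  also have "\<dots> = ennreal (\<Prod>j=1..i. w (j - 1) / (r + w (j - 1)))"
    using i r by (intro prod_ennreal) (auto intro!: divide_nonneg_nonneg add_nonneg_nonneg less_imp_le[OF w])
  also have "(\<Prod>j=1..i. w (j - 1) / (r + w (j - 1))) = phi1 i r"
    unfolding phi1_def by (rule prod.reindex_bij_witness[of _ Suc "\<lambda>j. j - 1"]) auto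
  finally show ?thesis .
qed

lemma phi1_nonneg: "i \<in> {1..K} \<Longrightarrow> 0 \<le> r \<Longrightarrow> 0 \<le> phi1 i r"
  unfolding phi1_def by (auto intro!: prod_nonneg divide_nonneg_nonneg add_nonneg_nonneg less_imp_le[OF w])

lemma phi_nonneg: "0 \<le> r \<Longrightarrow> 0 \<le> phi r"
  unfolding phi_def by (auto intro!: sum_nonneg phi1_nonneg)

lemma AE_exp_birth_le_1: "i \<in> {1..K} \<Longrightarrow> 0 \<le> r \<Longrightarrow> AE s in law. exp (- r * birth s [i]) \<le> 1"
  using AE_birth_nonneg by eventually_elim (auto dest!: bspec[of _ _ "[i]"])

lemma integrable_exp_birth:
  assumes "i \<in> {1..K}" "0 \<le> r"
  shows "integrable law (\<lambda>s. exp (- r * birth s [i]))"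
  using AE_exp_birth_le_1[OF assms] assms
  by (intro integrable_const_bound[where B=1]) auto

lemma integral_exp_birth:
  assumes "i \<in> {1..K}" "0 \<le> r"
  shows "(\<integral>s. exp (- r * birth s [i]) \<partial>law) = phi1 i r"
  using nn_integral_exp_birth[OF assms] phi1_nonneg[OF assms] assms
  by (subst integral_eq_nn_integral) auto

end

section \<open>The Malthusian parameter and the branching operator\<close>

context tree_law
begin

lemma phi1_Suc: "phi1 (Suc i) r = phi1 i r * (w i / (r + w i))"
  by (simp add: phi1_def)

lemma denom_pos: "k < K \<Longrightarrow> 0 \<le> r \<Longrightarrow> 0 < r + w k"
  using w[of k] by simp

lemma phi1_0: "i \<le> K \<Longrightarrow> phi1 i 0 = 1"
  unfolding phi1_def
proof (rule prod.neutral, rule ballI)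
  fix k assume "i \<le> K" "k \<in> {..<i}"
  then show "w k / (0 + w k) = 1" using w[of k] by simp
qed

lemma phi_0: "phi 0 = real K"
  by (simp add: phi_def phi1_0)

lemma phi1_strict_antimono:
  assumes "i \<in> {1..K}" "0 \<le> r" "r < r'"
  shows "phi1 i r' < phi1 i r"
proof -
  have less: "w k / (r' + w k) < w k / (r + w k)" "0 < w k / (r' + w k)" if "k < i" for k
  proof -
    have "0 < w k" using that assms by (intro w) auto
    then show "w k / (r' + w k) < w k / (r + w k)" "0 < w k / (r' + w k)"
      using assms by (auto intro!: divide_strict_left_mono mult_pos_pos add_nonneg_pos)
  qed
  show ?thesis
    unfolding phi1_def
  proof (rule prod_mono_strict)
    show "0 \<in> {..<i}" "w 0 / (r' + w 0) < w 0 / (r + w 0)" using assms less[of 0] by auto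
    show "0 \<le> w k / (r' + w k) \<and> w k / (r' + w k) \<le> w k / (r + w k)" if "k \<in> {..<i}" for k
      using less[of k] that by simp
    show "0 < w k / (r + w k)" if "k \<in> {..<i}" for k
      using less[of k] that by (meson lessThan_iff order.strict_trans)
  qed simp
qed

lemma phi_strict_antimono: "0 \<le> r \<Longrightarrow> r < r' \<Longrightarrow> phi r' < phi r"
  unfolding phi_def using K by (intro sum_strict_mono phi1_strict_antimono) auto

lemma phi_antimono: "0 \<le> r \<Longrightarrow> r \<le> r' \<Longrightarrow> phi r' \<le> phi r"
  using phi_strict_antimono[of r r'] by (cases "r = r'") auto

lemma phi_differentiable:
  assumes "0 \<le> r"
  shows "phi differentiable (at r)"
proof -
  have "(\<lambda>r. phi1 i r) differentiable (at r)" if "i \<le> K" for i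
    using that
  proof (induction i)
    case (Suc i)
    then show ?case
      unfolding phi1_Suc using denom_pos[of i r] assms
      by (intro differentiable_mult differentiable_divide differentiable_add
          differentiable_const differentiable_ident) auto
  qed (simp add: phi1_def[abs_def])
  then show ?thesis
    unfolding phi_def[abs_def] by (intro differentiable_sum ballI) auto
qed

text \<open>Every factor is at most 1, so only the factor for \<open>k = 0\<close> is kept. The
  bound decays in \<open>r\<close>, which supplies the right end of the intermediate value argument
  below.\<close>

lemma phi_upper:
  assumes "0 \<le> r"
  shows "phi r \<le> K * (w 0 / (r + w 0))"
proof -
  have w0: "0 < w 0" using K by (intro w) simp
  have "phi1 i r \<le> w 0 / (r + w 0)" if i: "i \<in> {1..K}" for i
  proof -
    obtain j where j: "i = Suc j" using i by (cases i) auto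
    have "(\<Prod>k\<in>{..<i}. w k / (r + w k)) = w 0 / (r + w 0) * (\<Prod>k\<in>{1..<i}. w k / (r + w k))"
    proof -
      have "{..<i} = insert 0 {1..<i}" using j by auto
      then show ?thesis by simp
    qed
    also have "\<dots> \<le> w 0 / (r + w 0) * 1"
    proof (intro mult_left_mono prod_le_1)
      fix k assume "k \<in> {1..<i}"
      then have "k < K" using i by auto
      then show "0 \<le> w k / (r + w k) \<and> w k / (r + w k) \<le> 1"
        using w[of k] assms by simp
    qed (use w0 assms in simp)
    finally show ?thesis by (simp add: phi1_def)
  qed
  then have "phi r \<le> (\<Sum>i=1..K. w 0 / (r + w 0))"
    unfolding phi_def by (intro sum_mono) auto
  then show ?thesis by simp
qed

lemma ex_phi_eq:
  assumes v: "0 < v" "v \<le> real K"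
  shows "\<exists>r\<ge>0. phi r = v"
proof -
  \<comment> \<open>As \<open>R * v = K * w 0\<close>, the upper bound for \<open>phi\<close> at
    \<open>R\<close> is at most \<open>v\<close>; at 0 the value of \<open>phi\<close> is
    \<open>K\<close>.\<close>
  define R where "R = K * w 0 / v"
  have w0: "0 < w 0" using K by (intro w) simp
  have R: "0 \<le> R" using w0 v by (simp add: R_def)
  have "phi R \<le> K * (w 0 / (R + w 0))" by (rule phi_upper[OF R])
  also have "\<dots> = K * w 0 / (R + w 0)" by simp
  also have "\<dots> \<le> v"
  proof -
    have "v * (R + w 0) = K * w 0 + v * w 0" using v by (simp add: R_def distrib_left)
    then have "K * w 0 \<le> v * (R + w 0)" using v w0 by simp
    then show ?thesis using R w0 by (simp add: pos_divide_le_eq)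
  qed
  finally have "phi R \<le> v" .
  moreover have "continuous_on {0..R} phi"
    by (intro continuous_at_imp_continuous_on ballI differentiable_imp_continuous_within phi_differentiable) auto
  ultimately have "\<exists>r\<ge>0. r \<le> R \<and> phi r = v"
    using R v by (intro IVT2') (auto simp: phi_0)
  then show ?thesis by blast
qed

definition malthus :: real where
  "malthus = (SOME r. 0 \<le> r \<and> phi r = 1)"

lemma malthus: "0 < malthus" "phi malthus = 1"
proof -
  have "\<exists>r. 0 \<le> r \<and> phi r = 1" using ex_phi_eq[of 1] K by auto
  then have *: "0 \<le> malthus \<and> phi malthus = 1" unfolding malthus_def by (rule someI_ex)
  then show "phi malthus = 1" by simp
  with * show "0 < malthus" using phi_0 K by (cases "malthus = 0") auto
qed

lemma phi_less_1: "malthus < r \<Longrightarrow> phi r < 1"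
  using phi_strict_antimono[of malthus r] malthus by simp

section \<open>Square integrable functionals of the waiting times\<close>

definition sqint :: "((nat list \<Rightarrow> real) \<Rightarrow> real) \<Rightarrow> bool" where
  "sqint g \<longleftrightarrow> g \<in> borel_measurable law \<and> integrable law (\<lambda>s. (g s)\<^sup>2)"

lemma sqint_measurable [measurable_dest]: "sqint g \<Longrightarrow> g \<in> borel_measurable law"
  by (simp add: sqint_def)

lemma sqint_integrable_sq: "sqint g \<Longrightarrow> integrable law (\<lambda>s. (g s)\<^sup>2)"
  by (simp add: sqint_def)

lemma sqint_integrable: "sqint g \<Longrightarrow> integrable law g"
  unfolding sqint_def by (rule square_integrable_imp_integrable[OF conjunct1 conjunct2])

lemma weighted_square_add_le:
  fixes a b e :: real
  assumes "0 < e"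
  shows "(a + b)\<^sup>2 \<le> (1 + e) * a\<^sup>2 + (1 + 1 / e) * b\<^sup>2"
proof -
  have "0 \<le> (sqrt e * a - b / sqrt e)\<^sup>2" by simp
  also have "\<dots> = e * a\<^sup>2 + b\<^sup>2 / e - 2 * a * b"
    using assms by (simp add: power2_diff power_mult_distrib power_divide)
  finally show ?thesis by (simp add: power2_sum algebra_simps)
qed

lemma sqint_add:
  assumes a: "sqint a" and b: "sqint b"
  shows "sqint (\<lambda>s. a s + b s)"
proof -
  have [measurable]: "a \<in> borel_measurable law" "b \<in> borel_measurable law"
    using a b by (auto simp: sqint_def)
  have "integrable law (\<lambda>s. (a s + b s)\<^sup>2)"
  proof (rule Bochner_Integration.integrable_bound)
    show "integrable law (\<lambda>s. (1 + 1) * (a s)\<^sup>2 + (1 + 1 / 1) * (b s)\<^sup>2)"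
      using a b by (auto simp: sqint_def)
    show "AE s in law. norm ((a s + b s)\<^sup>2) \<le> norm ((1 + 1) * (a s)\<^sup>2 + (1 + 1 / 1) * (b s)\<^sup>2)"
    proof (rule AE_I2)
      fix s show "norm ((a s + b s)\<^sup>2) \<le> norm ((1 + 1) * (a s)\<^sup>2 + (1 + 1 / 1) * (b s)\<^sup>2)"
        using weighted_square_add_le[of 1 "a s" "b s"] by simp
    qed
  qed measurable
  then show ?thesis by (simp add: sqint_def)
qed

lemma sqint_cmult: "sqint a \<Longrightarrow> sqint (\<lambda>s. c * a s)"
  by (auto simp: sqint_def power_mult_distrib)

lemma sqint_const: "sqint (\<lambda>s. c)"
  by (simp add: sqint_def)

lemma sqint_diff: "sqint a \<Longrightarrow> sqint b \<Longrightarrow> sqint (\<lambda>s. a s - b s)"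
  using sqint_add[of a "\<lambda>s. -1 * b s"] sqint_cmult[of b "-1"] by simp

lemma integral_square_add_le:
  assumes a: "sqint a" and b: "sqint b" and e: "0 < e"
  shows "(\<integral>s. (a s + b s)\<^sup>2 \<partial>law) \<le> (1 + e) * (\<integral>s. (a s)\<^sup>2 \<partial>law) + (1 + 1 / e) * (\<integral>s. (b s)\<^sup>2 \<partial>law)"
proof -
  have "(\<integral>s. (a s + b s)\<^sup>2 \<partial>law) \<le> (\<integral>s. (1 + e) * (a s)\<^sup>2 + (1 + 1 / e) * (b s)\<^sup>2 \<partial>law)"
    using a b sqint_add[OF a b] e
    by (intro integral_mono weighted_square_add_le) (auto simp: sqint_def)
  also have "\<dots> = (1 + e) * (\<integral>s. (a s)\<^sup>2 \<partial>law) + (1 + 1 / e) * (\<integral>s. (b s)\<^sup>2 \<partial>law)"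
    using a b by (subst Bochner_Integration.integral_add) (auto simp: sqint_def)
  finally show ?thesis .
qed

lemma indep_root_subtree_real:
  fixes f g :: "(nat list \<Rightarrow> real) \<Rightarrow> real"
  assumes f: "f \<in> borel_measurable root_sets" "integrable law (\<lambda>s. f (restrict s (block 0)))"
    and g: "integrable law g" and i: "i \<in> {1..K}"
  shows "integrable law (\<lambda>s. f (restrict s (block 0)) * g (shift [i] s))" (is ?int)
    and "(\<integral>s. f (restrict s (block 0)) * g (shift [i] s) \<partial>law)
      = (\<integral>s. f (restrict s (block 0)) \<partial>law) * (\<integral>s. g s \<partial>law)" (is ?eq)
proof -
  \<comment> \<open>The lemma on two subtrees is applied with the constant 1 on some other child,
    which exists because \<open>K \<ge> 2\<close>.\<close>
  obtain j where j: "j \<in> {1..K}" "i \<noteq> j"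
    using K i by (cases "i = 1") (auto intro: that[of 1] that[of 2])
  have one: "(\<integral>s. 1 \<partial>law) = (1 :: real)" by (simp add: prob_space)
  show ?int ?eq
    using indep_root_two_subtrees[OF f g integrable_const[of 1] i j]
    unfolding one mult_1_right by blast+
qed

section \<open>The one-generation branching operator\<close>

definition sumop :: "real \<Rightarrow> ((nat list \<Rightarrow> real) \<Rightarrow> real) \<Rightarrow> (nat list \<Rightarrow> real) \<Rightarrow> real" where
  "sumop r g s = (\<Sum>i=1..K. exp (- r * birth s [i]) * g (shift [i] s))"

lemma measurable_sumop [measurable]:
  "g \<in> borel_measurable law \<Longrightarrow> sumop r g \<in> borel_measurable law"
  unfolding sumop_def
  by (intro borel_measurable_sum borel_measurable_times borel_measurable_exp borel_measurable_const
      measurable_birth measurable_compose[OF measurable_shift]) auto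

lemma nn_integral_sumop:
  assumes [measurable]: "g \<in> borel_measurable law" and g: "\<And>s. 0 \<le> g s" and r: "0 \<le> r"
  shows "(\<integral>\<^sup>+s. ennreal (sumop r g s) \<partial>law) = ennreal (phi r) * (\<integral>\<^sup>+s. ennreal (g s) \<partial>law)"
proof -
  have "(\<integral>\<^sup>+s. ennreal (sumop r g s) \<partial>law)
      = (\<integral>\<^sup>+s. (\<Sum>i=1..K. ennreal (exp (- r * birth (restrict s (block 0)) [i])) * ennreal (g (shift [i] s))) \<partial>law)"
    by (intro nn_integral_cong)
      (simp add: sumop_def g birth_restrict sum_nonneg flip: sum_ennreal ennreal_mult)
  also have "\<dots> = (\<Sum>i=1..K. \<integral>\<^sup>+s. ennreal (exp (- r * birth (restrict s (block 0)) [i])) * ennreal (g (shift [i] s)) \<partial>law)"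
    by (intro nn_integral_sum) (simp add: birth_restrict)
  also have "\<dots> = (\<Sum>i=1..K. ennreal (phi1 i r) * (\<integral>\<^sup>+s. ennreal (g s) \<partial>law))"
  proof (rule sum.cong[OF refl])
    fix i assume i: "i \<in> {1..K}"
    then show "(\<integral>\<^sup>+s. ennreal (exp (- r * birth (restrict s (block 0)) [i])) * ennreal (g (shift [i] s)) \<partial>law)
      = ennreal (phi1 i r) * (\<integral>\<^sup>+s. ennreal (g s) \<partial>law)"
      using indep_root_subtree[of "\<lambda>v. ennreal (exp (- r * birth v [i]))" "\<lambda>s. ennreal (g s)" i]
        nn_integral_exp_birth[OF i r]
      by (simp add: birth_restrict)
  qed
  also have "\<dots> = ennreal (phi r) * (\<integral>\<^sup>+s. ennreal (g s) \<partial>law)"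
  proof -
    have "(\<Sum>i=1..K. ennreal (phi1 i r)) = ennreal (phi r)"
      unfolding phi_def using phi1_nonneg[OF _ r] by (rule sum_ennreal)
    then show ?thesis by (simp flip: sum_distrib_right)
  qed
  finally show ?thesis .
qed

text \<open>Distinct subtrees are independent, so the off-diagonal terms only see the mean of \<open>g\<close>;
  the contraction factor \<open>phi (2 * r) < 1\<close> of the diagonal drives all estimates below.\<close>

lemma integral_sumop_sq:
  assumes g: "sqint g" and r: "0 \<le> r"
  shows "sqint (sumop r g)"
    and "(\<integral>s. (sumop r g s)\<^sup>2 \<partial>law) \<le> phi (2 * r) * (\<integral>s. (g s)\<^sup>2 \<partial>law) + (real K)\<^sup>2 * (\<integral>s. g s \<partial>law)\<^sup>2"
proof -
  note [measurable] = sqint_measurable[OF g]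
  define e where "e i s = exp (- r * birth s [i])" for i s
  define t where "t i j s = (e i s * g (shift [i] s)) * (e j s * g (shift [j] s))" for i j s
  have sq: "(sumop r g s)\<^sup>2 = (\<Sum>i=1..K. \<Sum>j=1..K. t i j s)" for s
    by (simp add: sumop_def power2_eq_square sum_product t_def e_def)
  have meas: "(\<lambda>v. e i v * e j v) \<in> borel_measurable root_sets"
    if "i \<in> {1..K}" "j \<in> {1..K}" for i j
    using that unfolding e_def by measurable
  have er: "e i (restrict s (block 0)) = e i s" if "i \<in> {1..K}" for i s
    using that by (simp add: e_def birth_restrict)
  have e1: "AE s in law. e i s * e j s \<le> 1" if "i \<in> {1..K}" "j \<in> {1..K}" for i j
    using AE_exp_birth_le_1[OF that(1) r] AE_exp_birth_le_1[OF that(2) r]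
    by eventually_elim (auto simp: e_def intro!: mult_le_one)
  have e0: "0 \<le> e i s" for i s by (simp add: e_def)
  have inte: "integrable law (\<lambda>s. e i s * e j s)" if "i \<in> {1..K}" "j \<in> {1..K}" for i j
  proof (rule integrable_const_bound[where B=1])
    show "AE s in law. norm (e i s * e j s) \<le> 1"
      using e1[OF that] by eventually_elim (simp add: abs_mult e0)
    show "(\<lambda>s. e i s * e j s) \<in> borel_measurable law"
      using borel_measurable_integrable[OF integrable_exp_birth[OF that(1) r]]
        borel_measurable_integrable[OF integrable_exp_birth[OF that(2) r]]
      unfolding e_def by (rule borel_measurable_times)
  qed
  have t: "integrable law (t i j) \<and> (\<integral>s. t i j s \<partial>law)
      \<le> (if i = j then phi1 i (2 * r) * (\<integral>s. (g s)\<^sup>2 \<partial>law) else 0) + (\<integral>s. g s \<partial>law)\<^sup>2"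
    if ij: "i \<in> {1..K}" "j \<in> {1..K}" for i j
  proof (cases "i = j")
    case True
    have teq: "t i j = (\<lambda>s. (e i s * e i s) * (g (shift [i] s))\<^sup>2)"
      by (auto simp: t_def True power2_eq_square)
    have e2: "e i s * e i s = exp (- (2 * r) * birth s [i])" for s
      by (simp add: e_def flip: exp_add)
    have m2: "(\<integral>s. e i s * e i s \<partial>law) = phi1 i (2 * r)"
      unfolding e2 using r by (intro integral_exp_birth ij) simp
    have "integrable law (\<lambda>s. (e i s * e i s) * (g (shift [i] s))\<^sup>2)"
      and "(\<integral>s. (e i s * e i s) * (g (shift [i] s))\<^sup>2 \<partial>law) = phi1 i (2 * r) * (\<integral>s. (g s)\<^sup>2 \<partial>law)"
      using indep_root_subtree_real[of "\<lambda>v. e i v * e i v" "\<lambda>s. (g s)\<^sup>2" i] meas[OF ij(1) ij(1)]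
        inte[OF ij(1) ij(1)] ij(1) sqint_integrable_sq[OF g]
      by (simp_all add: er m2)
    then show ?thesis unfolding teq using True by simp
  next
    case False
    have teq: "t i j = (\<lambda>s. (e i s * e j s) * (g (shift [i] s) * g (shift [j] s)))"
      by (auto simp: t_def)
    have "integrable law (t i j)"
      and eq: "(\<integral>s. t i j s \<partial>law) = (\<integral>s. e i s * e j s \<partial>law) * (\<integral>s. g s \<partial>law)\<^sup>2"
      using indep_root_two_subtrees[of "\<lambda>v. e i v * e j v" g g i j] meas[OF ij] inte[OF ij] ij
        sqint_integrable[OF g] False
      by (simp_all add: er teq power2_eq_square)
    \<comment> \<open>The off-diagonal weights are bounded crudely by 1: they multiply the squared
      mean of \<open>g\<close>, which is at most 1 or even zero in the applications.\<close>
    have "(\<integral>s. e i s * e j s \<partial>law) \<le> (\<integral>s. 1 \<partial>law)"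
      using e1[OF ij] inte[OF ij] by (intro integral_mono_AE) auto
    then have "(\<integral>s. e i s * e j s \<partial>law) \<le> 1" by (simp add: prob_space)
    then have "(\<integral>s. e i s * e j s \<partial>law) * (\<integral>s. g s \<partial>law)\<^sup>2 \<le> 1 * (\<integral>s. g s \<partial>law)\<^sup>2"
      by (intro mult_right_mono) auto
    then show ?thesis using \<open>integrable law (t i j)\<close> eq False by simp
  qed
  have "integrable law (\<lambda>s. \<Sum>i=1..K. \<Sum>j=1..K. t i j s)"
    using t by (intro Bochner_Integration.integrable_sum) auto
  then show "sqint (sumop r g)" by (simp add: sqint_def sq)
  have "(\<integral>s. (sumop r g s)\<^sup>2 \<partial>law) = (\<Sum>i=1..K. \<Sum>j=1..K. \<integral>s. t i j s \<partial>law)"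
    unfolding sq using t
    by (subst Bochner_Integration.integral_sum;
        (intro sum.cong refl Bochner_Integration.integral_sum Bochner_Integration.integrable_sum)?; blast)
  also have "\<dots> \<le> (\<Sum>i=1..K. \<Sum>j=1..K. (if i = j then phi1 i (2 * r) * (\<integral>s. (g s)\<^sup>2 \<partial>law) else 0) + (\<integral>s. g s \<partial>law)\<^sup>2)"
    using t by (intro sum_mono) blast
  also have "\<dots> = phi (2 * r) * (\<integral>s. (g s)\<^sup>2 \<partial>law) + (real K)\<^sup>2 * (\<integral>s. g s \<partial>law)\<^sup>2"
    by (simp add: sum.distrib phi_def sum_distrib_right power2_eq_square)
  finally show "(\<integral>s. (sumop r g s)\<^sup>2 \<partial>law) \<le> phi (2 * r) * (\<integral>s. (g s)\<^sup>2 \<partial>law) + (real K)\<^sup>2 * (\<integral>s. g s \<partial>law)\<^sup>2" .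
qed

text \<open>The cost of changing the exponent. Cauchy-Schwarz over the children gives the factor
  \<open>K\<close>. The weight differences \<open>d\<close> lie between 0 and 1, so
  \<open>d\<^sup>2 \<le> d\<close>, and the mean of \<open>d\<close> is a difference of values of
  \<open>phi1\<close>.\<close>

lemma integral_sumop_diff_sq:
  assumes g: "sqint g" and r: "0 \<le> r" "r \<le> r'"
  shows "sqint (\<lambda>s. sumop r g s - sumop r' g s)"
    and "(\<integral>s. (sumop r g s - sumop r' g s)\<^sup>2 \<partial>law) \<le> K * (phi r - phi r') * (\<integral>s. (g s)\<^sup>2 \<partial>law)"
proof -
  note [measurable] = sqint_measurable[OF g]
  define d where "d i s = exp (- r * birth s [i]) - exp (- r' * birth s [i])" for i s
  have r': "0 \<le> r'" using r by simp
  have eq: "sumop r g s - sumop r' g s = (\<Sum>i=1..K. d i s * g (shift [i] s))" for s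
    by (simp add: sumop_def d_def sum_subtractf left_diff_distrib)
  have meas: "(\<lambda>v. (d i v)\<^sup>2) \<in> borel_measurable root_sets" if "i \<in> {1..K}" for i
    using that unfolding d_def by measurable
  have dr: "d i (restrict s (block 0)) = d i s" if "i \<in> {1..K}" for i s
    using that by (simp add: d_def birth_restrict)
  have d1: "AE s in law. 0 \<le> d i s \<and> d i s \<le> 1" if "i \<in> {1..K}" for i
    using AE_birth_nonneg
  proof eventually_elim
    case (elim s)
    then have "0 \<le> birth s [i]" using that by simp
    then have "exp (- r' * birth s [i]) \<le> exp (- r * birth s [i])" "exp (- r * birth s [i]) \<le> 1"
      using r by (auto intro: mult_right_mono)
    moreover have "0 \<le> exp (- r' * birth s [i])" by simp
    ultimately show ?case unfolding d_def by linarith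
  qed
  have intd: "integrable law (d i)" "(\<integral>s. d i s \<partial>law) = phi1 i r - phi1 i r'" if "i \<in> {1..K}" for i
    using integrable_exp_birth[OF that r(1)] integrable_exp_birth[OF that r']
      integral_exp_birth[OF that r(1)] integral_exp_birth[OF that r']
    by (simp_all add: d_def[abs_def])
  have d2: "AE s in law. (d i s)\<^sup>2 \<le> d i s" if "i \<in> {1..K}" for i
    using d1[OF that] by eventually_elim (auto simp: power2_eq_square intro: mult_left_le)
  have intd2: "integrable law (\<lambda>s. (d i s)\<^sup>2)" if "i \<in> {1..K}" for i
    by (rule Bochner_Integration.integrable_bound[OF intd(1)[OF that]])
      (use d2[OF that] d1[OF that] intd(1)[OF that] in \<open>auto elim: eventually_mono\<close>)
  have t: "integrable law (\<lambda>s. (d i s)\<^sup>2 * (g (shift [i] s))\<^sup>2)"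
    "(\<integral>s. (d i s)\<^sup>2 * (g (shift [i] s))\<^sup>2 \<partial>law) \<le> (phi1 i r - phi1 i r') * (\<integral>s. (g s)\<^sup>2 \<partial>law)"
    if i: "i \<in> {1..K}" for i
  proof -
    show "integrable law (\<lambda>s. (d i s)\<^sup>2 * (g (shift [i] s))\<^sup>2)"
      using indep_root_subtree_real(1)[of "\<lambda>v. (d i v)\<^sup>2" "\<lambda>s. (g s)\<^sup>2" i] meas[OF i] intd2[OF i] i
        sqint_integrable_sq[OF g] by (simp add: dr)
    have "(\<integral>s. (d i s)\<^sup>2 * (g (shift [i] s))\<^sup>2 \<partial>law) = (\<integral>s. (d i s)\<^sup>2 \<partial>law) * (\<integral>s. (g s)\<^sup>2 \<partial>law)"
      using indep_root_subtree_real(2)[of "\<lambda>v. (d i v)\<^sup>2" "\<lambda>s. (g s)\<^sup>2" i] meas[OF i] intd2[OF i] i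
        sqint_integrable_sq[OF g] by (simp add: dr)
    also have "(\<integral>s. (d i s)\<^sup>2 \<partial>law) \<le> (\<integral>s. d i s \<partial>law)"
      using d2[OF i] intd2[OF i] intd(1)[OF i] by (intro integral_mono_AE)
    finally show "(\<integral>s. (d i s)\<^sup>2 * (g (shift [i] s))\<^sup>2 \<partial>law) \<le> (phi1 i r - phi1 i r') * (\<integral>s. (g s)\<^sup>2 \<partial>law)"
      by (simp add: intd(2)[OF i] mult_right_mono)
  qed
  show sq: "sqint (\<lambda>s. sumop r g s - sumop r' g s)"
    using integral_sumop_sq(1)[OF g] r r' by (intro sqint_diff) auto
  have "(\<integral>s. (sumop r g s - sumop r' g s)\<^sup>2 \<partial>law) \<le> (\<integral>s. K * (\<Sum>i=1..K. (d i s)\<^sup>2 * (g (shift [i] s))\<^sup>2) \<partial>law)"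
  proof (rule integral_mono)
    show "integrable law (\<lambda>s. (sumop r g s - sumop r' g s)\<^sup>2)" using sq by (rule sqint_integrable_sq)
    show "integrable law (\<lambda>s. K * (\<Sum>i=1..K. (d i s)\<^sup>2 * (g (shift [i] s))\<^sup>2))"
      using t(1) by (intro integrable_mult_right Bochner_Integration.integrable_sum) auto
    show "(sumop r g s - sumop r' g s)\<^sup>2 \<le> K * (\<Sum>i=1..K. (d i s)\<^sup>2 * (g (shift [i] s))\<^sup>2)" for s
      unfolding eq using sum_squared_le_sum_of_squares[of "\<lambda>i. d i s * g (shift [i] s)" "{1..K}"]
      by (simp add: power_mult_distrib mult.commute)
  qed
  also have "\<dots> = K * (\<Sum>i=1..K. \<integral>s. (d i s)\<^sup>2 * (g (shift [i] s))\<^sup>2 \<partial>law)"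
    using t(1) by (subst integral_mult_right_zero, subst Bochner_Integration.integral_sum) auto
  also have "\<dots> \<le> K * (\<Sum>i=1..K. (phi1 i r - phi1 i r') * (\<integral>s. (g s)\<^sup>2 \<partial>law))"
    using t(2) by (intro mult_left_mono sum_mono) auto
  also have "\<dots> = K * (phi r - phi r') * (\<integral>s. (g s)\<^sup>2 \<partial>law)"
    by (simp add: phi_def sum_subtractf flip: sum_distrib_right)
  finally show "(\<integral>s. (sumop r g s - sumop r' g s)\<^sup>2 \<partial>law) \<le> K * (phi r - phi r') * (\<integral>s. (g s)\<^sup>2 \<partial>law)" .
qed

section \<open>Sums over a whole generation\<close>

definition lvlsum :: "real \<Rightarrow> ((nat list \<Rightarrow> real) \<Rightarrow> real) \<Rightarrow> nat \<Rightarrow> (nat list \<Rightarrow> real) \<Rightarrow> real" where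
  "lvlsum r g n s = (\<Sum>x\<in>lvl K n. exp (- r * birth s x) * g (shift x s))"

lemma lvlsum_0: "s \<in> space law \<Longrightarrow> lvlsum r g 0 s = g s"
  by (simp add: lvlsum_def shift_Nil)

text \<open>A word is split after its first letter: generation \<open>n + 1\<close> of the tree is
  generation \<open>n\<close> in the subtrees of the children. Iteration makes the means of
  generation sums powers of \<open>phi r\<close>.\<close>

lemma lvlsum_Suc: "lvlsum r g (Suc n) s = sumop r (lvlsum r g n) s"
proof -
  have "lvlsum r g (Suc n) s = (\<Sum>i=1..K. \<Sum>x\<in>lvl K n. exp (- r * birth s (i # x)) * g (shift (i # x) s))"
    by (simp add: lvlsum_def sum_lvl_Suc)
  also have "\<dots> = (\<Sum>i=1..K. \<Sum>x\<in>lvl K n. exp (- r * birth s [i]) *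
      (exp (- r * birth (shift [i] s) x) * g (shift x (shift [i] s))))"
  proof (intro sum.cong refl)
    fix i x assume "x \<in> lvl K n"
    then have x: "x \<in> words K" by (rule lvl_subset_words)
    show "exp (- r * birth s (i # x)) * g (shift (i # x) s) = exp (- r * birth s [i]) *
      (exp (- r * birth (shift [i] s) x) * g (shift x (shift [i] s)))"
      using birth_append[OF x, of s "[i]"] shift_append[OF x, of "[i]" s]
      by (simp add: algebra_simps flip: exp_add)
  qed
  finally show ?thesis by (simp add: lvlsum_def sumop_def sum_distrib_left)
qed

lemma measurable_lvlsum [measurable]:
  "g \<in> borel_measurable law \<Longrightarrow> lvlsum r g n \<in> borel_measurable law"
  unfolding lvlsum_def
  by (intro borel_measurable_sum borel_measurable_times borel_measurable_exp borel_measurable_const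
      measurable_birth measurable_compose[OF measurable_shift]) (auto dest: lvl_subset_words)

lemma lvlsum_nonneg: "(\<And>s. 0 \<le> g s) \<Longrightarrow> 0 \<le> lvlsum r g n s"
  by (simp add: lvlsum_def sum_nonneg)

lemma nn_integral_lvlsum:
  assumes [measurable]: "g \<in> borel_measurable law" and g: "\<And>s. 0 \<le> g s" and r: "0 \<le> r"
  shows "(\<integral>\<^sup>+s. ennreal (lvlsum r g n s) \<partial>law) = ennreal (phi r ^ n) * (\<integral>\<^sup>+s. ennreal (g s) \<partial>law)"
proof (induction n)
  case 0
  show ?case by (simp add: lvlsum_0 cong: nn_integral_cong)
next
  case (Suc n)
  have "(\<integral>\<^sup>+s. ennreal (lvlsum r g (Suc n) s) \<partial>law) = ennreal (phi r) * (\<integral>\<^sup>+s. ennreal (lvlsum r g n s) \<partial>law)"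
    unfolding lvlsum_Suc using g r by (intro nn_integral_sumop lvlsum_nonneg) auto
  then show ?case using Suc phi_nonneg[OF r] by (simp add: ennreal_mult mult.assoc)
qed

end

section \<open>Exponential sums over the tree\<close>

context tree_law
begin

text \<open>First moment method: a series of nonnegative variables with finite total mean is finite
  almost surely. All almost sure summability below rests on this.\<close>

lemma AE_summable_of_nn_integral:
  fixes X :: "nat \<Rightarrow> (nat list \<Rightarrow> real) \<Rightarrow> real"
  assumes meas [measurable]: "\<And>n. X n \<in> borel_measurable law" and nonneg: "\<And>n s. 0 \<le> X n s"
    and le: "\<And>n. (\<integral>\<^sup>+s. ennreal (X n s) \<partial>law) \<le> ennreal (b n)"
    and b: "\<And>n. 0 \<le> b n" "summable b"
  shows "AE s in law. summable (\<lambda>n. X n s)"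
proof -
  have "(\<integral>\<^sup>+s. (\<Sum>n. ennreal (X n s)) \<partial>law) = (\<Sum>n. \<integral>\<^sup>+s. ennreal (X n s) \<partial>law)"
    by (rule nn_integral_suminf) measurable
  also have "\<dots> \<le> (\<Sum>n. ennreal (b n))"
    by (intro suminf_le le) auto
  also have "\<dots> < top"
    using ennreal_suminf_neq_top[OF b(2,1)] by (simp add: less_top)
  finally have "(\<integral>\<^sup>+s. (\<Sum>n. ennreal (X n s)) \<partial>law) \<noteq> \<infinity>" by simp
  then have "AE s in law. (\<Sum>n. ennreal (X n s)) \<noteq> \<infinity>"
    by (intro nn_integral_PInf_AE) measurable
  then show ?thesis
    by eventually_elim (auto intro: summable_suminf_not_top nonneg)
qed

text \<open>Fatou's lemma for the squares: almost sure limits inherit a uniform bound on second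
  moments.\<close>

lemma sqint_limit:
  fixes f :: "nat \<Rightarrow> (nat list \<Rightarrow> real) \<Rightarrow> real"
  assumes f: "\<And>n. sqint (f n)" "\<And>n. (\<integral>s. (f n s)\<^sup>2 \<partial>law) \<le> C"
    and g [measurable]: "g \<in> borel_measurable law"
    and lim: "AE s in law. (\<lambda>n. f n s) \<longlonglongrightarrow> g s"
  shows "sqint g" "(\<integral>s. (g s)\<^sup>2 \<partial>law) \<le> C"
proof -
  have [measurable]: "f n \<in> borel_measurable law" for n using f(1) by (rule sqint_measurable)
  have "0 \<le> (\<integral>s. (f 0 s)\<^sup>2 \<partial>law)" by simp
  then have C: "0 \<le> C" using f(2)[of 0] by linarith
  have "(\<integral>\<^sup>+s. ennreal ((g s)\<^sup>2) \<partial>law) = (\<integral>\<^sup>+s. liminf (\<lambda>n. ennreal ((f n s)\<^sup>2)) \<partial>law)"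
  proof (rule nn_integral_cong_AE)
    show "AE s in law. ennreal ((g s)\<^sup>2) = liminf (\<lambda>n. ennreal ((f n s)\<^sup>2))"
      using lim
    proof eventually_elim
      case (elim s)
      then have "(\<lambda>n. ennreal ((f n s)\<^sup>2)) \<longlonglongrightarrow> ennreal ((g s)\<^sup>2)"
        by (intro tendsto_ennrealI tendsto_power)
      then show ?case by (intro lim_imp_Liminf[symmetric]) auto
    qed
  qed
  also have "\<dots> \<le> liminf (\<lambda>n. \<integral>\<^sup>+s. ennreal ((f n s)\<^sup>2) \<partial>law)"
    by (rule nn_integral_liminf) measurable
  also have "\<dots> \<le> limsup (\<lambda>n. \<integral>\<^sup>+s. ennreal ((f n s)\<^sup>2) \<partial>law)"
    by (intro Liminf_le_Limsup) simp
  also have "\<dots> \<le> ennreal C"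
  proof (intro Limsup_bounded always_eventually allI)
    fix n
    have "(\<integral>\<^sup>+s. ennreal ((f n s)\<^sup>2) \<partial>law) = ennreal (\<integral>s. (f n s)\<^sup>2 \<partial>law)"
      by (intro nn_integral_eq_integral sqint_integrable_sq f) simp
    then show "(\<integral>\<^sup>+s. ennreal ((f n s)\<^sup>2) \<partial>law) \<le> ennreal C"
      using f(2)[of n] by (simp add: ennreal_leI)
  qed
  finally have le: "(\<integral>\<^sup>+s. ennreal ((g s)\<^sup>2) \<partial>law) \<le> ennreal C" .
  have "integrable law (\<lambda>s. (g s)\<^sup>2)"
    using le by (intro integrableI_bounded) (auto simp: le_less_trans)
  then show "sqint g" by (simp add: sqint_def)
  show "(\<integral>s. (g s)\<^sup>2 \<partial>law) \<le> C"
    using le C by (subst integral_eq_nn_integral) (auto intro: enn2real_leI)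
qed

section \<open>Exponential sums above the Malthusian parameter\<close>

abbreviation gen :: "real \<Rightarrow> nat \<Rightarrow> (nat list \<Rightarrow> real) \<Rightarrow> real" where
  "gen r n \<equiv> lvlsum r (\<lambda>_. 1) n"

lemma measurable_gen [measurable]: "gen r n \<in> borel_measurable law"
  by (rule measurable_lvlsum) simp

lemma gen_nonneg: "0 \<le> gen r n s"
  by (rule lvlsum_nonneg) simp

lemma nn_integral_gen: "0 \<le> r \<Longrightarrow> (\<integral>\<^sup>+s. ennreal (gen r n s) \<partial>law) = ennreal (phi r ^ n)"
  by (subst nn_integral_lvlsum) (simp_all add: emeasure_space_1)

lemma integrable_gen: "0 \<le> r \<Longrightarrow> integrable law (gen r n)"
  by (rule integrableI_nonneg) (auto simp: gen_nonneg nn_integral_gen)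

lemma integral_gen: "0 \<le> r \<Longrightarrow> (\<integral>s. gen r n s \<partial>law) = phi r ^ n"
  by (subst integral_eq_nn_integral) (auto simp: gen_nonneg nn_integral_gen phi_nonneg)

definition total :: "real \<Rightarrow> (nat list \<Rightarrow> real) \<Rightarrow> real" where
  "total r s = (\<Sum>n. gen r n s)"

definition ntotal :: "real \<Rightarrow> (nat list \<Rightarrow> real) \<Rightarrow> real" where
  "ntotal r s = (1 - phi r) * total r s"

text \<open>Truncation to the first \<open>n\<close> generations. It allows induction on
  \<open>n\<close> for the second moment; the recursion of \<open>ntotal\<close> alone would bound
  that moment only after it is known to be finite.\<close>

definition ptotal :: "real \<Rightarrow> nat \<Rightarrow> (nat list \<Rightarrow> real) \<Rightarrow> real" where
  "ptotal r n s = (1 - phi r) * (\<Sum>k<n. gen r k s)"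

lemma measurable_ntotal [measurable]: "ntotal r \<in> borel_measurable law"
  unfolding ntotal_def total_def by measurable

context
  fixes r assumes r: "malthus < r"
begin

lemma r_nonneg: "0 \<le> r"
  using r malthus by simp

lemma phi_r: "0 \<le> phi r" "phi r < 1"
  using phi_nonneg[OF r_nonneg] phi_less_1[OF r] by auto

lemma AE_summable_gen: "AE s in law. summable (\<lambda>n. gen r n s)"
  by (rule AE_summable_of_nn_integral[where b="\<lambda>n. phi r ^ n"])
    (auto simp: gen_nonneg nn_integral_gen r_nonneg phi_r)

lemma ntotal_integrable: "integrable law (ntotal r)"
  and integral_ntotal: "(\<integral>s. ntotal r s \<partial>law) = 1"
proof -
  have *: "AE s in law. summable (\<lambda>n. norm (gen r n s))"
    using AE_summable_gen by (simp add: gen_nonneg)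
  have **: "summable (\<lambda>n. \<integral>s. norm (gen r n s) \<partial>law)"
    using phi_r by (simp add: gen_nonneg integral_gen r_nonneg)
  have "integrable law (total r)"
    unfolding total_def[abs_def] by (rule integrable_suminf[OF integrable_gen[OF r_nonneg] * **])
  then show "integrable law (ntotal r)" by (simp add: ntotal_def[abs_def])
  have "(\<integral>s. total r s \<partial>law) = (\<Sum>n. \<integral>s. gen r n s \<partial>law)"
    unfolding total_def[abs_def] by (rule integral_suminf[OF integrable_gen[OF r_nonneg] * **])
  also have "\<dots> = 1 / (1 - phi r)"
    using phi_r by (simp add: integral_gen r_nonneg suminf_geometric)
  finally show "(\<integral>s. ntotal r s \<partial>law) = 1"
    using phi_r by (simp add: ntotal_def)
qed

lemma AE_ptotal_lim: "AE s in law. (\<lambda>n. ptotal r n s) \<longlonglongrightarrow> ntotal r s"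
  using AE_summable_gen unfolding ptotal_def ntotal_def total_def
  by eventually_elim (intro tendsto_mult tendsto_const summable_LIMSEQ)

lemma AE_ntotal_nonneg: "AE s in law. 0 \<le> ntotal r s"
  using AE_summable_gen unfolding ntotal_def total_def
  by eventually_elim (use phi_r in \<open>auto intro!: mult_nonneg_nonneg suminf_nonneg gen_nonneg\<close>)

text \<open>Generation 0 contributes \<open>1 - phi r\<close>; a word of a later generation lies in
  the subtree of some child and is one letter shorter there.\<close>

lemma ptotal_Suc:
  assumes "s \<in> space law"
  shows "ptotal r (Suc n) s = (1 - phi r) + sumop r (ptotal r n) s"
proof -
  have "sumop r (ptotal r n) s = (1 - phi r) * (\<Sum>k<n. sumop r (gen r k) s)"
    unfolding sumop_def ptotal_def sum_distrib_left
    by (subst sum.swap) (simp add: mult_ac)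
  also have "\<dots> = (1 - phi r) * (\<Sum>k<n. gen r (Suc k) s)" by (simp add: lvlsum_Suc)
  finally have 1: "sumop r (ptotal r n) s = (1 - phi r) * (\<Sum>k<n. gen r (Suc k) s)" .
  have "(\<Sum>k<Suc n. gen r k s) = 1 + (\<Sum>k<n. gen r (Suc k) s)"
    using assms by (subst sum.lessThan_Suc_shift) (simp add: lvlsum_0)
  then show ?thesis unfolding 1 ptotal_def by (simp only: distrib_left mult_1_right)
qed

text \<open>The truncations converge almost surely at the root and, by invariance under
  \<open>shift\<close>, at each child, so their recursion passes to the limit.\<close>

lemma AE_ntotal_rec: "AE s in law. ntotal r s = (1 - phi r) + sumop r (ntotal r) s"
proof -
  have "AE s in law. \<forall>i\<in>{1..K}. (\<lambda>n. ptotal r n (shift [i] s)) \<longlonglongrightarrow> ntotal r (shift [i] s)"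
    by (intro AE_finite_allI AE_shift[where Q="\<lambda>s. (\<lambda>n. ptotal r n s) \<longlonglongrightarrow> ntotal r s"] AE_ptotal_lim) auto
  with AE_ptotal_lim AE_space show ?thesis
  proof eventually_elim
    case (elim s)
    have "(\<lambda>n. (1 - phi r) + sumop r (ptotal r n) s) \<longlonglongrightarrow> (1 - phi r) + sumop r (ntotal r) s"
      unfolding sumop_def using elim by (intro tendsto_intros) auto
    then have "(\<lambda>n. ptotal r (Suc n) s) \<longlonglongrightarrow> (1 - phi r) + sumop r (ntotal r) s"
      using elim by (simp add: ptotal_Suc)
    moreover have "(\<lambda>n. ptotal r (Suc n) s) \<longlonglongrightarrow> ntotal r s"
      using elim by (intro LIMSEQ_Suc)
    ultimately show ?case by (rule LIMSEQ_unique[symmetric])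
  qed
qed

end

section \<open>Second moment bounds uniform in the exponent\<close>

definition contr :: real where
  "contr = phi (2 * malthus)"

text \<open>The slack in Young's inequality \<open>(a + b)\<^sup>2 \<le> (1 + slack) * a\<^sup>2 + (1 + 1 / slack) * b\<^sup>2\<close> is
  chosen such that \<open>(1 + slack) * contr < 1\<close>, so that second moments stay contracted.\<close>

definition slack :: real where
  "slack = (1 - contr) / 2"

text \<open>What remains of the coefficient of a second moment after the contracted term on the
  right has been moved to the left.\<close>

definition gap :: real where
  "gap = 1 - (1 + slack) * contr"

text \<open>The fixed point of
  \<open>C = (1 + slack) * (contr * C + K ^ 2) + (1 + 1 / slack)\<close>, the recursive bound for
  second moments of \<open>ptotal\<close>; hence it reproduces itself in the induction step of
  \<open>ptotal_sq\<close>.\<close>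

definition sqbound :: real where
  "sqbound = ((1 + slack) * (real K)\<^sup>2 + (1 + 1 / slack)) / gap"

lemma contr: "0 \<le> contr" "contr < 1"
  using phi_nonneg[of "2 * malthus"] phi_less_1[of "2 * malthus"] malthus by (auto simp: contr_def)

lemma slack: "0 < slack"
  using contr by (simp add: slack_def)

lemma gap: "0 < gap"
proof -
  \<comment> \<open>\<open>gap\<close> is half of this product.\<close>
  have "0 < (1 - contr) * (2 - contr)" using contr by (intro mult_pos_pos) auto
  then show ?thesis by (simp add: gap_def slack_def field_simps)
qed

lemma sqbound: "0 \<le> sqbound"
  unfolding sqbound_def using gap slack by (auto intro!: divide_nonneg_pos add_nonneg_nonneg)

lemma phi_double_le: "malthus \<le> r \<Longrightarrow> phi (2 * r) \<le> contr"
  unfolding contr_def using malthus by (intro phi_antimono) auto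

lemma sqint_cong_AE:
  assumes "sqint f" "AE s in law. f s = g s" "g \<in> borel_measurable law"
  shows "sqint g"
proof -
  have [measurable]: "f \<in> borel_measurable law" "g \<in> borel_measurable law"
    using assms by (auto simp: sqint_def)
  have "integrable law (\<lambda>s. (f s)\<^sup>2) \<longleftrightarrow> integrable law (\<lambda>s. (g s)\<^sup>2)"
    using assms(2) by (intro integrable_cong_AE) auto
  then show ?thesis using assms by (simp add: sqint_def)
qed

text \<open>The bound depends neither on \<open>n\<close> nor on \<open>r\<close>: above
  \<open>malthus\<close> one has \<open>phi (2 * r) \<le> contr\<close>, and the mean
  \<open>1 - phi r ^ n\<close> lies between 0 and 1.\<close>

lemma ptotal_sq:
  assumes r: "malthus < r"
  shows "sqint (ptotal r n) \<and> (\<integral>s. (ptotal r n s)\<^sup>2 \<partial>law) \<le> sqbound"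
proof (induction n)
  case 0
  show ?case by (simp add: ptotal_def[abs_def] sqint_const sqbound)
next
  case (Suc n)
  note r_nonneg = r_nonneg[OF r] and phi_r = phi_r[OF r]
  have sq: "sqint (ptotal r n)" using Suc by simp
  note op = integral_sumop_sq[OF sq r_nonneg]
  have eq: "ptotal r (Suc n) s = sumop r (ptotal r n) s + (1 - phi r)" if "s \<in> space law" for s
    using ptotal_Suc[OF r that] by simp
  have meas: "ptotal r m \<in> borel_measurable law" for m
    unfolding ptotal_def by measurable
  have sq': "sqint (\<lambda>s. sumop r (ptotal r n) s + (1 - phi r))"
    by (intro sqint_add op sqint_const)
  have sq_Suc: "sqint (ptotal r (Suc n))"
    by (rule sqint_cong_AE[OF sq']) (auto simp: eq meas)
  have mean: "(\<integral>s. ptotal r n s \<partial>law) = 1 - phi r ^ n"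
  proof -
    have "(\<integral>s. ptotal r n s \<partial>law) = (1 - phi r) * (\<Sum>k<n. phi r ^ k)"
      unfolding ptotal_def
      by (simp add: Bochner_Integration.integral_sum integrable_gen integral_gen r_nonneg)
    then show ?thesis using one_diff_power_eq[of "phi r" n] by simp
  qed
  have "0 \<le> phi r ^ n" "phi r ^ n \<le> 1" using phi_r by (auto intro: power_le_one)
  then have mean2: "(\<integral>s. ptotal r n s \<partial>law)\<^sup>2 \<le> 1" unfolding mean by (intro power_le_one) auto
  have "(\<integral>s. (ptotal r (Suc n) s)\<^sup>2 \<partial>law) = (\<integral>s. (sumop r (ptotal r n) s + (1 - phi r))\<^sup>2 \<partial>law)"
    by (intro Bochner_Integration.integral_cong) (simp_all add: eq)
  also have "\<dots> \<le> (1 + slack) * (\<integral>s. (sumop r (ptotal r n) s)\<^sup>2 \<partial>law) + (1 + 1 / slack) * (\<integral>s. (1 - phi r)\<^sup>2 \<partial>law)"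
    by (rule integral_square_add_le[OF op(1) sqint_const slack])
  also have "\<dots> \<le> (1 + slack) * (contr * sqbound + (real K)\<^sup>2) + (1 + 1 / slack)"
  proof (intro add_mono)
    have "(\<integral>s. (sumop r (ptotal r n) s)\<^sup>2 \<partial>law)
        \<le> phi (2 * r) * (\<integral>s. (ptotal r n s)\<^sup>2 \<partial>law) + (real K)\<^sup>2 * (\<integral>s. ptotal r n s \<partial>law)\<^sup>2"
      by (rule op)
    also have "\<dots> \<le> contr * sqbound + (real K)\<^sup>2 * 1"
      using Suc mean2 phi_double_le[of r] r contr
      by (intro add_mono mult_mono) auto
    finally show "(1 + slack) * (\<integral>s. (sumop r (ptotal r n) s)\<^sup>2 \<partial>law) \<le> (1 + slack) * (contr * sqbound + (real K)\<^sup>2)"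
      using slack by simp
    have "(1 - phi r)\<^sup>2 \<le> 1" using phi_r by (intro power_le_one) auto
    then have "(1 + 1 / slack) * (1 - phi r)\<^sup>2 \<le> (1 + 1 / slack) * 1"
      using slack by (intro mult_left_mono) auto
    then show "(1 + 1 / slack) * (\<integral>s. (1 - phi r)\<^sup>2 \<partial>law) \<le> 1 + 1 / slack"
      by (simp add: prob_space)
  qed
  also have "\<dots> = sqbound"
  proof -
    have "gap * sqbound = (1 + slack) * (real K)\<^sup>2 + (1 + 1 / slack)"
      using gap by (simp add: sqbound_def)
    moreover have "gap * sqbound = sqbound - (1 + slack) * contr * sqbound"
      by (simp add: gap_def left_diff_distrib)
    moreover have "(1 + slack) * (contr * sqbound + (real K)\<^sup>2) = (1 + slack) * contr * sqbound + (1 + slack) * (real K)\<^sup>2"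
      by (simp add: distrib_left)
    ultimately show ?thesis by linarith
  qed
  finally show ?case using sq_Suc by simp
qed

lemma ntotal_sq:
  assumes r: "malthus < r"
  shows "sqint (ntotal r)" "(\<integral>s. (ntotal r s)\<^sup>2 \<partial>law) \<le> sqbound"
  using sqint_limit[of "ptotal r" sqbound "ntotal r"] ptotal_sq[OF r] AE_ptotal_lim[OF r]
  by auto

text \<open>The factor \<open>1 + 1 / slack\<close> is from Young's inequality,
  \<open>2 + 2 * K * sqbound\<close> bounds the second moment of the perturbation \<open>E\<close>
  in the next proof relative to the difference of \<open>phi\<close>, and \<open>gap\<close> is from
  the contraction.\<close>

definition cauchy_const :: real where
  "cauchy_const = (1 + 1 / slack) * (2 + 2 * K * sqbound) / gap"

text \<open>The difference \<open>D\<close> solves \<open>D = sumop r' D + E\<close>, where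
  \<open>E\<close> collects the change of exponent in the operator and in the constant. Both
  normalised sums have mean 1, so \<open>D\<close> has mean 0 and the off-diagonal part of its
  second moment disappears. What is left is contracted, and \<open>E\<close> is small with
  \<open>phi r - phi r'\<close>.\<close>

lemma ntotal_diff_sq:
  assumes r: "malthus < r" "r \<le> r'"
  shows "(\<integral>s. (ntotal r s - ntotal r' s)\<^sup>2 \<partial>law) \<le> cauchy_const * (phi r - phi r')"
proof -
  have r': "malthus < r'" using r by simp
  note nn = r_nonneg[OF r(1)] r_nonneg[OF r']
  note A = ntotal_sq(1)[OF r(1)] and A' = ntotal_sq(1)[OF r']
  define D where "D s = ntotal r s - ntotal r' s" for s
  define E where "E s = (sumop r (ntotal r) s - sumop r' (ntotal r) s) + (phi r' - phi r)" for s
  define \<delta> where "\<delta> = phi r - phi r'"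
  have \<delta>: "0 \<le> \<delta>" "\<delta> \<le> 1"
    using phi_antimono[OF nn(1) r(2)] phi_r[OF r(1)] phi_r[OF r'] by (auto simp: \<delta>_def)
  have D: "sqint D" unfolding D_def by (intro sqint_diff A A')
  have dsq: "sqint (\<lambda>s. sumop r (ntotal r) s - sumop r' (ntotal r) s)"
    by (rule integral_sumop_diff_sq[OF A nn(1) r(2)])
  have E: "sqint E" unfolding E_def by (intro sqint_add dsq sqint_const)
  have D0: "(\<integral>s. D s \<partial>law) = 0"
    unfolding D_def using ntotal_integrable[OF r(1)] ntotal_integrable[OF r']
    by (simp add: integral_ntotal[OF r(1)] integral_ntotal[OF r'])
  note op = integral_sumop_sq[OF D nn(2)]
  have AEeq: "AE s in law. D s = sumop r' D s + E s"
    using AE_ntotal_rec[OF r(1)] AE_ntotal_rec[OF r']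
  proof eventually_elim
    case (elim s)
    have "sumop r' D s = sumop r' (ntotal r) s - sumop r' (ntotal r') s"
      by (simp add: sumop_def D_def sum_subtractf right_diff_distrib)
    then show ?case using elim by (simp add: D_def E_def)
  qed
  have [measurable]: "D \<in> borel_measurable law" "E \<in> borel_measurable law" "sumop r' D \<in> borel_measurable law"
    using D E op(1) by (auto simp: sqint_def)
  have "(\<integral>s. (D s)\<^sup>2 \<partial>law) = (\<integral>s. (sumop r' D s + E s)\<^sup>2 \<partial>law)"
    by (intro integral_cong_AE) (use AEeq in \<open>auto elim: eventually_mono\<close>)
  also have "\<dots> \<le> (1 + slack) * (\<integral>s. (sumop r' D s)\<^sup>2 \<partial>law) + (1 + 1 / slack) * (\<integral>s. (E s)\<^sup>2 \<partial>law)"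
    by (rule integral_square_add_le[OF op(1) E slack])
  also have "\<dots> \<le> (1 + slack) * (contr * (\<integral>s. (D s)\<^sup>2 \<partial>law)) + (1 + 1 / slack) * ((2 + 2 * K * sqbound) * \<delta>)"
  proof (intro add_mono mult_left_mono)
    have "(\<integral>s. (sumop r' D s)\<^sup>2 \<partial>law) \<le> phi (2 * r') * (\<integral>s. (D s)\<^sup>2 \<partial>law)"
      using op(2) D0 by simp
    also have "\<dots> \<le> contr * (\<integral>s. (D s)\<^sup>2 \<partial>law)"
      using phi_double_le[of r'] r' by (intro mult_right_mono) auto
    finally show "(\<integral>s. (sumop r' D s)\<^sup>2 \<partial>law) \<le> contr * (\<integral>s. (D s)\<^sup>2 \<partial>law)" .
    have "(\<integral>s. (E s)\<^sup>2 \<partial>law) \<le> (1 + 1) * (\<integral>s. (sumop r (ntotal r) s - sumop r' (ntotal r) s)\<^sup>2 \<partial>law)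
        + (1 + 1 / 1) * (\<integral>s. (phi r' - phi r)\<^sup>2 \<partial>law)"
      unfolding E_def by (rule integral_square_add_le[OF dsq sqint_const]) simp
    also have "\<dots> \<le> (1 + 1) * (K * \<delta> * sqbound) + (1 + 1 / 1) * \<delta>"
    proof (intro add_mono mult_left_mono)
      have "(\<integral>s. (sumop r (ntotal r) s - sumop r' (ntotal r) s)\<^sup>2 \<partial>law) \<le> K * \<delta> * (\<integral>s. (ntotal r s)\<^sup>2 \<partial>law)"
        unfolding \<delta>_def by (rule integral_sumop_diff_sq[OF A nn(1) r(2)])
      also have "\<dots> \<le> K * \<delta> * sqbound"
        using ntotal_sq(2)[OF r(1)] \<delta> by (intro mult_left_mono) auto
      finally show "(\<integral>s. (sumop r (ntotal r) s - sumop r' (ntotal r) s)\<^sup>2 \<partial>law) \<le> K * \<delta> * sqbound" .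
      have "(phi r' - phi r)\<^sup>2 = \<delta> * \<delta>" by (simp add: \<delta>_def power2_eq_square algebra_simps)
      also have "\<dots> \<le> \<delta>" using \<delta> by (simp add: mult_left_le)
      finally show "(\<integral>s. (phi r' - phi r)\<^sup>2 \<partial>law) \<le> \<delta>" by (simp add: prob_space)
    qed auto
    also have "\<dots> = (2 + 2 * K * sqbound) * \<delta>" by (simp add: algebra_simps)
    finally show "(\<integral>s. (E s)\<^sup>2 \<partial>law) \<le> (2 + 2 * K * sqbound) * \<delta>" .
  qed (use slack in auto)
  finally have "gap * (\<integral>s. (D s)\<^sup>2 \<partial>law) \<le> (1 + 1 / slack) * ((2 + 2 * K * sqbound) * \<delta>)"
    unfolding gap_def by (simp add: algebra_simps)
  then have "(\<integral>s. (D s)\<^sup>2 \<partial>law) \<le> (1 + 1 / slack) * ((2 + 2 * K * sqbound) * \<delta>) / gap"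
    using gap by (simp add: pos_le_divide_eq mult.commute)
  also have "\<dots> = cauchy_const * (phi r - phi r')"
    by (simp add: cauchy_const_def \<delta>_def)
  finally show ?thesis by (simp add: D_def)
qed

end

section \<open>The limit variable and the typical decay of the masses\<close>

context tree_law
begin

text \<open>The exponents are chosen so that \<open>1 - phi (rs k)\<close> is
  \<open>4 ^ (- (k + 1))\<close>. Second moments of consecutive differences are then of order
  \<open>4 ^ (- k)\<close>, so their first moments are summable.\<close>

definition rs :: "nat \<Rightarrow> real" where
  "rs k = (SOME r. 0 \<le> r \<and> phi r = 1 - (1/4) ^ Suc k)"

lemma rs: "0 \<le> rs k" "phi (rs k) = 1 - (1/4) ^ Suc k"
proof -
  have "(1/4::real) ^ Suc k \<le> 1/4"
    using power_decreasing[of 1 "Suc k" "1/4::real"] by (simp del: power_Suc)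
  moreover have "0 < (1/4::real) ^ Suc k" by simp
  moreover have "2 \<le> real K" using K by simp
  ultimately have "0 < 1 - (1/4::real) ^ Suc k" "1 - (1/4::real) ^ Suc k \<le> real K"
    by linarith+
  then have "\<exists>r\<ge>0. phi r = 1 - (1/4) ^ Suc k" by (rule ex_phi_eq)
  then have "0 \<le> rs k \<and> phi (rs k) = 1 - (1/4) ^ Suc k"
    unfolding rs_def by (intro someI_ex[where P="\<lambda>r. 0 \<le> r \<and> phi r = 1 - (1/4) ^ Suc k"]) auto
  then show "0 \<le> rs k" "phi (rs k) = 1 - (1/4) ^ Suc k" by auto
qed

lemma rs_gt: "malthus < rs k"
proof (rule ccontr)
  assume "\<not> malthus < rs k"
  then have "phi malthus \<le> phi (rs k)" using rs by (intro phi_antimono) auto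
  then have "1 \<le> 1 - (1/4::real) ^ Suc k" by (simp only: malthus rs)
  moreover have "0 < (1/4::real) ^ Suc k" by simp
  ultimately show False by linarith
qed

lemma rs_Suc_le: "rs (Suc k) \<le> rs k"
proof (rule ccontr)
  assume "\<not> rs (Suc k) \<le> rs k"
  then have "phi (rs (Suc k)) < phi (rs k)" using rs by (intro phi_strict_antimono) auto
  moreover have "(1/4::real) ^ Suc (Suc k) \<le> (1/4) ^ Suc k" by (intro power_decreasing) auto
  ultimately show False unfolding rs by linarith
qed

lemma rs_lim: "rs \<longlonglongrightarrow> malthus"
proof (rule LIMSEQ_I)
  fix e :: real assume e: "0 < e"
  have "(\<lambda>k. 1 - (1/4::real) ^ Suc k) \<longlonglongrightarrow> 1 - 0"
    by (intro tendsto_diff tendsto_const LIMSEQ_Suc[OF LIMSEQ_power_zero]) auto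
  moreover have "phi (malthus + e) < 1 - 0" using phi_less_1[of "malthus + e"] e by simp
  ultimately have "\<forall>\<^sub>F k in sequentially. phi (malthus + e) < 1 - (1/4) ^ Suc k"
    by (rule order_tendstoD)
  then have "\<forall>\<^sub>F k in sequentially. norm (rs k - malthus) < e"
  proof eventually_elim
    case (elim k)
    have "rs k < malthus + e"
    proof (rule ccontr)
      assume "\<not> rs k < malthus + e"
      then have "phi (rs k) \<le> phi (malthus + e)" using malthus e by (intro phi_antimono) auto
      then show False using elim by (simp only: rs)
    qed
    then show ?case using rs_gt[of k] by simp
  qed
  then show "\<exists>n. \<forall>k\<ge>n. norm (rs k - malthus) < e" by (simp add: eventually_sequentially)
qed

text \<open>The \<open>max 0\<close> makes the variable nonnegative everywhere, also where the limit
  does not exist; almost surely it changes nothing.\<close>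

definition wlim :: "(nat list \<Rightarrow> real) \<Rightarrow> real" where
  "wlim s = max 0 (lim (\<lambda>k. ntotal (rs k) s))"

lemma wlim_nonneg: "0 \<le> wlim s"
  by (simp add: wlim_def)

lemma measurable_wlim [measurable]: "wlim \<in> borel_measurable law"
  unfolding wlim_def by measurable

section \<open>Convergence of the normalised sums along \<open>rs\<close>\<close>

definition incr :: "nat \<Rightarrow> (nat list \<Rightarrow> real) \<Rightarrow> real" where
  "incr k s = ntotal (rs (Suc k)) s - ntotal (rs k) s"

lemma cauchy_const: "0 \<le> cauchy_const"
  unfolding cauchy_const_def using slack gap sqbound
  by (intro divide_nonneg_pos mult_nonneg_nonneg add_nonneg_nonneg) auto

lemma incr_integrable: "integrable law (incr k)"
  unfolding incr_def[abs_def] by (intro Bochner_Integration.integrable_diff ntotal_integrable rs_gt)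

lemma integral_abs_incr: "(\<integral>s. \<bar>incr k s\<bar> \<partial>law) \<le> (1 + cauchy_const) * (1/2) ^ k"
proof -
  \<comment> \<open>The inequality \<open>\<bar>d\<bar> \<le> a + d\<^sup>2 / a\<close> trades
    second for first moments. This \<open>a\<close> is the square root of the order
    \<open>4 ^ (- k)\<close> of the second moment, which balances the two terms.\<close>
  define a :: real where "a = (1/2) ^ k"
  have a: "0 < a" by (simp add: a_def)
  have le: "\<bar>d\<bar> \<le> a + d\<^sup>2 / a" for d :: real
  proof -
    have "0 \<le> (a - \<bar>d\<bar>)\<^sup>2" by simp
    also have "\<dots> = a * a + d\<^sup>2 - 2 * (a * \<bar>d\<bar>)" by (simp add: power2_diff power2_eq_square[of a])
    finally have "2 * (a * \<bar>d\<bar>) \<le> a * a + d\<^sup>2" by simp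
    moreover have "0 \<le> a * \<bar>d\<bar>" using a by simp
    ultimately have "a * \<bar>d\<bar> \<le> a * a + d\<^sup>2" by linarith
    also have "\<dots> = a * (a + d\<^sup>2 / a)" using a by (simp add: distrib_left)
    finally show ?thesis using a by simp
  qed
  have sq: "sqint (incr k)"
    unfolding incr_def[abs_def] by (intro sqint_diff ntotal_sq rs_gt)
  have "(\<integral>s. (incr k s)\<^sup>2 \<partial>law) \<le> cauchy_const * (phi (rs (Suc k)) - phi (rs k))"
    unfolding incr_def by (rule ntotal_diff_sq[OF rs_gt rs_Suc_le])
  also have "phi (rs (Suc k)) - phi (rs k) \<le> a * a"
    by (simp add: rs a_def flip: power_mult_distrib)
  finally have V: "(\<integral>s. (incr k s)\<^sup>2 \<partial>law) \<le> cauchy_const * (a * a)"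
    using cauchy_const by (simp add: mult_left_mono)
  have "(\<integral>s. \<bar>incr k s\<bar> \<partial>law) \<le> (\<integral>s. a + (incr k s)\<^sup>2 / a \<partial>law)"
    using incr_integrable sqint_integrable_sq[OF sq] by (intro integral_mono le) auto
  also have "\<dots> = a + (\<integral>s. (incr k s)\<^sup>2 \<partial>law) / a"
    using sqint_integrable_sq[OF sq] by (simp add: prob_space)
  also have "\<dots> \<le> a + cauchy_const * (a * a) / a"
    using V a by (intro add_left_mono divide_right_mono) auto
  also have "\<dots> = (1 + cauchy_const) * a" using a by (simp add: algebra_simps)
  finally show ?thesis by (simp add: a_def)
qed

lemma AE_summable_incr: "AE s in law. summable (\<lambda>k. \<bar>incr k s\<bar>)"
proof (rule AE_summable_of_nn_integral[where b="\<lambda>k. (1 + cauchy_const) * (1/2) ^ k"])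
  show "(\<lambda>s. \<bar>incr k s\<bar>) \<in> borel_measurable law" for k
    using incr_integrable[of k] by measurable
  show "(\<integral>\<^sup>+s. ennreal \<bar>incr k s\<bar> \<partial>law) \<le> ennreal ((1 + cauchy_const) * (1/2) ^ k)" for k
    using incr_integrable[of k] integral_abs_incr[of k]
    by (subst nn_integral_eq_integral) (auto intro: ennreal_leI)
qed (use cauchy_const in \<open>auto intro!: summable_mult summable_geometric\<close>)

text \<open>The series form is recorded next to the limit because the mean of \<open>wlim\<close> is
  computed termwise.\<close>

lemma AE_wlim_aux:
  "AE s in law. (\<lambda>k. ntotal (rs k) s) \<longlonglongrightarrow> wlim s \<and> wlim s = ntotal (rs 0) s + (\<Sum>k. incr k s)"
proof -
  have "AE s in law. \<forall>k. 0 \<le> ntotal (rs k) s"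
    by (subst AE_all_countable) (intro allI AE_ntotal_nonneg rs_gt)
  with AE_summable_incr show ?thesis
  proof eventually_elim
    case (elim s)
    have tele: "ntotal (rs 0) s + (\<Sum>k<n. incr k s) = ntotal (rs n) s" for n
      unfolding incr_def by (subst sum_lessThan_telescope) simp
    have "summable (\<lambda>k. incr k s)" using elim(1) by (rule summable_rabs_cancel)
    then have "(\<lambda>n. ntotal (rs 0) s + (\<Sum>k<n. incr k s)) \<longlonglongrightarrow> ntotal (rs 0) s + (\<Sum>k. incr k s)"
      by (intro tendsto_intros summable_LIMSEQ)
    then have lim: "(\<lambda>n. ntotal (rs n) s) \<longlonglongrightarrow> ntotal (rs 0) s + (\<Sum>k. incr k s)"
      by (simp only: tele)
    then have "0 \<le> ntotal (rs 0) s + (\<Sum>k. incr k s)"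
      using elim(2) by (intro LIMSEQ_le_const) auto
    then have "wlim s = ntotal (rs 0) s + (\<Sum>k. incr k s)"
      using limI[OF lim] by (simp add: wlim_def)
    with lim show ?case by simp
  qed
qed

lemma AE_wlim: "AE s in law. (\<lambda>k. ntotal (rs k) s) \<longlonglongrightarrow> wlim s"
  using AE_wlim_aux by eventually_elim (erule conjunct1)

lemma sqint_wlim: "sqint wlim"
  using sqint_limit(1)[of "\<lambda>k. ntotal (rs k)" sqbound wlim] ntotal_sq rs_gt AE_wlim by auto

text \<open>The increments are summable in mean and each has mean 0, so the mean 1 of
  \<open>ntotal (rs 0)\<close> survives in the limit. This excludes a limit that vanishes almost
  surely.\<close>

lemma integral_wlim: "(\<integral>s. wlim s \<partial>law) = 1"
proof -
  have s: "AE s in law. summable (\<lambda>k. norm (incr k s))" using AE_summable_incr by simp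
  have i: "summable (\<lambda>k. \<integral>s. norm (incr k s) \<partial>law)"
    by (rule summable_comparison_test'[where g="\<lambda>k. (1 + cauchy_const) * (1/2) ^ k" and N=0])
      (use integral_abs_incr in \<open>auto intro!: summable_mult summable_geometric\<close>)
  have int: "integrable law (\<lambda>s. \<Sum>k. incr k s)"
    by (rule integrable_suminf[OF incr_integrable s i])
  have "(\<integral>s. (\<Sum>k. incr k s) \<partial>law) = (\<Sum>k. \<integral>s. incr k s \<partial>law)"
    by (rule integral_suminf[OF incr_integrable s i])
  also have "\<dots> = 0"
    unfolding incr_def using ntotal_integrable[OF rs_gt] by (simp add: integral_ntotal rs_gt)
  finally have 0: "(\<integral>s. (\<Sum>k. incr k s) \<partial>law) = 0" .
  have "(\<integral>s. wlim s \<partial>law) = (\<integral>s. ntotal (rs 0) s + (\<Sum>k. incr k s) \<partial>law)"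
  proof (rule integral_cong_AE)
    show "AE s in law. wlim s = ntotal (rs 0) s + (\<Sum>k. incr k s)"
      using AE_wlim_aux by eventually_elim (erule conjunct2)
  qed (use int in auto)
  also have "\<dots> = 1"
    using int ntotal_integrable[OF rs_gt, of 0] 0 by (simp add: integral_ntotal rs_gt)
  finally show ?thesis .
qed

text \<open>There are countably many words and each \<open>shift x\<close> preserves
  \<open>law\<close>, so an almost sure property holds in all subtrees at once.\<close>

lemma AE_shift_all: "AE s in law. Q s \<Longrightarrow> AE s in law. \<forall>x\<in>words K. Q (shift x s)"
  by (subst AE_ball_countable, simp, intro ballI AE_shift)

text \<open>Limit of the recursion for \<open>ntotal\<close>: the inhomogeneous term
  \<open>1 - phi (rs k)\<close> vanishes as \<open>rs k\<close> tends to
  \<open>malthus\<close>.\<close>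

lemma AE_wlim_rec: "AE s in law. wlim s = sumop malthus wlim s"
proof -
  have rec: "AE s in law. \<forall>k. ntotal (rs k) s = (1 - phi (rs k)) + sumop (rs k) (ntotal (rs k)) s"
    by (subst AE_all_countable) (intro allI AE_ntotal_rec rs_gt)
  from rec AE_wlim AE_shift_all[OF AE_wlim] show ?thesis
  proof eventually_elim
    case (elim s)
    have "(\<lambda>k. (1/4::real) ^ Suc k + sumop (rs k) (ntotal (rs k)) s) \<longlonglongrightarrow> 0 + sumop malthus wlim s"
      unfolding sumop_def using elim(3)
      by (intro tendsto_intros rs_lim LIMSEQ_Suc[OF LIMSEQ_power_zero]) auto
    moreover have "(\<lambda>k. (1/4::real) ^ Suc k + sumop (rs k) (ntotal (rs k)) s) = (\<lambda>k. ntotal (rs k) s)"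
    proof
      fix k
      have "ntotal (rs k) s = (1 - phi (rs k)) + sumop (rs k) (ntotal (rs k)) s" using elim(1) by blast
      then show "(1/4::real) ^ Suc k + sumop (rs k) (ntotal (rs k)) s = ntotal (rs k) s"
        by (simp only: rs)
    qed
    ultimately show ?case using LIMSEQ_unique[OF elim(2)] by simp
  qed
qed

text \<open>Extinction would have to occur in two independent subtrees, so its probability \<open>q\<close>
  satisfies \<open>q \<le> q\<^sup>2\<close>.\<close>

lemma AE_wlim_pos: "AE s in law. 0 < wlim s"
proof -
  define g :: "(nat list \<Rightarrow> real) \<Rightarrow> real" where "g s = (if wlim s = 0 then 1 else 0)" for s
  have [measurable]: "g \<in> borel_measurable law" unfolding g_def by measurable
  have int: "integrable law g"
    by (rule integrable_const_bound[where B=1]) (auto simp: g_def)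
  have 12: "1 \<in> {1..K}" "2 \<in> {1..K}" "(1::nat) \<noteq> 2" using K by auto
  have one: "(\<lambda>_. 1 :: real) \<in> borel_measurable root_sets" "integrable law (\<lambda>s. 1 :: real)" by auto
  note ind = indep_root_two_subtrees[OF one int int 12]
  have le: "AE s in law. g s \<le> g (shift [1] s) * g (shift [2] s)"
    using AE_wlim_rec
  proof eventually_elim
    case (elim s)
    show ?case
    proof (cases "wlim s = 0")
      case True
      then have "(\<Sum>i=1..K. exp (- malthus * birth s [i]) * wlim (shift [i] s)) = 0"
        using elim by (simp add: sumop_def)
      then have "\<forall>i\<in>{1..K}. exp (- malthus * birth s [i]) * wlim (shift [i] s) = 0"
        by (subst (asm) sum_nonneg_eq_0_iff) (auto simp: wlim_nonneg)
      then have "wlim (shift [1] s) = 0" "wlim (shift [2] s) = 0" using 12 by auto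
      then show ?thesis by (simp add: g_def)
    qed (simp add: g_def)
  qed
  have "(\<integral>s. g s \<partial>law) \<le> (\<integral>s. g (shift [1] s) * g (shift [2] s) \<partial>law)"
    using ind(1) le int by (intro integral_mono_AE) auto
  also have "\<dots> = (\<integral>s. g s \<partial>law) * (\<integral>s. g s \<partial>law)"
    using ind(2) by (simp add: prob_space)
  finally have q: "(\<integral>s. g s \<partial>law) \<le> (\<integral>s. g s \<partial>law) * (\<integral>s. g s \<partial>law)" .
  have q0: "0 \<le> (\<integral>s. g s \<partial>law)" by (simp add: g_def)
  \<comment> \<open>If extinction were certain, \<open>wlim\<close> would have mean 0 instead of
    1.\<close>
  have q1: "(\<integral>s. g s \<partial>law) < 1"
  proof (rule ccontr)
    assume "\<not> (\<integral>s. g s \<partial>law) < 1"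
    moreover have "(\<integral>s. 1 - g s \<partial>law) = 1 - (\<integral>s. g s \<partial>law)" using int by (simp add: prob_space)
    moreover have "0 \<le> (\<integral>s. 1 - g s \<partial>law)" by (simp add: g_def)
    ultimately have "(\<integral>s. 1 - g s \<partial>law) = 0" by linarith
    moreover have "integrable law (\<lambda>s. 1 - g s)" "AE s in law. 0 \<le> 1 - g s"
      using int by (simp, simp add: g_def)
    ultimately have "AE s in law. 1 - g s = 0"
      using integral_nonneg_eq_0_iff_AE by blast
    then have "AE s in law. wlim s = 0" by eventually_elim (simp add: g_def split: if_splits)
    then have "(\<integral>s. wlim s \<partial>law) = (\<integral>s. 0 \<partial>law)" by (intro integral_cong_AE) auto
    then show False by (simp add: integral_wlim)
  qed
  have "(\<integral>s. g s \<partial>law) = 0"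
  proof (rule ccontr)
    assume "(\<integral>s. g s \<partial>law) \<noteq> 0"
    then have "(\<integral>s. g s \<partial>law) * (\<integral>s. g s \<partial>law) < (\<integral>s. g s \<partial>law) * 1"
      using q0 q1 by (intro mult_strict_left_mono) auto
    with q show False by simp
  qed
  then have "AE s in law. g s = 0"
    using int by (subst (asm) integral_nonneg_eq_0_iff_AE) (auto simp: g_def)
  then show ?thesis
  proof eventually_elim
    case (elim s)
    then show ?case using wlim_nonneg[of s] by (auto simp: g_def split: if_splits)
  qed
qed

section \<open>Masses of words and their exponential decay\<close>

definition mass :: "(nat list \<Rightarrow> real) \<Rightarrow> nat list \<Rightarrow> real" where
  "mass s x = exp (- malthus * birth s x) * wlim (shift x s) / wlim s"

lemma nn_integral_wlim: "(\<integral>\<^sup>+s. ennreal (wlim s) \<partial>law) = 1"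
  using integral_wlim wlim_nonneg by (subst nn_integral_eq_integral[OF sqint_integrable[OF sqint_wlim]]) auto

lemma nn_integral_wlim_sq: "(\<integral>\<^sup>+s. ennreal ((wlim s)\<^sup>2) \<partial>law) = ennreal (\<integral>s. (wlim s)\<^sup>2 \<partial>law)"
  by (intro nn_integral_eq_integral sqint_integrable_sq sqint_wlim) auto

text \<open>Squaring a mass doubles the exponent, so the sum of squares on level \<open>n\<close> is
  a generation sum at \<open>2 * malthus\<close>, whose mean carries the factor
  \<open>contr ^ n\<close>. This is where the finite second moment of \<open>wlim\<close>
  enters.\<close>

lemma AE_mass_small: "AE s in law. (\<lambda>n. \<Sum>x\<in>lvl K n. (mass s x)\<^sup>2) \<longlonglongrightarrow> 0"
proof -
  have "AE s in law. summable (\<lambda>n. lvlsum (2 * malthus) (\<lambda>s. (wlim s)\<^sup>2) n s)"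
  proof (rule AE_summable_of_nn_integral[where b="\<lambda>n. contr ^ n * (\<integral>s. (wlim s)\<^sup>2 \<partial>law)"])
    show "(\<integral>\<^sup>+s. ennreal (lvlsum (2 * malthus) (\<lambda>s. (wlim s)\<^sup>2) n s) \<partial>law)
        \<le> ennreal (contr ^ n * (\<integral>s. (wlim s)\<^sup>2 \<partial>law))" for n
      using malthus contr
      by (subst nn_integral_lvlsum) (auto simp: nn_integral_wlim_sq ennreal_mult simp flip: contr_def)
  qed (use contr in \<open>auto intro!: lvlsum_nonneg summable_mult2 summable_geometric\<close>)
  then show ?thesis
  proof eventually_elim
    case (elim s)
    have "(\<Sum>x\<in>lvl K n. (mass s x)\<^sup>2) = lvlsum (2 * malthus) (\<lambda>s. (wlim s)\<^sup>2) n s / (wlim s)\<^sup>2" for n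
      unfolding lvlsum_def sum_divide_distrib
      by (intro sum.cong refl) (simp add: mass_def power_mult_distrib power_divide flip: exp_double)
    \<comment> \<open>Where \<open>wlim s = 0\<close>, division by zero makes every term 0.\<close>
    moreover have "(\<lambda>n. lvlsum (2 * malthus) (\<lambda>s. (wlim s)\<^sup>2) n s / (wlim s)\<^sup>2) \<longlonglongrightarrow> 0 / (wlim s)\<^sup>2"
      by (cases "wlim s = 0") (use summable_LIMSEQ_zero[OF elim] in \<open>auto intro!: tendsto_divide_zero\<close>)
    ultimately show ?case by simp
  qed
qed

text \<open>Minus the derivative of \<open>phi\<close> at \<open>malthus\<close> is the mean birth
  time of a child under the weights \<open>exp (- malthus * birth)\<close>, which sum to 1 in mean.
  Thus \<open>rate\<close> is the mean growth per generation of \<open>malthus * birth\<close> along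
  a line of descent chosen by these weights.\<close>

definition rate :: real where
  "rate = - malthus * deriv phi malthus"

text \<open>Both expressions equal 1 at \<open>\<theta> = 0\<close> and have derivative
  \<open>- \<delta>\<close> there, because \<open>rate\<close> cancels the derivative of
  \<open>phi\<close>; so they are below 1 for small positive \<theta>. The bound
  \<open>\<theta> < 1\<close> keeps the exponent \<open>malthus * (1 - \<theta>)\<close>
  nonnegative.\<close>

lemma chernoff_exponents:
  assumes \<delta>: "0 < \<delta>"
  obtains \<theta> where "0 < \<theta>" "\<theta> < 1"
    "exp (- \<theta> * (rate + \<delta>)) * phi (malthus * (1 - \<theta>)) < 1"
    "exp (\<theta> * (rate - \<delta>)) * phi (malthus * (1 + \<theta>)) < 1"
proof -
  have D: "(phi has_real_derivative deriv phi malthus) (at malthus)"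
    using phi_differentiable[of malthus] malthus
    by (simp add: DERIV_deriv_iff_real_differentiable)
  have "((\<lambda>\<theta>. exp (- \<theta> * (rate + \<delta>)) * phi (malthus * (1 - \<theta>))) has_real_derivative - \<delta>) (at 0)"
    using D by (auto intro!: derivative_eq_intros DERIV_chain2[where f=phi] simp: rate_def malthus)
  moreover have "- \<delta> < 0" using \<delta> by simp
  ultimately obtain d1 where d1: "0 < d1" "\<And>h. 0 < h \<Longrightarrow> h < d1 \<Longrightarrow>
      exp (- h * (rate + \<delta>)) * phi (malthus * (1 - h)) < 1"
    using DERIV_neg_dec_right[of "\<lambda>\<theta>. exp (- \<theta> * (rate + \<delta>)) * phi (malthus * (1 - \<theta>))" "- \<delta>" 0]
    by (auto simp: malthus)
  have "((\<lambda>\<theta>. exp (\<theta> * (rate - \<delta>)) * phi (malthus * (1 + \<theta>))) has_real_derivative - \<delta>) (at 0)"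
    using D by (auto intro!: derivative_eq_intros DERIV_chain2[where f=phi] simp: rate_def malthus)
  moreover have "- \<delta> < 0" using \<delta> by simp
  ultimately obtain d2 where d2: "0 < d2" "\<And>h. 0 < h \<Longrightarrow> h < d2 \<Longrightarrow>
      exp (h * (rate - \<delta>)) * phi (malthus * (1 + h)) < 1"
    using DERIV_neg_dec_right[of "\<lambda>\<theta>. exp (\<theta> * (rate - \<delta>)) * phi (malthus * (1 + \<theta>))" "- \<delta>" 0]
    by (auto simp: malthus)
  define \<theta> where "\<theta> = min (1/2) (min (d1/2) (d2/2))"
  have "0 < \<theta>" "\<theta> < 1" "\<theta> < d1" "\<theta> < d2" using d1(1) d2(1) by (auto simp: \<theta>_def)
  then show ?thesis by (intro that[of \<theta>] d1(2) d2(2))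
qed

lemma AE_summable_lvlsum:
  assumes g: "g \<in> borel_measurable law" "\<And>s. 0 \<le> g s" and C: "(\<integral>\<^sup>+s. ennreal (g s) \<partial>law) = ennreal C" "0 \<le> C"
    and r: "0 \<le> r" and q: "exp a * phi r < 1"
  shows "AE s in law. summable (\<lambda>n. exp (a * real n) * lvlsum r g n s)"
proof (rule AE_summable_of_nn_integral[where b="\<lambda>n. (exp a * phi r) ^ n * C"])
  have q0: "0 \<le> exp a * phi r" using phi_nonneg[OF r] by simp
  then show "0 \<le> (exp a * phi r) ^ n * C" for n using C by simp
  show "summable (\<lambda>n. (exp a * phi r) ^ n * C)"
    using q q0 by (intro summable_mult2 summable_geometric) auto
  show "(\<lambda>s. exp (a * real n) * lvlsum r g n s) \<in> borel_measurable law" for n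
    using measurable_lvlsum[OF g(1)] by measurable
  show "(\<integral>\<^sup>+s. ennreal (exp (a * real n) * lvlsum r g n s) \<partial>law) \<le> ennreal ((exp a * phi r) ^ n * C)" for n
  proof -
    have "(\<integral>\<^sup>+s. ennreal (exp (a * real n) * lvlsum r g n s) \<partial>law)
        = ennreal (exp (a * real n)) * (\<integral>\<^sup>+s. ennreal (lvlsum r g n s) \<partial>law)"
      using measurable_lvlsum[OF g(1)]
      by (subst nn_integral_cmult[symmetric]) (auto simp: ennreal_mult' lvlsum_nonneg g(2))
    also have "\<dots> = ennreal (exp (a * real n)) * (ennreal (phi r ^ n) * ennreal C)"
      by (simp add: nn_integral_lvlsum[OF g r] C)
    also have "\<dots> = ennreal ((exp a * phi r) ^ n * C)"
      using phi_nonneg[OF r] C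
      by (simp add: power_mult_distrib exp_of_nat_mult mult.commute[of a] mult.assoc flip: ennreal_mult)
    finally show ?thesis by simp
  qed
  show "0 \<le> exp (a * real n) * lvlsum r g n s" for n s
    by (simp add: lvlsum_nonneg g(2))
qed

definition atyp :: "(nat list \<Rightarrow> real) \<Rightarrow> real \<Rightarrow> nat \<Rightarrow> nat list set" where
  "atyp s e n = {x. x \<in> lvl K n \<and> \<bar>- ln (mass s x) - rate * n\<bar> > e * n}"

text \<open>Each atypical word is penalised by a Chernoff factor for its birth time or by a Markov factor
  for \<open>wlim (shift x s)\<close>; the four resulting level sums have geometrically decaying means.\<close>

lemma AE_typical1:
  assumes e: "0 < e"
  shows "AE s in law. summable (\<lambda>n. \<Sum>x\<in>atyp s e n. mass s x)"
proof -
  \<comment> \<open>Three errors of at most \<open>\<delta> * n\<close> each, from the birth time,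
    from \<open>wlim (shift x s)\<close> and from \<open>wlim s\<close>, stay below
    \<open>e * n\<close>; the last one is that small for all large \<open>n\<close>.\<close>
  define \<delta> where "\<delta> = e / 4"
  have \<delta>: "0 < \<delta>" using e by (simp add: \<delta>_def)
  obtain \<theta> where \<theta>: "0 < \<theta>" "\<theta> < 1"
    and q: "exp (- \<theta> * (rate + \<delta>)) * phi (malthus * (1 - \<theta>)) < 1"
      "exp (\<theta> * (rate - \<delta>)) * phi (malthus * (1 + \<theta>)) < 1"
    using chernoff_exponents[OF \<delta>] .
  define V where "V = (\<integral>s. (wlim s)\<^sup>2 \<partial>law)"
  have qd: "exp (- \<delta>) * phi malthus < 1" using \<delta> by (simp add: malthus)
  have one: "(\<integral>\<^sup>+s. ennreal 1 \<partial>law) = ennreal 1" by (simp add: emeasure_space_1)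
  have W1: "(\<integral>\<^sup>+s. ennreal (wlim s) \<partial>law) = ennreal 1" by (simp add: nn_integral_wlim)
  have W2: "(\<integral>\<^sup>+s. ennreal ((wlim s)\<^sup>2) \<partial>law) = ennreal V" by (simp add: nn_integral_wlim_sq V_def)
  have "AE s in law. summable (\<lambda>n. exp ((- \<theta> * (rate + \<delta>)) * real n) * lvlsum (malthus * (1 - \<theta>)) wlim n s)"
    using malthus \<theta> q by (intro AE_summable_lvlsum[OF _ _ W1] wlim_nonneg) auto
  moreover have "AE s in law. summable (\<lambda>n. exp ((\<theta> * (rate - \<delta>)) * real n) * lvlsum (malthus * (1 + \<theta>)) wlim n s)"
    using malthus \<theta> q by (intro AE_summable_lvlsum[OF _ _ W1] wlim_nonneg) auto
  moreover have "AE s in law. summable (\<lambda>n. exp ((- \<delta>) * real n) * lvlsum malthus (\<lambda>s. (wlim s)\<^sup>2) n s)"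
    using malthus qd by (intro AE_summable_lvlsum[OF _ _ W2]) (auto simp: V_def)
  moreover have "AE s in law. summable (\<lambda>n. exp ((- \<delta>) * real n) * lvlsum malthus (\<lambda>s. 1) n s)"
    using malthus qd by (intro AE_summable_lvlsum[OF _ _ one]) auto
  ultimately show ?thesis
    using AE_shift_all[OF AE_wlim_pos] AE_wlim_pos
  proof eventually_elim
    case (elim s)
    let ?F = "\<lambda>n. exp ((- \<theta> * (rate + \<delta>)) * real n) * lvlsum (malthus * (1 - \<theta>)) wlim n s
      + exp ((\<theta> * (rate - \<delta>)) * real n) * lvlsum (malthus * (1 + \<theta>)) wlim n s
      + exp ((- \<delta>) * real n) * lvlsum malthus (\<lambda>s. (wlim s)\<^sup>2) n s
      + exp ((- \<delta>) * real n) * lvlsum malthus (\<lambda>s. 1) n s"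
    have F: "summable (\<lambda>n. ?F n / wlim s)"
      using elim(1-4) by (intro summable_divide summable_add)
    have "filterlim (\<lambda>n. \<delta> * real n) at_top sequentially"
      using \<delta> by (intro filterlim_tendsto_pos_mult_at_top[OF tendsto_const] filterlim_real_sequentially)
    then have ev: "\<forall>\<^sub>F n in sequentially. \<bar>ln (wlim s)\<bar> \<le> \<delta> * real n"
      by (simp add: filterlim_at_top)
    have "\<forall>\<^sub>F n in sequentially. norm (\<Sum>x\<in>atyp s e n. mass s x) \<le> ?F n / wlim s"
      using ev
    proof eventually_elim
      case ev: (elim n)
      define F where "F x = exp ((- \<theta> * (rate + \<delta>)) * real n) * (exp (- (malthus * (1 - \<theta>)) * birth s x) * wlim (shift x s))
      + exp ((\<theta> * (rate - \<delta>)) * real n) * (exp (- (malthus * (1 + \<theta>)) * birth s x) * wlim (shift x s))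
      + exp ((- \<delta>) * real n) * (exp (- malthus * birth s x) * (wlim (shift x s))\<^sup>2)
      + exp ((- \<delta>) * real n) * (exp (- malthus * birth s x) * 1)" for x
      have F_nonneg: "0 \<le> F x" for x by (simp add: F_def wlim_nonneg)
      have le: "mass s x \<le> F x / wlim s" if x: "x \<in> atyp s e n" for x
      proof -
        define a where "a = malthus * birth s x"
        define u where "u = wlim (shift x s)"
        have xw: "x \<in> words K" using x by (auto simp: atyp_def dest: lvl_subset_words)
        have u: "0 < u" using elim(5) xw by (simp add: u_def)
        have W: "0 < wlim s" by (rule elim(6))
        have m: "mass s x = exp (- a) * u / wlim s" by (simp add: mass_def a_def u_def)
        have "ln (mass s x) = - a + ln u - ln (wlim s)"
          using u W by (simp add: m ln_div ln_mult)
        then have "\<bar>(a - rate * n) - ln u + ln (wlim s)\<bar> > 4 * \<delta> * n"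
        proof -
          assume "ln (mass s x) = - a + ln u - ln (wlim s)"
          then have "(a - rate * n) - ln u + ln (wlim s) = - ln (mass s x) - rate * n" by simp
          moreover have "\<bar>- ln (mass s x) - rate * n\<bar> > 4 * \<delta> * n"
            using x by (simp add: atyp_def \<delta>_def)
          ultimately show ?thesis by (simp only:)
        qed
        then have cases: "a > rate * n + \<delta> * n \<or> a < rate * n - \<delta> * n \<or> ln u > \<delta> * n \<or> ln u < - (\<delta> * n)"
          using ev by linarith
        \<comment> \<open>Each factor is at least 1 on its own deviation. \<open>G1\<close> and
          \<open>G2\<close> move the exponent of the mass to \<open>malthus * (1 - \<theta>)\<close>
          and \<open>malthus * (1 + \<theta>)\<close>; \<open>G3\<close> turns the weight
          \<open>u\<close> of the mass into \<open>u\<^sup>2\<close>, and \<open>G4\<close> turns it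
          into 1.\<close>
        define G1 where "G1 = exp (\<theta> * (a - (rate * n + \<delta> * n)))"
        define G2 where "G2 = exp (\<theta> * ((rate * n - \<delta> * n) - a))"
        define G3 where "G3 = u * exp (- \<delta> * n)"
        define G4 where "G4 = exp (- \<delta> * n) / u"
        have pos: "0 < G1" "0 < G2" "0 < G3" "0 < G4"
          using u by (auto simp: G1_def G2_def G3_def G4_def)
        have "1 \<le> G1 \<or> 1 \<le> G2 \<or> 1 \<le> G3 \<or> 1 \<le> G4"
        proof -
          have "1 \<le> G3" if "ln u > \<delta> * n"
          proof -
            have "1 = exp (\<delta> * n) * exp (- \<delta> * n)" by (simp flip: exp_add)
            also have "\<dots> \<le> exp (ln u) * exp (- \<delta> * n)" using that by (intro mult_right_mono) auto
            finally show ?thesis using u by (simp add: G3_def)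
          qed
          moreover have "1 \<le> G4" if "ln u < - (\<delta> * n)"
          proof -
            have "exp (ln u) \<le> exp (- \<delta> * n)" using that by simp
            then show ?thesis using u by (simp add: G4_def)
          qed
          moreover have "1 \<le> G1" if "a > rate * n + \<delta> * n" using that \<theta> by (simp add: G1_def)
          moreover have "1 \<le> G2" if "a < rate * n - \<delta> * n" using that \<theta> by (simp add: G2_def)
          ultimately show ?thesis using cases by blast
        qed
        then have "1 \<le> G1 + G2 + G3 + G4" using pos by linarith
        then have "(exp (- a) * u) * 1 \<le> (exp (- a) * u) * (G1 + G2 + G3 + G4)"
          using u by (intro mult_left_mono) auto
        also have "\<dots> = F x"
        proof -
          have "exp (- a) * G1 = exp ((- \<theta> * (rate + \<delta>)) * real n) * exp (- (malthus * (1 - \<theta>)) * birth s x)"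
            by (simp add: G1_def a_def algebra_simps flip: exp_add)
          moreover have "exp (- a) * G2 = exp ((\<theta> * (rate - \<delta>)) * real n) * exp (- (malthus * (1 + \<theta>)) * birth s x)"
            by (simp add: G2_def a_def algebra_simps flip: exp_add)
          moreover have "(exp (- a) * u) * G3 = exp ((- \<delta>) * real n) * (exp (- malthus * birth s x) * u\<^sup>2)"
            by (simp add: G3_def a_def power2_eq_square)
          moreover have "(exp (- a) * u) * G4 = exp ((- \<delta>) * real n) * (exp (- malthus * birth s x) * 1)"
            using u by (simp add: G4_def a_def)
          moreover have "(exp (- a) * u) * (G1 + G2 + G3 + G4)
              = (exp (- a) * G1) * u + (exp (- a) * G2) * u + (exp (- a) * u) * G3 + (exp (- a) * u) * G4"
            by (simp only: algebra_simps)
          ultimately show ?thesis by (simp only: F_def u_def mult.assoc)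
        qed
        finally show ?thesis using W by (simp add: m divide_right_mono)
      qed
      have sub: "atyp s e n \<subseteq> lvl K n" by (auto simp: atyp_def)
      have W: "0 < wlim s" by (rule elim(6))
      have "(\<Sum>x\<in>atyp s e n. mass s x) \<le> (\<Sum>x\<in>atyp s e n. F x / wlim s)"
        by (intro sum_mono le)
      also have "\<dots> \<le> (\<Sum>x\<in>lvl K n. F x / wlim s)"
        using W by (intro sum_mono2 sub) (auto simp: F_nonneg)
      also have "\<dots> = ?F n / wlim s"
        unfolding F_def lvlsum_def
        by (simp only: sum.distrib flip: sum_divide_distrib sum_distrib_left)
      finally have "(\<Sum>x\<in>atyp s e n. mass s x) \<le> ?F n / wlim s" .
      moreover have "0 \<le> (\<Sum>x\<in>atyp s e n. mass s x)"
        by (intro sum_nonneg) (simp add: mass_def wlim_nonneg)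
      ultimately show ?case by simp
    qed
    then show ?case by (rule summable_comparison_test_ev[OF _ F])
  qed
qed

lemma AE_typical: "AE s in law. \<forall>e>0. summable (\<lambda>n. \<Sum>x\<in>atyp s e n. mass s x)"
proof -
  have "AE s in law. \<forall>j. summable (\<lambda>n. \<Sum>x\<in>atyp s (1 / real (Suc j)) n. mass s x)"
    by (subst AE_all_countable) (intro allI AE_typical1, simp)
  then show ?thesis
  proof (eventually_elim, intro allI impI)
    fix s and e :: real
    assume *: "\<forall>j. summable (\<lambda>n. \<Sum>x\<in>atyp s (1 / real (Suc j)) n. mass s x)" and e: "0 < e"
    obtain j where j: "1 / real (Suc j) < e"
      using reals_Archimedean[OF e] by (auto simp: inverse_eq_divide)
    have nonneg: "0 \<le> mass s x" for x by (simp add: mass_def wlim_nonneg)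
    show "summable (\<lambda>n. \<Sum>x\<in>atyp s e n. mass s x)"
    proof (rule summable_comparison_test'[OF *[rule_format, of j]])
      fix n :: nat
      have "atyp s e n \<subseteq> atyp s (1 / real (Suc j)) n"
      proof -
        have "1 / real (Suc j) * n \<le> e * n" using j by (intro mult_right_mono) auto
        then show ?thesis unfolding atyp_def by force
      qed
      moreover have "finite (atyp s (1 / real (Suc j)) n)"
        by (rule finite_subset[OF _ finite_lvl[of K n]]) (auto simp: atyp_def)
      ultimately have "(\<Sum>x\<in>atyp s e n. mass s x) \<le> (\<Sum>x\<in>atyp s (1 / real (Suc j)) n. mass s x)"
        by (intro sum_mono2 nonneg) auto
      then show "norm (\<Sum>x\<in>atyp s e n. mass s x) \<le> (\<Sum>x\<in>atyp s (1 / real (Suc j)) n. mass s x)"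
        by (simp add: sum_nonneg nonneg)
    qed
  qed
qed

end

section \<open>Identification of the limiting proportions\<close>

text \<open>An integral over the counting measure with values in \<open>ennreal\<close> makes sense
  for infinite index sets before summability is known, and exchanges with time integrals by
  Tonelli.\<close>

definition exp_count :: "'b set \<Rightarrow> ('b \<Rightarrow> real) \<Rightarrow> real \<Rightarrow> ennreal" where
  "exp_count A f r = (\<integral>\<^sup>+x. ennreal (exp (- r * f x)) \<partial>count_space A)"

lemma nn_integral_exp_tail:
  assumes "0 < r"
  shows "(\<integral>\<^sup>+t. ennreal (r * exp (- r * t)) * indicator {a..} t \<partial>lborel) = ennreal (exp (- r * a))"
proof -
  have "((\<lambda>t. - exp (- r * t)) \<longlongrightarrow> - 0) at_top"
  proof (intro tendsto_minus filterlim_compose[OF exp_at_bot])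
    have "filterlim (\<lambda>t. r * t) at_top at_top"
      using assms by (intro filterlim_tendsto_pos_mult_at_top[OF tendsto_const] filterlim_ident)
    then show "filterlim (\<lambda>t. - r * t) at_bot at_top" by (simp add: filterlim_uminus_at_top)
  qed
  then have "((\<lambda>t. - exp (- r * t)) \<longlongrightarrow> 0) at_top" by simp
  then have "(\<integral>\<^sup>+t. ennreal (r * exp (- r * t)) * indicator {a..} t \<partial>lborel) = 0 - (- exp (- r * a))"
    using assms by (intro nn_integral_FTC_atLeast) (auto intro!: derivative_eq_intros)
  then show ?thesis by simp
qed

text \<open>The term \<open>exp (- r * f x)\<close> is the integral of
  \<open>r * exp (- r * t)\<close> over \<open>t \<ge> f x\<close>; exchanging sum and integral
  yields \<open>r\<close> times the Laplace transform of the counting function.\<close>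

lemma exp_count_eq:
  assumes A: "countable A" and r: "0 < r" and fin: "\<And>t. finite {x \<in> A. f x \<le> t}"
  shows "exp_count A f r = (\<integral>\<^sup>+t. ennreal (r * exp (- r * t)) * of_nat (card {x \<in> A. f x \<le> t}) \<partial>lborel)"
proof -
  have "exp_count A f r
      = (\<integral>\<^sup>+x. \<integral>\<^sup>+t. ennreal (r * exp (- r * t)) * indicator {f x..} t \<partial>lborel \<partial>count_space A)"
    unfolding exp_count_def by (simp only: nn_integral_exp_tail[OF r])
  also have "\<dots> = (\<integral>\<^sup>+t. \<integral>\<^sup>+x. ennreal (r * exp (- r * t)) * indicator {f x..} t \<partial>count_space A \<partial>lborel)"
    by (rule nn_integral_count_space_nn_integral[symmetric, OF A]) simp
  also have "\<dots> = (\<integral>\<^sup>+t. ennreal (r * exp (- r * t)) * of_nat (card {x \<in> A. f x \<le> t}) \<partial>lborel)"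
  proof (intro nn_integral_cong)
    fix t
    have "(\<integral>\<^sup>+x. ennreal (r * exp (- r * t)) * indicator {f x..} t \<partial>count_space A)
        = (\<integral>\<^sup>+x. ennreal (r * exp (- r * t)) * indicator {x \<in> A. f x \<le> t} x \<partial>count_space A)"
      by (intro nn_integral_cong) (auto split: split_indicator)
    also have "\<dots> = ennreal (r * exp (- r * t)) * emeasure (count_space A) {x \<in> A. f x \<le> t}"
      by (intro nn_integral_cmult_indicator) auto
    also have "emeasure (count_space A) {x \<in> A. f x \<le> t} = of_nat (card {x \<in> A. f x \<le> t})"
      using fin by (intro emeasure_count_space_finite) auto
    finally show "(\<integral>\<^sup>+x. ennreal (r * exp (- r * t)) * indicator {f x..} t \<partial>count_space A)
      = ennreal (r * exp (- r * t)) * of_nat (card {x \<in> A. f x \<le> t})" .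
  qed
  finally show ?thesis .
qed

text \<open>The comparison of counting functions is integrated against
  \<open>r * exp (- r * t)\<close>, a probability density on the positive times; the additive
  constant \<beta> therefore reappears unchanged for every \<open>r\<close>.\<close>

lemma exp_count_le:
  assumes A: "countable A" "\<And>t. finite {x \<in> A. f x \<le> t}" "\<And>x. x \<in> A \<Longrightarrow> 0 \<le> f x"
    and B: "countable B" "\<And>t. finite {y \<in> B. g y \<le> t}" and r: "0 < r"
    and \<alpha>: "0 \<le> \<alpha>" "0 \<le> \<beta>"
    and le: "\<And>t. 0 \<le> t \<Longrightarrow> real (card {x \<in> A. f x \<le> t}) \<le> \<alpha> * real (card {y \<in> B. g y \<le> t}) + \<beta>"
    and a: "exp_count A f r = ennreal a" and b: "exp_count B g r = ennreal b" "0 \<le> b"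
  shows "a \<le> \<alpha> * b + \<beta>"
proof -
  let ?e = "\<lambda>t. ennreal (r * exp (- r * t))"
  let ?A = "\<lambda>t. card {x \<in> A. f x \<le> t}" and ?B = "\<lambda>t. card {y \<in> B. g y \<le> t}"
  have [measurable]: "(\<lambda>t. real (?B t)) \<in> borel_measurable lborel"
  proof -
    have "mono (\<lambda>t. real (?B t))"
      using B(2) by (intro monoI of_nat_mono card_mono) auto
    then show ?thesis using borel_measurable_mono by simp
  qed
  have "ennreal a = (\<integral>\<^sup>+t. ?e t * of_nat (?A t) \<partial>lborel)"
    using exp_count_eq[OF A(1) r A(2)] a by simp
  also have "\<dots> \<le> (\<integral>\<^sup>+t. ennreal \<alpha> * (?e t * of_nat (?B t)) + ennreal \<beta> * (?e t * indicator {0..} t) \<partial>lborel)"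
  proof (intro nn_integral_mono)
    fix t :: real
    show "?e t * of_nat (?A t) \<le> ennreal \<alpha> * (?e t * of_nat (?B t)) + ennreal \<beta> * (?e t * indicator {0..} t)"
    proof (cases "0 \<le> t")
      case True
      have "?e t * of_nat (?A t) = ennreal (r * exp (- r * t) * real (?A t))"
        using r by (simp add: ennreal_mult ennreal_of_nat_eq_real_of_nat)
      also have "\<dots> \<le> ennreal (r * exp (- r * t) * (\<alpha> * real (?B t) + \<beta>))"
        using le[OF True] r by (intro ennreal_leI mult_left_mono) auto
      also have "r * exp (- r * t) * (\<alpha> * real (?B t) + \<beta>)
          = \<alpha> * (r * exp (- r * t) * real (?B t)) + \<beta> * (r * exp (- r * t))"
        by (simp only: algebra_simps)
      also have "ennreal \<dots> = ennreal \<alpha> * (?e t * of_nat (?B t)) + ennreal \<beta> * (?e t * indicator {0..} t)"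
        using r \<alpha> True by (simp add: ennreal_mult ennreal_plus ennreal_of_nat_eq_real_of_nat)
      finally show ?thesis .
    next
      case False
      \<comment> \<open>The comparison is assumed from time 0 on only, but nothing in
        \<open>A\<close> is counted earlier.\<close>
      then have "{x \<in> A. f x \<le> t} = {}" using A(3) by force
      then show ?thesis by (simp only: card.empty of_nat_0 mult_zero_right) simp
    qed
  qed
  also have "\<dots> = ennreal \<alpha> * exp_count B g r + ennreal \<beta> * ennreal (exp (- r * 0))"
  proof -
    have [measurable]: "(\<lambda>t. ?e t * of_nat (?B t)) \<in> borel_measurable lborel"
      unfolding ennreal_of_nat_eq_real_of_nat by measurable
    have "(\<integral>\<^sup>+t. ennreal \<alpha> * (?e t * of_nat (?B t)) + ennreal \<beta> * (?e t * indicator {0..} t) \<partial>lborel)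
        = (\<integral>\<^sup>+t. ennreal \<alpha> * (?e t * of_nat (?B t)) \<partial>lborel) + (\<integral>\<^sup>+t. ennreal \<beta> * (?e t * indicator {0..} t) \<partial>lborel)"
      by (rule nn_integral_add) measurable
    also have "(\<integral>\<^sup>+t. ennreal \<alpha> * (?e t * of_nat (?B t)) \<partial>lborel) = ennreal \<alpha> * exp_count B g r"
      unfolding exp_count_eq[OF B(1) r B(2)] by (rule nn_integral_cmult) measurable
    also have "(\<integral>\<^sup>+t. ennreal \<beta> * (?e t * indicator {0..} t) \<partial>lborel) = ennreal \<beta> * ennreal (exp (- r * 0))"
      unfolding nn_integral_exp_tail[OF r, symmetric] by (rule nn_integral_cmult) measurable
    finally show ?thesis .
  qed
  also have "\<dots> = ennreal (\<alpha> * b + \<beta>)"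
    using \<alpha> b by (simp add: ennreal_mult ennreal_plus)
  finally have "ennreal a \<le> ennreal (\<alpha> * b + \<beta>)" .
  then show ?thesis using \<alpha> b by (subst (asm) ennreal_le_iff) auto
qed

text \<open>Beyond some time the counts are comparable up to factors near \<open>l\<close>; earlier
  times cost an additive constant, which disappears after division by \<open>b k\<close> since
  \<open>b\<close> tends to infinity. The point \<open>y\<close> keeps the denominators positive
  from time 0 on.\<close>

lemma abelian_ratio:
  fixes r a b :: "nat \<Rightarrow> real"
  assumes A: "countable A" "\<And>t. finite {x \<in> A. f x \<le> t}" "\<And>x. x \<in> A \<Longrightarrow> 0 \<le> f x"
    and B: "countable B" "\<And>t. finite {y \<in> B. g y \<le> t}" "\<And>y. y \<in> B \<Longrightarrow> 0 \<le> g y"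
    and y: "y \<in> B" "g y = 0" and r: "\<And>k. 0 < r k"
    and a: "\<And>k. exp_count A f (r k) = ennreal (a k)" "\<And>k. 0 \<le> a k"
    and b: "\<And>k. exp_count B g (r k) = ennreal (b k)" "filterlim b at_top sequentially"
    and m: "(\<lambda>k. a k / b k) \<longlonglongrightarrow> m"
    and l: "((\<lambda>t. real (card {x \<in> A. f x \<le> t}) / real (card {y \<in> B. g y \<le> t})) \<longlongrightarrow> l) at_top"
  shows "l = m"
proof -
  let ?A = "\<lambda>t. real (card {x \<in> A. f x \<le> t})" and ?B = "\<lambda>t. real (card {y \<in> B. g y \<le> t})"
  have Bpos: "0 < ?B t" if "0 \<le> t" for t
    using y B(2)[of t] that by (auto simp: card_gt_0_iff)
  have bpos: "\<forall>\<^sub>F k in sequentially. 0 < b k" using b(2) by (simp add: filterlim_at_top_dense)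
  have inv: "(\<lambda>k. \<beta> / b k) \<longlonglongrightarrow> 0" for \<beta>
    by (intro tendsto_divide_0[OF tendsto_const] filterlim_at_top_imp_at_infinity b)
  have l0: "0 \<le> l" by (rule tendsto_lowerbound[OF l]) auto
  have close: "\<exists>t0\<ge>0. \<forall>t\<ge>t0. (l - e) * ?B t \<le> ?A t \<and> ?A t \<le> (l + e) * ?B t" if e: "0 < e" for e
  proof -
    have "\<forall>\<^sub>F t in at_top. dist (?A t / ?B t) l < e \<and> 0 \<le> t"
      using tendstoD[OF l e] eventually_ge_at_top[of 0] by eventually_elim simp
    then obtain t0 where t0: "\<And>t. t \<ge> t0 \<Longrightarrow> dist (?A t / ?B t) l < e \<and> 0 \<le> t"
      by (auto simp: eventually_at_top_linorder)
    show ?thesis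
    proof (intro exI[of _ "max 0 t0"] conjI allI impI)
      fix t assume "max 0 t0 \<le> t"
      then have *: "\<bar>?A t / ?B t - l\<bar> < e" "0 < ?B t" using t0[of t] Bpos[of t] by (auto simp: dist_real_def)
      then have "l - e \<le> ?A t / ?B t" "?A t / ?B t \<le> l + e" by linarith+
      then show "(l - e) * ?B t \<le> ?A t" "?A t \<le> (l + e) * ?B t"
        using *(2) by (simp_all add: pos_le_divide_eq pos_divide_le_eq)
    qed simp
  qed
  have monoA: "?A t \<le> ?A t0" and monoB: "?B t \<le> ?B t0" if "t \<le> t0" for t t0
    using that A(2)[of t0] B(2)[of t0] by (auto intro!: card_mono)
  have "m \<le> l + e" if e: "0 < e" for e
  proof -
    obtain t0 where t0: "0 \<le> t0" "\<And>t. t \<ge> t0 \<Longrightarrow> ?A t \<le> (l + e) * ?B t" using close[OF e] by blast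
    have "?A t \<le> (l + e) * ?B t + ?A t0" if "0 \<le> t" for t
    proof (cases "t0 \<le> t")
      case True
      then show ?thesis using t0(2)[of t] by linarith
    next
      case False
      then have "?A t \<le> ?A t0" by (intro monoA) simp
      moreover have "0 \<le> (l + e) * ?B t" using l0 e by simp
      ultimately show ?thesis by linarith
    qed
    then have le: "a k \<le> (l + e) * b k + ?A t0" if "0 \<le> b k" for k
      using l0 e that by (intro exp_count_le[OF A B(1,2) r _ _ _ a(1) b(1)]) auto
    have "\<forall>\<^sub>F k in sequentially. a k / b k \<le> (l + e) + ?A t0 / b k"
      using bpos
    proof eventually_elim
      case (elim k)
      have "a k / b k \<le> ((l + e) * b k + ?A t0) / b k"
        using le[of k] elim by (intro divide_right_mono) auto
      then show ?case using elim by (simp add: add_divide_distrib)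
    qed
    then have "m \<le> (l + e) + 0"
      by (intro tendsto_le[OF _ tendsto_add[OF tendsto_const inv] m]) auto
    then show ?thesis by simp
  qed
  then have "m \<le> l" by (rule field_le_epsilon)
  moreover have "l \<le> m + e" if e: "0 < e" for e
  \<comment> \<open>The comparison is inverted here, which takes \<open>l - e > 0\<close>; otherwise
    the claim follows from \<open>m \<ge> 0\<close>.\<close>
  proof (cases "e < l")
    case True
    obtain t0 where t0: "0 \<le> t0" "\<And>t. t \<ge> t0 \<Longrightarrow> (l - e) * ?B t \<le> ?A t" using close[OF e] by blast
    have "?B t \<le> 1 / (l - e) * ?A t + ?B t0" if "0 \<le> t" for t
    proof (cases "t0 \<le> t")
      case t: True
      then have "?B t \<le> ?A t / (l - e)" using t0(2)[of t] True by (simp add: pos_le_divide_eq mult.commute)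
      then show ?thesis by simp
    next
      case False
      then have "?B t \<le> ?B t0" by (intro monoB) simp
      moreover have "0 \<le> 1 / (l - e) * ?A t" using True by simp
      ultimately show ?thesis by linarith
    qed
    then have le: "b k \<le> 1 / (l - e) * a k + ?B t0" for k
      using True by (intro exp_count_le[OF B A(1,2) r _ _ _ b(1) a]) auto
    have "\<forall>\<^sub>F k in sequentially. 1 \<le> 1 / (l - e) * (a k / b k) + ?B t0 / b k"
      using bpos
    proof eventually_elim
      case (elim k)
      have "b k / b k \<le> (1 / (l - e) * a k + ?B t0) / b k"
        using le[of k] elim by (intro divide_right_mono) auto
      then show ?case using elim by (simp add: add_divide_distrib)
    qed
    then have "1 \<le> 1 / (l - e) * m + 0"
      by (intro tendsto_le[OF _ tendsto_add[OF tendsto_mult[OF tendsto_const m] inv] tendsto_const]) auto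
    then show ?thesis using True by (simp add: pos_le_divide_eq)
  next
    case False
    have "0 \<le> m"
    proof (rule tendsto_lowerbound[OF m])
      show "\<forall>\<^sub>F k in sequentially. 0 \<le> a k / b k"
        using bpos by eventually_elim (simp add: a)
    qed simp
    then show ?thesis using False by simp
  qed
  then have "l \<le> m" by (rule field_le_epsilon)
  ultimately show ?thesis by simp
qed

context tree_law
begin

section \<open>Exponential counts of the random tree\<close>

lemma exp_count_birth:
  assumes "summable (\<lambda>n. gen r n s)"
  shows "exp_count (words K) (birth s) r = ennreal (total r s)"
proof -
  let ?e = "\<lambda>x. ennreal (exp (- r * birth s x))"
  have "exp_count (words K) (birth s) r
      = (\<integral>\<^sup>+x. (\<Sum>n. ?e x * indicator (lvl K n) x) \<partial>count_space (words K))"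
    unfolding exp_count_def
  proof (intro nn_integral_cong)
    fix x assume "x \<in> space (count_space (words K))"
    then have x: "x \<in> lvl K (length x)" by (simp add: lvl_def)
    have "disjoint_family (lvl K)" by (auto simp: disjoint_family_on_def lvl_def)
    from suminf_cmult_indicator[OF this x, of "\<lambda>_. ?e x"]
    show "?e x = (\<Sum>n. ?e x * indicator (lvl K n) x)" by simp
  qed
  also have "\<dots> = (\<Sum>n. \<integral>\<^sup>+x. ?e x * indicator (lvl K n) x \<partial>count_space (words K))"
    by (intro nn_integral_suminf) simp
  also have "\<dots> = (\<Sum>n. ennreal (gen r n s))"
  proof (intro suminf_cong)
    fix n
    have "(\<integral>\<^sup>+x. ?e x * indicator (lvl K n) x \<partial>count_space (words K)) = (\<integral>\<^sup>+x. ?e x \<partial>count_space (lvl K n))"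
      by (subst (1 2) nn_integral_count_space_indicator)
        (auto simp: lvl_def intro!: nn_integral_cong split: split_indicator)
    also have "\<dots> = (\<Sum>x\<in>lvl K n. ?e x)" by (rule nn_integral_count_space_finite) simp
    also have "\<dots> = ennreal (gen r n s)" by (simp add: lvlsum_def)
    finally show "(\<integral>\<^sup>+x. ?e x * indicator (lvl K n) x \<partial>count_space (words K)) = ennreal (gen r n s)" .
  qed
  also have "\<dots> = ennreal (total r s)"
    unfolding total_def using assms by (intro suminf_ennreal2) (auto simp: gen_nonneg)
  finally show ?thesis .
qed

text \<open>Infinitely many births up to time \<open>t\<close> would each contribute at least
  \<open>exp (- r * t)\<close> and make the exponential sum infinite.\<close>

lemma finite_born_before:
  assumes sum: "summable (\<lambda>n. gen r n s)" and r: "0 \<le> r"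
  shows "finite {x \<in> words K. birth s x \<le> t}"
proof -
  let ?S = "{x \<in> words K. birth s x \<le> t}"
  have "ennreal (exp (- r * t)) * emeasure (count_space (words K)) ?S
      = (\<integral>\<^sup>+x. ennreal (exp (- r * t)) * indicator ?S x \<partial>count_space (words K))"
    by (intro nn_integral_cmult_indicator[symmetric]) auto
  also have "\<dots> \<le> exp_count (words K) (birth s) r"
    unfolding exp_count_def
    by (intro nn_integral_mono) (auto split: split_indicator intro!: ennreal_leI mult_left_mono r)
  also have "\<dots> < top" by (simp add: exp_count_birth[OF sum])
  finally have "ennreal (exp (- r * t)) * emeasure (count_space (words K)) ?S \<noteq> top" by simp
  then show ?thesis
    by (cases "finite ?S") (auto simp: emeasure_count_space_infinite ennreal_mult_top)
qed

lemma exp_count_birth_subtree: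
  assumes sum: "summable (\<lambda>n. gen r n (shift x s))"
  shows "exp_count (words K) (\<lambda>y. birth s (x @ y)) r = ennreal (exp (- r * birth s x) * total r (shift x s))"
proof -
  have "exp_count (words K) (\<lambda>y. birth s (x @ y)) r
      = (\<integral>\<^sup>+y. ennreal (exp (- r * birth s x)) * ennreal (exp (- r * birth (shift x s) y)) \<partial>count_space (words K))"
    unfolding exp_count_def
    by (intro nn_integral_cong) (auto simp: birth_append algebra_simps simp flip: exp_add ennreal_mult)
  also have "\<dots> = ennreal (exp (- r * birth s x)) * exp_count (words K) (birth (shift x s)) r"
    unfolding exp_count_def by (rule nn_integral_cmult) simp
  also have "\<dots> = ennreal (exp (- r * birth s x) * total r (shift x s))"
    by (simp add: exp_count_birth[OF sum] ennreal_mult')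
  finally show ?thesis .
qed

text \<open>Gathers the almost sure properties, at every subtree and every \<open>rs k\<close>, so
  that the rest of the argument is deterministic for a fixed sample point.\<close>

definition regular :: "(nat list \<Rightarrow> real) \<Rightarrow> bool" where
  "regular s \<longleftrightarrow> s \<in> space law \<and> (\<forall>x\<in>words K. 0 \<le> birth s x)
    \<and> (\<forall>x\<in>words K. \<forall>k. summable (\<lambda>n. gen (rs k) n (shift x s)))
    \<and> (\<forall>x\<in>words K. (\<lambda>k. ntotal (rs k) (shift x s)) \<longlonglongrightarrow> wlim (shift x s))
    \<and> (\<forall>x\<in>words K. 0 < wlim (shift x s))
    \<and> (\<forall>x\<in>words K. wlim (shift x s) = sumop malthus wlim (shift x s))
    \<and> (\<lambda>n. \<Sum>x\<in>lvl K n. (mass s x)\<^sup>2) \<longlonglongrightarrow> 0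
    \<and> (\<forall>e>0. summable (\<lambda>n. \<Sum>x\<in>atyp s e n. mass s x))"

lemma AE_regular: "AE s in law. regular s"
proof -
  have "AE s in law. \<forall>k. summable (\<lambda>n. gen (rs k) n s)"
    by (subst AE_all_countable) (intro allI AE_summable_gen rs_gt)
  from AE_space AE_birth_nonneg AE_shift_all[OF this] AE_shift_all[OF AE_wlim]
    AE_shift_all[OF AE_wlim_pos] AE_shift_all[OF AE_wlim_rec] AE_mass_small AE_typical
  show ?thesis unfolding regular_def by eventually_elim blast
qed

section \<open>Masses and limiting proportions at a regular sample point\<close>

context
  fixes s assumes s: "regular s"
begin

lemma wlim_root: "0 < wlim s" "shift [] s = s"
  using s shift_Nil[of s] unfolding regular_def by (metis Nil_in_words)+

lemma mass_pos: "x \<in> words K \<Longrightarrow> 0 < mass s x"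
  using s wlim_root by (auto simp: regular_def mass_def)

lemma mass_root: "mass s [] = 1"
  using wlim_root by (simp add: mass_def)

lemma mass_split: 
  assumes x: "x \<in> words K"
  shows "mass s x = (\<Sum>i=1..K. mass s (x @ [i]))"
proof -
  have "wlim (shift x s) = (\<Sum>i=1..K. exp (- malthus * birth (shift x s) [i]) * wlim (shift [i] (shift x s)))"
    using s x unfolding regular_def sumop_def by blast
  then have "mass s x = (\<Sum>i=1..K. exp (- malthus * birth s x) *
      (exp (- malthus * birth (shift x s) [i]) * wlim (shift [i] (shift x s))) / wlim s)"
    by (simp add: mass_def sum_distrib_left sum_divide_distrib)
  also have "\<dots> = (\<Sum>i=1..K. mass s (x @ [i]))"
  proof (intro sum.cong refl)
    fix i assume "i \<in> {1..K}"
    then have i: "[i] \<in> words K" by simp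
    have "exp (- malthus * (birth s x + birth (shift x s) [i]))
        = exp (- malthus * birth s x) * exp (- malthus * birth (shift x s) [i])"
      by (simp add: algebra_simps flip: exp_add)
    then show "exp (- malthus * birth s x) * (exp (- malthus * birth (shift x s) [i]) *
        wlim (shift [i] (shift x s))) / wlim s = mass s (x @ [i])"
      unfolding mass_def birth_append[OF i] shift_append[OF i]
      by (simp only: mult.assoc)
  qed
  finally show ?thesis .
qed

lemma limit_ratio_eq_mass:
  assumes x: "x \<in> words K"
    and l: "((\<lambda>t. real (card {y \<in> words K. birth s (x @ y) \<le> t}) / real (card {y \<in> words K. birth s y \<le> t}))
      \<longlongrightarrow> l) at_top"
  shows "l = mass s x"
proof (rule abelian_ratio[where A="words K" and B="words K" and f="\<lambda>y. birth s (x @ y)" and g="birth s"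
      and r=rs and a="\<lambda>k. exp (- rs k * birth s x) * total (rs k) (shift x s)" and b="\<lambda>k. total (rs k) s" and y="[]"])
  have sum: "summable (\<lambda>n. gen (rs k) n (shift x s))" "summable (\<lambda>n. gen (rs k) n s)" for k
    using s x wlim_root unfolding regular_def by (metis Nil_in_words)+
  have lims: "(\<lambda>k. ntotal (rs k) (shift x s)) \<longlonglongrightarrow> wlim (shift x s)" "(\<lambda>k. ntotal (rs k) s) \<longlonglongrightarrow> wlim s"
    using s x wlim_root unfolding regular_def by (metis Nil_in_words)+
  have nonneg: "0 \<le> birth s y" if "y \<in> words K" for y using s that by (simp add: regular_def)
  show "finite {y \<in> words K. birth s y \<le> t}" for t
    by (rule finite_born_before[OF sum(2) rs(1)])
  have "{y \<in> words K. birth s (x @ y) \<le> t} = {y \<in> words K. birth (shift x s) y \<le> t - birth s x}" for t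
    by (auto simp: birth_append)
  then show "finite {y \<in> words K. birth s (x @ y) \<le> t}" for t
    using finite_born_before[OF sum(1) rs(1)] by simp
  show "0 \<le> birth s (x @ y)" if "y \<in> words K" for y using nonneg x that by simp
  show "0 \<le> birth s y" if "y \<in> words K" for y using nonneg that .
  show "0 < rs k" for k using rs_gt[of k] malthus by simp
  show "exp_count (words K) (\<lambda>y. birth s (x @ y)) (rs k) = ennreal (exp (- rs k * birth s x) * total (rs k) (shift x s))" for k
    by (rule exp_count_birth_subtree[OF sum(1)])
  show "exp_count (words K) (birth s) (rs k) = ennreal (total (rs k) s)" for k
    by (rule exp_count_birth[OF sum(2)])
  show "0 \<le> exp (- rs k * birth s x) * total (rs k) (shift x s)" for k
    unfolding total_def by (intro mult_nonneg_nonneg suminf_nonneg sum gen_nonneg) simp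
  \<comment> \<open>By the choice of \<open>rs\<close>, passing from \<open>ntotal\<close> to
    \<open>total\<close> is multiplication by the same number \<open>4 * 4 ^ k\<close> at the root
    and at \<open>x\<close>: it cancels in the quotient and drives \<open>total (rs k) s\<close> to
    infinity.\<close>
  have p: "ntotal (rs k) u = (1/4) ^ Suc k * total (rs k) u" for k u
    unfolding ntotal_def rs by simp
  have q: "total (rs k) u = 4 * 4 ^ k * ntotal (rs k) u" for k u
    by (simp add: p power_divide)
  have "filterlim (\<lambda>k. ntotal (rs k) s * (4 * 4 ^ k)) at_top sequentially"
  proof (rule filterlim_tendsto_pos_mult_at_top[OF lims(2) wlim_root(1)])
    show "filterlim (\<lambda>k. 4 * 4 ^ k :: real) at_top sequentially"
      by (intro filterlim_tendsto_pos_mult_at_top[OF tendsto_const]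
          filterlim_at_infinity_imp_filterlim_at_top filterlim_realpow_sequentially_gt1) auto
  qed
  then show "filterlim (\<lambda>k. total (rs k) s) at_top sequentially"
    by (simp add: q mult.commute)
  have "(\<lambda>k. exp (- rs k * birth s x) * ntotal (rs k) (shift x s) / ntotal (rs k) s) \<longlonglongrightarrow> mass s x"
    unfolding mass_def using wlim_root(1)
    by (intro tendsto_intros rs_lim lims) auto
  then show "(\<lambda>k. exp (- rs k * birth s x) * total (rs k) (shift x s) / total (rs k) s) \<longlonglongrightarrow> mass s x"
    by (simp add: q)
  show "((\<lambda>t. real (card {y \<in> words K. birth s (x @ y) \<le> t}) / real (card {y \<in> words K. birth s y \<le> t}))
      \<longlongrightarrow> l) at_top" by (rule l)
qed auto

end

end

text \<open>\<open>Lim\<close> is a definite description; without a limit its predicate is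
  constantly false, so the value is the same for every divergent function.\<close>

lemma Lim_at_top_cases:
  fixes F :: "real \<Rightarrow> real"
  shows "(F \<longlongrightarrow> Lim at_top F) at_top \<or> Lim at_top F = (THE l. False)"
proof (cases "\<exists>l. (F \<longlongrightarrow> l) at_top")
  case True
  then obtain l where "(F \<longlongrightarrow> l) at_top" ..
  then show ?thesis using tendsto_Lim[of at_top F l] by simp
next
  case False
  then have "(\<lambda>l. (F \<longlongrightarrow> l) at_top) = (\<lambda>l. False)" by auto
  then show ?thesis unfolding t2_space_class.Lim_def by simp
qed

theorem theorem2p4:
  fixes K :: nat and w :: "nat \<Rightarrow> real" and \<Lambda> h :: real
    and M :: "'a measure"
    and \<sigma> :: "nat list \<Rightarrow> 'a \<Rightarrow> real"
    and \<mu> :: "'a \<Rightarrow> (nat \<Rightarrow> nat) measure"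
  assumes K: "2 \<le> K"
    and w: "\<And>j. j < K \<Longrightarrow> 0 < w j"
    and \<Lambda>: "0 < \<Lambda>" "\<Lambda> < 1"
    and M: "prob_space M"
    and indep: "prob_space.indep_vars M (\<lambda>_. borel) \<sigma> (words K - {[]})"
    and expo: "\<And>y i. y \<in> words K \<Longrightarrow> i \<in> {1..K} \<Longrightarrow>
      distributed M lborel (\<sigma> (y @ [i])) (exponential_density (w (i - 1)))"
    and \<mu>: "AE \<omega> in M. limiting_measure K \<Lambda> \<sigma> \<omega> (\<mu> \<omega>)"
    and h: "AE \<omega> in M. (\<lambda>n. level_entropy K \<sigma> n \<omega> / real n) \<longlonglongrightarrow> h"
  shows "AE \<omega> in M.
      hausdorff_dim K \<Lambda> (\<mu> \<omega>) = ereal (h / (- ln \<Lambda>)) \<and>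
      packing_dim K \<Lambda> (\<mu> \<omega>) = ereal (h / (- ln \<Lambda>)) \<and>
      (AE x in \<mu> \<omega>. has_local_dim K \<Lambda> (\<mu> \<omega>) x (hausdorff_dim K \<Lambda> (\<mu> \<omega>)) \<and>
                     has_local_dim K \<Lambda> (\<mu> \<omega>) x (packing_dim K \<Lambda> (\<mu> \<omega>)))"
proof -
  interpret prob_space M by (rule M)
  interpret T: tree_law K w by (rule tree_law.intro[OF K w])
  \<comment> \<open>The given waiting times, made extensional on \<open>idx\<close>, as a random
    point of the product space; its law turns out to be \<open>T.law\<close>.\<close>
  define Z where "Z \<omega> = (\<lambda>y\<in>T.idx. \<sigma> y \<omega>)" for \<omega>
  have indep': "indep_vars (\<lambda>_. borel) \<sigma> T.idx" using indep by (simp add: T.idx_def)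
  have rv: "\<sigma> y \<in> borel_measurable M" if "y \<in> T.idx" for y
    using indep' that by (simp add: indep_vars_def)
  have wait: "distr M borel (\<sigma> y) = T.wait y" if y: "y \<in> T.idx" for y
  proof -
    obtain z i where yz: "y = z @ [i]" using T.idxD(2)[OF y] by (cases y rule: rev_cases) auto
    then have "distributed M lborel (\<sigma> y) (exponential_density (w (i - 1)))"
      using expo[of z i] T.idxD(1)[OF y] by simp
    then have "distr M lborel (\<sigma> y) = T.wait y"
      by (simp add: distributed_distr_eq_density T.wait_def yz)
    moreover have "distr M lborel (\<sigma> y) = distr M borel (\<sigma> y)" by (rule distr_cong) auto
    ultimately show ?thesis by simp
  qed
  have Z [measurable]: "Z \<in> measurable M T.law"
    unfolding Z_def measurable_cong_sets[OF refl T.sets_law] by (intro measurable_restrict rv)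
  have "distr M T.law Z = distr M (PiM T.idx (\<lambda>_. borel)) (\<lambda>\<omega>. \<lambda>y\<in>T.idx. \<sigma> y \<omega>)"
    by (intro distr_cong refl T.sets_law) (simp add: Z_def)
  also have "\<dots> = PiM T.idx (\<lambda>y. distr M borel (\<sigma> y))"
  proof -
    have "[1] \<in> T.idx" using K by simp
    then have "T.idx \<noteq> {}" by blast
    then show ?thesis using indep' by (subst (asm) indep_vars_iff_distr_eq_PiM') (auto intro: rv)
  qed
  also have "\<dots> = T.law" unfolding T.law_def by (intro PiM_cong refl wait)
  finally have distr: "distr M T.law Z = T.law" .
  have "AE \<omega> in M. T.regular (Z \<omega>)"
  proof (rule AE_distrD[OF Z])
    show "AE s in distr M T.law Z. T.regular s"
      unfolding distr by (rule T.AE_regular)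
  qed
  with \<mu> h show ?thesis
  proof eventually_elim
    case (elim \<omega>)
    define s where "s = Z \<omega>"
    define \<nu> where "\<nu> = \<mu> \<omega>"
    have reg: "T.regular s" using elim by (simp add: s_def)
    have \<nu>: "prob_space \<nu>" "sets \<nu> = sets (leaf_borel K \<Lambda>)"
      and cyl: "\<And>x. x \<in> words K \<Longrightarrow> measure \<nu> (cylinder K x) = limit_mass K \<sigma> x \<omega>"
      using elim(1) by (auto simp: limiting_measure_def \<nu>_def)
    have birth: "birth_time \<sigma> x \<omega> = birth s x" if "x \<in> words K" for x
      unfolding birth_time_eq_birth by (rule birth_cong[OF _ that]) (auto simp: s_def Z_def T.idx_def)
    have mass: "measure \<nu> (cylinder K x) = T.mass s x" if "x \<in> words K" for x
    \<comment> \<open>The exceptional value is what \<open>Lim\<close> returns without convergence.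
      Additivity of the limiting masses is read off from the measure \<open>\<nu>\<close>.\<close>
    proof (rule flow_eqI[of K _ "T.mass s" "THE l. False"])
      show "measure \<nu> (cylinder K x) = (\<Sum>i=1..K. measure \<nu> (cylinder K (x @ [i])))" for x
        by (rule measure_cylinder_split[OF \<Lambda> \<nu>])
      show "T.mass s x = (\<Sum>i=1..K. T.mass s (x @ [i]))" if "x \<in> words K" for x
        by (rule T.mass_split[OF reg that])
      show "0 < T.mass s x" if "x \<in> words K" for x by (rule T.mass_pos[OF reg that])
      show "T.mass s [] = 1" by (rule T.mass_root[OF reg])
      show "(\<lambda>n. \<Sum>x\<in>lvl K n. (T.mass s x)\<^sup>2) \<longlonglongrightarrow> 0" using reg by (simp add: T.regular_def)
      have "cylinder K [] = space \<nu>"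
        using sets_eq_imp_space_eq[OF \<nu>(2)] \<Lambda> by (auto simp: cylinder_def initial_segment_def)
      then show "measure \<nu> (cylinder K []) = 1" using prob_space.prob_space[OF \<nu>(1)] by simp
      show "measure \<nu> (cylinder K x) = T.mass s x \<or> measure \<nu> (cylinder K x) = (THE l. False)"
        if x: "x \<in> words K" for x
      proof -
        have "{y. x @ y \<in> tree K \<sigma> t \<omega>} = {y \<in> words K. birth s (x @ y) \<le> t}"
          "tree K \<sigma> t \<omega> = {y \<in> words K. birth s y \<le> t}" for t
          using x by (auto simp: tree_def birth)
        moreover define F where "F t = real (card {y \<in> words K. birth s (x @ y) \<le> t})
            / real (card {y \<in> words K. birth s y \<le> t})" for t
        ultimately have eq: "measure \<nu> (cylinder K x) = Lim at_top F"
          by (simp add: cyl[OF x] limit_mass_def F_def[abs_def])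
        from Lim_at_top_cases[of F] show ?thesis
        proof
          assume "(F \<longlongrightarrow> Lim at_top F) at_top"
          then show ?thesis unfolding eq F_def by (intro disjI1 T.limit_ratio_eq_mass[OF reg x])
        qed (simp add: eq)
      qed
    qed (auto simp: that)
    have typical: "summable (\<lambda>n. \<Sum>x | x \<in> lvl K n \<and> \<bar>- ln (T.mass s x) - T.rate * n\<bar> > e * n. T.mass s x)"
      if "0 < e" for e :: real
      using reg that by (simp add: T.regular_def T.atyp_def)
    have "level_entropy K \<sigma> n \<omega> = - (\<Sum>x\<in>lvl K n. T.mass s x * ln (T.mass s x))" for n
      unfolding level_entropy_def lvl_def using mass cyl by simp
    moreover have "(\<lambda>n. - (\<Sum>x\<in>lvl K n. T.mass s x * ln (T.mass s x)) / n) \<longlonglongrightarrow> T.rate"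
    proof (rule entropy_rate_of_typical)
      show "0 < T.mass s x" if "x \<in> words K" for x by (rule T.mass_pos[OF reg that])
      show "(\<Sum>x\<in>lvl K n. T.mass s x) = 1" for n
        using sum_lvl_flow[OF T.mass_split[OF reg] Nil_in_words, of n] T.mass_root[OF reg] by simp
      show "(\<lambda>n. \<Sum>x | x \<in> lvl K n \<and> \<bar>- ln (T.mass s x) - T.rate * n\<bar> > e * n. T.mass s x) \<longlonglongrightarrow> 0"
        if "0 < e" for e :: real
        using typical[OF that] by (rule summable_LIMSEQ_zero)
    qed
    ultimately have h: "h = T.rate" using LIMSEQ_unique[OF elim(2)] by simp
    have "hausdorff_dim K \<Lambda> \<nu> = ereal (h / (- ln \<Lambda>))"
      unfolding h by (rule dims_of_typical(1)[OF \<Lambda> \<nu> mass T.mass_pos[OF reg] typical])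
    moreover have "packing_dim K \<Lambda> \<nu> = ereal (h / (- ln \<Lambda>))"
      unfolding h by (rule dims_of_typical(2)[OF \<Lambda> \<nu> mass T.mass_pos[OF reg] typical])
    moreover have "AE x in \<nu>. has_local_dim K \<Lambda> \<nu> x (ereal (h / (- ln \<Lambda>)))"
      unfolding h by (rule dims_of_typical(3)[OF \<Lambda> \<nu> mass T.mass_pos[OF reg] typical])
    ultimately show ?case by (simp only: \<nu>_def conj_absorb simp_thms)
  qed
qed

end
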